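(* Let $\lambda$ be an infinite regular cardinal, let $\mathcal{R}$ be a small additive category with $\lambda$-small products, and let $\mathcal{M}$ be the category of left $\mathcal{R}$-modules. For any left $\mathcal{R}$-module $M\in\mathcal{M}$, the following are equivalent. (a) $M$ preserves $\lambda$-small products. (b) The category $\mathrm{Pres}_\omega(\mathcal{M})/M$ is $\lambda$-filtered. (c) $M$ is a $\lambda$-directed colimit of finitely presented modules.
   Context: A left $\mathcal{R}$-module is an additive functor $\mathcal{R}\to\mathrm{Ab}$. $\mathrm{Pres}_\omega(\mathcal{M})$ is the full subcategory of finitely presented modules in $\mathcal{M}$, and $\mathrm{Pres}_\omega(\mathcal{M})/M$ is the comma category whose objects are morphisms $P\to M$ in $\mathcal{M}$ with $P$ finitely presented, and whose morphisms are commuting triangles over $M$. A $\lambda$-small product is one indexed by a set of cardinality $<\lambda$. *)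

theory Defs
  imports "HOL-Algebra.Coset"
begin

unbundle cardinal_syntax

section \<open>Categories and functors\<close>

text \<open>
  Hom-sets are indexed by their end points and need not be disjoint, so composition and functors
  take the end points as arguments: \<open>Cmp C x y z g f\<close> is \<open>g \<circ> f\<close> for \<open>f : x \<rightarrow> y\<close>, \<open>g : y \<rightarrow> z\<close>,
  and \<open>Ar F x y f\<close> is the image of \<open>f : x \<rightarrow> y\<close>.
\<close>

record ('o, 'h) cat =
  Obj :: "'o set"
  Hom :: "'o \<Rightarrow> 'o \<Rightarrow> 'h set"
  Id  :: "'o \<Rightarrow> 'h"
  Cmp :: "'o \<Rightarrow> 'o \<Rightarrow> 'o \<Rightarrow> 'h \<Rightarrow> 'h \<Rightarrow> 'h"

definition category :: "('o, 'h, 'z) cat_scheme \<Rightarrow> bool" where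
  "category C \<longleftrightarrow>
    (\<forall>x\<in>Obj C. Id C x \<in> Hom C x x) \<and>
    (\<forall>x\<in>Obj C. \<forall>y\<in>Obj C. \<forall>z\<in>Obj C. \<forall>f\<in>Hom C x y. \<forall>g\<in>Hom C y z.
       Cmp C x y z g f \<in> Hom C x z) \<and>
    (\<forall>x\<in>Obj C. \<forall>y\<in>Obj C. \<forall>f\<in>Hom C x y.
       Cmp C x x y f (Id C x) = f \<and> Cmp C x y y (Id C y) f = f) \<and>
    (\<forall>w\<in>Obj C. \<forall>x\<in>Obj C. \<forall>y\<in>Obj C. \<forall>z\<in>Obj C.
       \<forall>f\<in>Hom C w x. \<forall>g\<in>Hom C x y. \<forall>h\<in>Hom C y z.
       Cmp C w y z h (Cmp C w x y g f) = Cmp C w x z (Cmp C x y z h g) f)"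

definition arrows :: "('o, 'h, 'z) cat_scheme \<Rightarrow> ('o \<times> 'o \<times> 'h) set" where
  "arrows C = {(x, y, f). x \<in> Obj C \<and> y \<in> Obj C \<and> f \<in> Hom C x y}"

record ('a, 'f, 'b, 'g) ftor =
  Ob :: "'a \<Rightarrow> 'b"
  Ar :: "'a \<Rightarrow> 'a \<Rightarrow> 'f \<Rightarrow> 'g"

definition is_functor ::
    "('a, 'f, 'y) cat_scheme \<Rightarrow> ('b, 'g, 'z) cat_scheme \<Rightarrow> ('a, 'f, 'b, 'g) ftor \<Rightarrow> bool" where
  "is_functor C D F \<longleftrightarrow>
    (\<forall>x\<in>Obj C. Ob F x \<in> Obj D) \<and>
    (\<forall>x\<in>Obj C. \<forall>y\<in>Obj C. \<forall>f\<in>Hom C x y. Ar F x y f \<in> Hom D (Ob F x) (Ob F y)) \<and>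
    (\<forall>x\<in>Obj C. Ar F x x (Id C x) = Id D (Ob F x)) \<and>
    (\<forall>x\<in>Obj C. \<forall>y\<in>Obj C. \<forall>z\<in>Obj C. \<forall>f\<in>Hom C x y. \<forall>g\<in>Hom C y z.
       Ar F x z (Cmp C x y z g f) = Cmp D (Ob F x) (Ob F y) (Ob F z) (Ar F y z g) (Ar F x y f))"

definition is_cocone ::
    "('a, 'f, 'y) cat_scheme \<Rightarrow> ('b, 'g, 'z) cat_scheme \<Rightarrow> ('a, 'f, 'b, 'g) ftor \<Rightarrow> 'b \<Rightarrow>
     ('a \<Rightarrow> 'g) \<Rightarrow> bool" where
  "is_cocone J C D n c \<longleftrightarrow>
    n \<in> Obj C \<and>
    (\<forall>j\<in>Obj J. c j \<in> Hom C (Ob D j) n) \<and>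
    (\<forall>i\<in>Obj J. \<forall>j\<in>Obj J. \<forall>u\<in>Hom J i j. Cmp C (Ob D i) (Ob D j) n (c j) (Ar D i j u) = c i)"

definition is_colimit ::
    "('a, 'f, 'y) cat_scheme \<Rightarrow> ('b, 'g, 'z) cat_scheme \<Rightarrow> ('a, 'f, 'b, 'g) ftor \<Rightarrow> 'b \<Rightarrow>
     ('a \<Rightarrow> 'g) \<Rightarrow> bool" where
  "is_colimit J C D m c \<longleftrightarrow>
    is_cocone J C D m c \<and>
    (\<forall>n d. is_cocone J C D n d \<longrightarrow>
       (\<exists>!h. h \<in> Hom C m n \<and> (\<forall>j\<in>Obj J. Cmp C (Ob D j) m n h (c j) = d j)))"

definition is_product ::
    "('o, 'h, 'z) cat_scheme \<Rightarrow> 'i set \<Rightarrow> ('i \<Rightarrow> 'o) \<Rightarrow> 'o \<Rightarrow> ('i \<Rightarrow> 'h) \<Rightarrow> bool" where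
  "is_product C S X p \<pi> \<longleftrightarrow>
    (\<forall>s\<in>S. X s \<in> Obj C) \<and> p \<in> Obj C \<and> (\<forall>s\<in>S. \<pi> s \<in> Hom C p (X s)) \<and>
    (\<forall>q\<in>Obj C. \<forall>\<rho>. (\<forall>s\<in>S. \<rho> s \<in> Hom C q (X s)) \<longrightarrow>
       (\<exists>!h. h \<in> Hom C q p \<and> (\<forall>s\<in>S. Cmp C q p (X s) (\<pi> s) h = \<rho> s)))"

text \<open>
  A cardinal is a relation \<open>\<kappa> :: 'l rel\<close> with \<open>Card_order \<kappa>\<close>. Every set of cardinality \<open>< \<kappa>\<close> is
  equipotent to a subset of \<open>'l\<close>, so it is enough to consider products indexed by sets
  \<open>S :: 'l set\<close> and diagrams of shape \<open>J :: ('l, 'l) cat\<close>.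
\<close>

definition has_small_products :: "'l rel \<Rightarrow> ('o, 'h, 'z) cat_scheme \<Rightarrow> bool" where
  "has_small_products \<kappa> C \<longleftrightarrow>
    (\<forall>(S :: 'l set) X. |S| <o \<kappa> \<and> (\<forall>s\<in>S. X s \<in> Obj C) \<longrightarrow> (\<exists>p \<pi>. is_product C S X p \<pi>))"

definition preserves_small_products ::
    "'l rel \<Rightarrow> ('a, 'f, 'y) cat_scheme \<Rightarrow> ('b, 'g, 'z) cat_scheme \<Rightarrow> ('a, 'f, 'b, 'g) ftor \<Rightarrow> bool"
  where
  "preserves_small_products \<kappa> C D F \<longleftrightarrow>
    (\<forall>(S :: 'l set) X p \<pi>. |S| <o \<kappa> \<and> is_product C S X p \<pi> \<longrightarrow>
       is_product D S (\<lambda>s. Ob F (X s)) (Ob F p) (\<lambda>s. Ar F p (X s) (\<pi> s)))"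

definition filtered_category :: "'l rel \<Rightarrow> ('o, 'h, 'z) cat_scheme \<Rightarrow> bool" where
  "filtered_category \<kappa> C \<longleftrightarrow>
    (\<forall>(J :: ('l, 'l) cat) D. category J \<and> |arrows J| <o \<kappa> \<and> is_functor J C D \<longrightarrow>
       (\<exists>n c. is_cocone J C D n c))"

definition directed_poset :: "'l rel \<Rightarrow> 'i set \<Rightarrow> 'i rel \<Rightarrow> bool" where
  "directed_poset \<kappa> I r \<longleftrightarrow>
    partial_order_on I r \<and> (\<forall>S\<subseteq>I. |S| <o \<kappa> \<longrightarrow> (\<exists>u\<in>I. \<forall>s\<in>S. (s, u) \<in> r))"

definition poset_cat :: "'i set \<Rightarrow> 'i rel \<Rightarrow> ('i, unit) cat" where
  "poset_cat I r =
    \<lparr>Obj = I, Hom = (\<lambda>i j. if (i, j) \<in> r then {()} else {}),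
     Id = (\<lambda>i. ()), Cmp = (\<lambda>i j k v u. ())\<rparr>"

text \<open>The comma category \<open>A/m\<close>, where the set of objects \<open>A\<close> stands for a full subcategory of \<open>C\<close>.\<close>

definition comma :: "('o, 'h, 'z) cat_scheme \<Rightarrow> 'o set \<Rightarrow> 'o \<Rightarrow> ('o \<times> 'h, 'h) cat" where
  "comma C A m =
    \<lparr>Obj = {(p, f). p \<in> Obj C \<and> p \<in> A \<and> f \<in> Hom C p m},
     Hom = (\<lambda>(p, f) (q, g). {t \<in> Hom C p q. Cmp C p q m g t = f}),
     Id = (\<lambda>(p, f). Id C p),
     Cmp = (\<lambda>(p, f) (q, g) (r, h). Cmp C p q r)\<rparr>"

section \<open>Additive categories\<close>

record ('o, 'h) acat = "('o, 'h) cat" +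
  Plus :: "'o \<Rightarrow> 'o \<Rightarrow> 'h \<Rightarrow> 'h \<Rightarrow> 'h"
  Nul  :: "'o \<Rightarrow> 'o \<Rightarrow> 'h"

text \<open>Abelian groups are written multiplicatively, as \<^const>\<open>comm_group\<close>.\<close>

definition hom_group :: "('o, 'h, 'z) acat_scheme \<Rightarrow> 'o \<Rightarrow> 'o \<Rightarrow> 'h monoid" where
  "hom_group C x y = \<lparr>carrier = Hom C x y, mult = Plus C x y, one = Nul C x y\<rparr>"

definition preadditive :: "('o, 'h, 'z) acat_scheme \<Rightarrow> bool" where
  "preadditive C \<longleftrightarrow>
    category C \<and>
    (\<forall>x\<in>Obj C. \<forall>y\<in>Obj C. comm_group (hom_group C x y)) \<and>
    (\<forall>x\<in>Obj C. \<forall>y\<in>Obj C. \<forall>z\<in>Obj C. \<forall>f\<in>Hom C x y. \<forall>f'\<in>Hom C x y. \<forall>g\<in>Hom C y z. \<forall>g'\<in>Hom C y z.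
       Cmp C x y z g (Plus C x y f f') = Plus C x z (Cmp C x y z g f) (Cmp C x y z g f') \<and>
       Cmp C x y z (Plus C y z g g') f = Plus C x z (Cmp C x y z g f) (Cmp C x y z g' f))"

definition zero_object :: "('o, 'h, 'z) cat_scheme \<Rightarrow> 'o \<Rightarrow> bool" where
  "zero_object C z \<longleftrightarrow>
    z \<in> Obj C \<and> (\<forall>x\<in>Obj C. (\<exists>!f. f \<in> Hom C x z) \<and> (\<exists>!f. f \<in> Hom C z x))"

definition is_biproduct ::
    "('o, 'h, 'z) acat_scheme \<Rightarrow> 'o \<Rightarrow> 'o \<Rightarrow> 'o \<Rightarrow> 'h \<Rightarrow> 'h \<Rightarrow> 'h \<Rightarrow> 'h \<Rightarrow> bool" where
  "is_biproduct C x y s i j p q \<longleftrightarrow>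
    s \<in> Obj C \<and>
    i \<in> Hom C x s \<and> j \<in> Hom C y s \<and> p \<in> Hom C s x \<and> q \<in> Hom C s y \<and>
    Cmp C x s x p i = Id C x \<and> Cmp C y s y q j = Id C y \<and>
    Plus C s s (Cmp C s x s i p) (Cmp C s y s j q) = Id C s"

definition additive_category :: "('o, 'h, 'z) acat_scheme \<Rightarrow> bool" where
  "additive_category C \<longleftrightarrow>
    preadditive C \<and> (\<exists>z. zero_object C z) \<and>
    (\<forall>x\<in>Obj C. \<forall>y\<in>Obj C. \<exists>s i j p q. is_biproduct C x y s i j p q)"

definition additive_functor ::
    "('a, 'f, 'y) acat_scheme \<Rightarrow> ('b, 'g, 'z) acat_scheme \<Rightarrow> ('a, 'f, 'b, 'g) ftor \<Rightarrow> bool" where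
  "additive_functor C D F \<longleftrightarrow>
    is_functor C D F \<and>
    (\<forall>x\<in>Obj C. \<forall>y\<in>Obj C. Ar F x y \<in> hom (hom_group C x y) (hom_group D (Ob F x) (Ob F y)))"

section \<open>Abelian groups and modules\<close>

text \<open>
  A homomorphism is represented by the function that is \<^const>\<open>undefined\<close> outside its domain, so
  that equality of morphisms is equality in HOL. The two groups may live in different types.
\<close>

definition ab_hom :: "'a monoid \<Rightarrow> 'b monoid \<Rightarrow> ('a \<Rightarrow> 'b) set" where
  "ab_hom G H = hom G H \<inter> extensional (carrier G)"

definition Ab :: "('u monoid, 'u \<Rightarrow> 'u) acat" where
  "Ab =
    \<lparr>Obj = {G. comm_group G},
     Hom = ab_hom,
     Id = (\<lambda>G. \<lambda>a\<in>carrier G. a),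
     Cmp = (\<lambda>G H K g f. compose (carrier G) g f),
     Plus = (\<lambda>G H f g. \<lambda>a\<in>carrier G. f a \<otimes>\<^bsub>H\<^esub> g a),
     Nul = (\<lambda>G H. \<lambda>a\<in>carrier G. \<one>\<^bsub>H\<^esub>)\<rparr>"

type_synonym ('o, 'h, 'u) module = "('o, 'h, 'u monoid, 'u \<Rightarrow> 'u) ftor"

definition left_module :: "('o, 'h, 'z) acat_scheme \<Rightarrow> ('o, 'h, 'u) module \<Rightarrow> bool" where
  "left_module R M \<longleftrightarrow> additive_functor R Ab M"

text \<open>Module homomorphisms are the natural transformations.\<close>

definition module_hom ::
    "('o, 'h, 'z) acat_scheme \<Rightarrow> ('o, 'h, 'u) module \<Rightarrow> ('o, 'h, 'v) module \<Rightarrow> ('o \<Rightarrow> 'u \<Rightarrow> 'v) set"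
  where
  "module_hom R M N =
    {t \<in> (\<Pi>\<^sub>E x\<in>Obj R. ab_hom (Ob M x) (Ob N x)).
       \<forall>x\<in>Obj R. \<forall>y\<in>Obj R. \<forall>f\<in>Hom R x y. \<forall>a\<in>carrier (Ob M x).
         t y (Ar M x y f a) = Ar N x y f (t x a)}"

definition LMod :: "('o, 'h, 'z) acat_scheme \<Rightarrow> (('o, 'h, 'u) module, 'o \<Rightarrow> 'u \<Rightarrow> 'u) cat" where
  "LMod R =
    \<lparr>Obj = {M. left_module R M},
     Hom = module_hom R,
     Id = (\<lambda>M. \<lambda>x\<in>Obj R. \<lambda>a\<in>carrier (Ob M x). a),
     Cmp = (\<lambda>L M N t s. \<lambda>x\<in>Obj R. compose (carrier (Ob L x)) (t x) (s x))\<rparr>"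

definition representable :: "('o, 'h, 'z) acat_scheme \<Rightarrow> 'o \<Rightarrow> ('o, 'h, 'h) module" where
  "representable R x =
    \<lparr>Ob = hom_group R x,
     Ar = (\<lambda>y z f. \<lambda>g\<in>Hom R x y. Cmp R x y z f g)\<rparr>"

text \<open>
  \<open>P\<close> is finitely presented if there is an exact sequence \<open>R(y, -) \<rightarrow> R(x, -) \<rightarrow> P \<rightarrow> 0\<close>.
  The finitely generated free modules are the finite direct sums of representable functors;
  as \<open>R\<close> is additive, these are again representable, so single objects \<open>x\<close> and \<open>y\<close> suffice.
\<close>

definition finitely_presented ::
    "('o, 'h, 'z) acat_scheme \<Rightarrow> ('o, 'h, 'u) module \<Rightarrow> bool" where
  "finitely_presented R P \<longleftrightarrow>
    left_module R P \<and>
    (\<exists>x\<in>Obj R. \<exists>y\<in>Obj R.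
     \<exists>\<alpha> \<in> module_hom R (representable R y) (representable R x).
     \<exists>\<pi> \<in> module_hom R (representable R x) P.
       \<forall>z\<in>Obj R.
         \<pi> z ` carrier (Ob (representable R x) z) = carrier (Ob P z) \<and>
         kernel (Ob (representable R x) z) (Ob P z) (\<pi> z) =
           \<alpha> z ` carrier (Ob (representable R y) z))"

section \<open>Size\<close>

text \<open>
  The category of abelian groups is that of groups whose carrier is a subset of a type \<open>'u\<close>, and
  a set is called small if it embeds into \<open>'u\<close>. The only closure properties required of this
  universe are that it is infinite and that products of fewer than \<open>\<kappa>\<close> small sets are small.
  For any types \<open>'a\<close> and \<open>'l\<close> (\<open>'a\<close> infinite) the type \<open>('a \<times> 'l) set\<close> is such a universe for
  each \<open>\<kappa> :: 'l rel\<close>, so a given small category and given abelian groups always fit into one.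
\<close>

definition universe :: "'l rel \<Rightarrow> 'u set \<Rightarrow> bool" where
  "universe \<kappa> U \<longleftrightarrow> infinite U \<and> (\<forall>S :: 'l set. |S| <o \<kappa> \<longrightarrow> |S \<rightarrow>\<^sub>E U| \<le>o |U| )"

definition small_category :: "'u set \<Rightarrow> ('o, 'h, 'z) cat_scheme \<Rightarrow> bool" where
  "small_category U C \<longleftrightarrow> |arrows C| \<le>o |U|"

text \<open>The shape of the colimit is a small poset, so it may be taken on a subset of \<open>'u\<close>.\<close>

definition directed_colimit_of_fp ::
    "'l rel \<Rightarrow> ('o, 'h, 'z) acat_scheme \<Rightarrow> ('o, 'h, 'u) module \<Rightarrow> bool" where
  "directed_colimit_of_fp \<kappa> R M \<longleftrightarrow>
    (\<exists>(I :: 'u set) r D c.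
       directed_poset \<kappa> I r \<and> is_functor (poset_cat I r) (LMod R) D \<and>
       (\<forall>i\<in>I. finitely_presented R (Ob D i)) \<and>
       is_colimit (poset_cat I r) (LMod R) D M c)"

end

theory Submission
  imports Defs "HOL-Library.Nat_Bijection"
begin

text \<open>
  The proof works with elements of modules. By the Yoneda lemma a finitely presented module \<open>P\<close> is
  given by an element \<open>\<xi> \<in> P(x)\<close> that generates it and an arrow \<open>f : x \<rightarrow> y\<close> whose multiples \<open>h \<circ> f\<close>
  are the coefficients that kill \<open>\<xi>\<close> (\<open>presents\<close>), and \<open>M\<close> preserves a product if a family of
  elements over the factors comes from exactly one element over the product (\<open>elt_product\<close>).

  Two facts carry the proof. Finitely presented modules preserve all products
  (\<open>presents_elt_product\<close>), because coefficients and the multiples that express relations can both be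
  chosen one factor at a time. And every small system of elements of modules, related by arrows of
  \<open>R\<close>, has a universal solution that is finitely presented, universal among the product preserving
  modules (\<open>exists_graph_module\<close>): products in \<open>R\<close> merge all generators into one and all relations
  into one.

  If \<open>M\<close> preserves small products, a small diagram of finitely presented modules over \<open>M\<close>
  determines a small graph of elements of \<open>M\<close>, and the universal solution of this graph is the vertex
  of a cocone; so (a) implies (b), see \<open>filtered_category_comma\<close>. The universal solutions of all small
  graphs of elements of \<open>M\<close>, ordered by inclusion, form a directed system with colimit \<open>M\<close>; so (a)
  implies (c), see \<open>directed_colimit_of_subgraphs\<close>.

  Conversely, in (b) a cocone on representables over \<open>M\<close> is a finitely presented \<open>P \<rightarrow> M\<close> to which
  elements of \<open>M\<close>, and finally also equations between them, can be lifted; there the product property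
  of \<open>P\<close> applies (\<open>filtered_comma_elt_preserving\<close>). In (c) the colimit is computed on elements
  (\<open>colimit_surj\<close>, \<open>colimit_eq\<close>), so a small family of elements or equations already lives at one
  stage of the colimit, which again preserves products (\<open>directed_colimit_elt_preserving\<close>).
\<close>

section \<open>Modules element by element\<close>

abbreviation elts :: "('o, 'h, 'u) module \<Rightarrow> 'o \<Rightarrow> 'u set" where
  "elts N x \<equiv> carrier (Ob N x)"

lemma hom_group_simps [simp]:
  "carrier (hom_group C x y) = Hom C x y" "mult (hom_group C x y) = Plus C x y"
  "one (hom_group C x y) = Nul C x y"
  by (simp_all add: hom_group_def)

locale preadditive_cat =
  fixes R :: "('o, 'h, 'z) acat_scheme"
  assumes preadditive: "preadditive R"
begin

lemma category: "category R"
  using preadditive by (simp add: preadditive_def)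

lemma Id_in: "x \<in> Obj R \<Longrightarrow> Id R x \<in> Hom R x x"
  using category by (simp add: category_def)

lemma Cmp_in:
  "\<lbrakk>x \<in> Obj R; y \<in> Obj R; z \<in> Obj R; f \<in> Hom R x y; g \<in> Hom R y z\<rbrakk> \<Longrightarrow> Cmp R x y z g f \<in> Hom R x z"
  using category by (simp add: category_def)

lemma Cmp_Id_right: "\<lbrakk>x \<in> Obj R; y \<in> Obj R; f \<in> Hom R x y\<rbrakk> \<Longrightarrow> Cmp R x x y f (Id R x) = f"
  using category by (simp add: category_def)

lemma Cmp_Id_left: "\<lbrakk>x \<in> Obj R; y \<in> Obj R; f \<in> Hom R x y\<rbrakk> \<Longrightarrow> Cmp R x y y (Id R y) f = f"
  using category by (simp add: category_def)

lemma Cmp_assoc: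
  "\<lbrakk>w \<in> Obj R; x \<in> Obj R; y \<in> Obj R; z \<in> Obj R; f \<in> Hom R w x; g \<in> Hom R x y; h \<in> Hom R y z\<rbrakk> \<Longrightarrow>
    Cmp R w y z h (Cmp R w x y g f) = Cmp R w x z (Cmp R x y z h g) f"
  using category by (simp add: category_def)

lemma comm_group_hom: "\<lbrakk>x \<in> Obj R; y \<in> Obj R\<rbrakk> \<Longrightarrow> comm_group (hom_group R x y)"
  using preadditive by (simp add: preadditive_def)

lemma Cmp_Plus_right:
  "\<lbrakk>x \<in> Obj R; y \<in> Obj R; z \<in> Obj R; f \<in> Hom R x y; f' \<in> Hom R x y; g \<in> Hom R y z\<rbrakk> \<Longrightarrow>
    Cmp R x y z g (Plus R x y f f') = Plus R x z (Cmp R x y z g f) (Cmp R x y z g f')"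
  using preadditive by (simp add: preadditive_def)

lemma Cmp_Plus_left:
  "\<lbrakk>x \<in> Obj R; y \<in> Obj R; z \<in> Obj R; f \<in> Hom R x y; g \<in> Hom R y z; g' \<in> Hom R y z\<rbrakk> \<Longrightarrow>
    Cmp R x y z (Plus R y z g g') f = Plus R x z (Cmp R x y z g f) (Cmp R x y z g' f)"
  using preadditive by (simp add: preadditive_def)

lemma Nul_in: "\<lbrakk>x \<in> Obj R; y \<in> Obj R\<rbrakk> \<Longrightarrow> Nul R x y \<in> Hom R x y"
  using comm_group.axioms(1)[OF comm_group_hom] comm_group_hom[THEN comm_groupE(2)] by fastforce

lemma Plus_in: "\<lbrakk>x \<in> Obj R; y \<in> Obj R; f \<in> Hom R x y; g \<in> Hom R x y\<rbrakk> \<Longrightarrow> Plus R x y f g \<in> Hom R x y"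
  using comm_group_hom[THEN comm_groupE(1)] by fastforce

lemma Cmp_right_group_hom:
  assumes "x \<in> Obj R" "y \<in> Obj R" "z \<in> Obj R" "g \<in> Hom R y z"
  shows "group_hom (hom_group R x y) (hom_group R x z) (Cmp R x y z g)"
  using assms comm_group_hom[THEN comm_group.axioms(2)]
  by (auto simp: group_hom_def group_hom_axioms_def hom_def Cmp_in Cmp_Plus_right)

lemma Cmp_left_group_hom:
  assumes "x \<in> Obj R" "y \<in> Obj R" "z \<in> Obj R" "f \<in> Hom R x y"
  shows "group_hom (hom_group R y z) (hom_group R x z) (\<lambda>g. Cmp R x y z g f)"
  using assms comm_group_hom[THEN comm_group.axioms(2)]
  by (auto simp: group_hom_def group_hom_axioms_def hom_def Cmp_in Cmp_Plus_left)

definition Minus :: "'o \<Rightarrow> 'o \<Rightarrow> 'h \<Rightarrow> 'h \<Rightarrow> 'h" where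
  "Minus x y f g = Plus R x y f (inv\<^bsub>hom_group R x y\<^esub> g)"

lemma Minus_in: "\<lbrakk>x \<in> Obj R; y \<in> Obj R; f \<in> Hom R x y; g \<in> Hom R x y\<rbrakk> \<Longrightarrow> Minus x y f g \<in> Hom R x y"
  using group.inv_closed[OF comm_group.axioms(2)[OF comm_group_hom], of x y g]
  by (simp add: Minus_def Plus_in)

lemma Cmp_Minus_right:
  assumes "x \<in> Obj R" "y \<in> Obj R" "z \<in> Obj R" "f \<in> Hom R x y" "f' \<in> Hom R x y" "g \<in> Hom R y z"
  shows "Cmp R x y z g (Minus x y f f') = Minus x z (Cmp R x y z g f) (Cmp R x y z g f')"
proof -
  interpret group_hom "hom_group R x y" "hom_group R x z" "Cmp R x y z g"
    using assms by (intro Cmp_right_group_hom)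
  show ?thesis
    using assms hom_inv[of f'] hom_mult[of f "inv\<^bsub>hom_group R x y\<^esub> f'"] G.inv_closed[of f']
    by (simp add: Minus_def)
qed

end

locale lmodule = preadditive_cat R for R :: "('o, 'h, 'z) acat_scheme" +
  fixes N :: "('o, 'h, 'u) module"
  assumes left_module: "left_module R N"
begin

lemma comm_group_Ob: "x \<in> Obj R \<Longrightarrow> comm_group (Ob N x)"
  using left_module by (simp add: left_module_def additive_functor_def is_functor_def Ab_def)

lemma group_Ob: "x \<in> Obj R \<Longrightarrow> group (Ob N x)"
  by (simp add: comm_group_Ob comm_group.axioms(2))

lemma Ar_ab_hom:
  "\<lbrakk>x \<in> Obj R; y \<in> Obj R; f \<in> Hom R x y\<rbrakk> \<Longrightarrow> Ar N x y f \<in> ab_hom (Ob N x) (Ob N y)"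
  using left_module by (simp add: left_module_def additive_functor_def is_functor_def Ab_def)

lemma Ar_group_hom:
  "\<lbrakk>x \<in> Obj R; y \<in> Obj R; f \<in> Hom R x y\<rbrakk> \<Longrightarrow> group_hom (Ob N x) (Ob N y) (Ar N x y f)"
  using Ar_ab_hom group_Ob by (fastforce simp: group_hom_def group_hom_axioms_def ab_hom_def)

lemma Ar_in:
  "\<lbrakk>x \<in> Obj R; y \<in> Obj R; f \<in> Hom R x y; a \<in> elts N x\<rbrakk> \<Longrightarrow> Ar N x y f a \<in> elts N y"
  using group_hom.hom_closed[OF Ar_group_hom] .

lemma Ar_mult:
  "\<lbrakk>x \<in> Obj R; y \<in> Obj R; f \<in> Hom R x y; a \<in> elts N x; b \<in> elts N x\<rbrakk> \<Longrightarrow>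
    Ar N x y f (a \<otimes>\<^bsub>Ob N x\<^esub> b) = Ar N x y f a \<otimes>\<^bsub>Ob N y\<^esub> Ar N x y f b"
  using group_hom.hom_mult[OF Ar_group_hom] .

lemma Ar_one:
  "\<lbrakk>x \<in> Obj R; y \<in> Obj R; f \<in> Hom R x y\<rbrakk> \<Longrightarrow> Ar N x y f \<one>\<^bsub>Ob N x\<^esub> = \<one>\<^bsub>Ob N y\<^esub>"
  using group_hom.hom_one[OF Ar_group_hom] .

lemma Ar_Id: "\<lbrakk>x \<in> Obj R; a \<in> elts N x\<rbrakk> \<Longrightarrow> Ar N x x (Id R x) a = a"
  using left_module by (simp add: left_module_def additive_functor_def is_functor_def Ab_def)

lemma Ar_Cmp:
  "\<lbrakk>x \<in> Obj R; y \<in> Obj R; z \<in> Obj R; f \<in> Hom R x y; g \<in> Hom R y z; a \<in> elts N x\<rbrakk> \<Longrightarrow>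
    Ar N x z (Cmp R x y z g f) a = Ar N y z g (Ar N x y f a)"
  using left_module
  by (simp add: left_module_def additive_functor_def is_functor_def Ab_def compose_def)

lemma Ar_Plus:
  assumes "x \<in> Obj R" "y \<in> Obj R" "f \<in> Hom R x y" "g \<in> Hom R x y" "a \<in> elts N x"
  shows "Ar N x y (Plus R x y f g) a = Ar N x y f a \<otimes>\<^bsub>Ob N y\<^esub> Ar N x y g a"
proof -
  have "Ar N x y \<in> hom (hom_group R x y) (hom_group Ab (Ob N x) (Ob N y))"
    using left_module assms by (simp add: left_module_def additive_functor_def)
  from hom_mult[OF this, of f g] show ?thesis
    using assms by (simp add: Ab_def)
qed

lemma Ar_arrow_group_hom:
  assumes "x \<in> Obj R" "y \<in> Obj R" "a \<in> elts N x"
  shows "group_hom (hom_group R x y) (Ob N y) (\<lambda>f. Ar N x y f a)"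
  using assms comm_group_hom[THEN comm_group.axioms(2)] group_Ob
  by (auto simp: group_hom_def group_hom_axioms_def hom_def Ar_in Ar_Plus)

lemma Ar_Nul:
  "\<lbrakk>x \<in> Obj R; y \<in> Obj R; a \<in> elts N x\<rbrakk> \<Longrightarrow> Ar N x y (Nul R x y) a = \<one>\<^bsub>Ob N y\<^esub>"
  using group_hom.hom_one[OF Ar_arrow_group_hom] by simp

lemma Ar_Minus:
  assumes "x \<in> Obj R" "y \<in> Obj R" "f \<in> Hom R x y" "g \<in> Hom R x y" "a \<in> elts N x"
  shows "Ar N x y (Minus x y f g) a = Ar N x y f a \<otimes>\<^bsub>Ob N y\<^esub> inv\<^bsub>Ob N y\<^esub> Ar N x y g a"
proof -
  interpret group_hom "hom_group R x y" "Ob N y" "\<lambda>f. Ar N x y f a"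
    using assms by (intro Ar_arrow_group_hom)
  show ?thesis
    using assms hom_inv[of g] hom_mult[of f "inv\<^bsub>hom_group R x y\<^esub> g"] G.inv_closed[of g]
    by (simp add: Minus_def)
qed

lemma Ar_Minus_eq_one_iff:
  assumes "x \<in> Obj R" "y \<in> Obj R" "f \<in> Hom R x y" "g \<in> Hom R x y" "a \<in> elts N x"
  shows "Ar N x y (Minus x y f g) a = \<one>\<^bsub>Ob N y\<^esub> \<longleftrightarrow> Ar N x y f a = Ar N x y g a"
proof -
  interpret group "Ob N y" using assms by (intro group_Ob)
  show ?thesis
    using assms Ar_in inv_equality[of "Ar N x y f a" "inv\<^bsub>Ob N y\<^esub> Ar N x y g a"]
    by (auto simp: Ar_Minus)
qed

end

context preadditive_cat
begin

lemma left_moduleI: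
  assumes "\<And>x. x \<in> Obj R \<Longrightarrow> comm_group (Ob N x)"
    and "\<And>x y f. \<lbrakk>x \<in> Obj R; y \<in> Obj R; f \<in> Hom R x y\<rbrakk> \<Longrightarrow> Ar N x y f \<in> extensional (elts N x)"
    and "\<And>x y f a. \<lbrakk>x \<in> Obj R; y \<in> Obj R; f \<in> Hom R x y; a \<in> elts N x\<rbrakk> \<Longrightarrow>
      Ar N x y f a \<in> elts N y"
    and "\<And>x y f a b. \<lbrakk>x \<in> Obj R; y \<in> Obj R; f \<in> Hom R x y; a \<in> elts N x; b \<in> elts N x\<rbrakk> \<Longrightarrow>
      Ar N x y f (a \<otimes>\<^bsub>Ob N x\<^esub> b) = Ar N x y f a \<otimes>\<^bsub>Ob N y\<^esub> Ar N x y f b"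
    and "\<And>x a. \<lbrakk>x \<in> Obj R; a \<in> elts N x\<rbrakk> \<Longrightarrow> Ar N x x (Id R x) a = a"
    and "\<And>x y z f g a. \<lbrakk>x \<in> Obj R; y \<in> Obj R; z \<in> Obj R; f \<in> Hom R x y; g \<in> Hom R y z; a \<in> elts N x\<rbrakk> \<Longrightarrow>
      Ar N x z (Cmp R x y z g f) a = Ar N y z g (Ar N x y f a)"
    and "\<And>x y f g a. \<lbrakk>x \<in> Obj R; y \<in> Obj R; f \<in> Hom R x y; g \<in> Hom R x y; a \<in> elts N x\<rbrakk> \<Longrightarrow>
      Ar N x y (Plus R x y f g) a = Ar N x y f a \<otimes>\<^bsub>Ob N y\<^esub> Ar N x y g a"
  shows "left_module R N"
proof -
  have *: "Ar N x y f \<in> ab_hom (Ob N x) (Ob N y)" if "x \<in> Obj R" "y \<in> Obj R" "f \<in> Hom R x y" for x y f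
    using that assms(2-4) by (auto simp: ab_hom_def hom_def)
  have "Ar N x x (Id R x) = (\<lambda>a\<in>elts N x. a)" if "x \<in> Obj R" for x
    using assms(2,5) Id_in that by (intro extensionalityI[of _ "elts N x"]) auto
  moreover have "Ar N x z (Cmp R x y z g f) = compose (elts N x) (Ar N y z g) (Ar N x y f)"
    if "x \<in> Obj R" "y \<in> Obj R" "z \<in> Obj R" "f \<in> Hom R x y" "g \<in> Hom R y z" for x y z f g
    using assms(2,6) Cmp_in that
    by (intro extensionalityI[of _ "elts N x"]) (auto simp: compose_def)
  moreover have "Ar N x y (Plus R x y f g) = (\<lambda>a\<in>elts N x. Ar N x y f a \<otimes>\<^bsub>Ob N y\<^esub> Ar N x y g a)"
    if "x \<in> Obj R" "y \<in> Obj R" "f \<in> Hom R x y" "g \<in> Hom R x y" for x y f g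
    using assms(2,7) Plus_in that by (intro extensionalityI[of _ "elts N x"]) auto
  ultimately show ?thesis
    using assms(1) *
    by (simp add: left_module_def additive_functor_def is_functor_def Ab_def hom_def[of "hom_group _ _ _"])
qed

lemma lmodule: "left_module R N \<Longrightarrow> lmodule R N"
  by unfold_locales

lemma left_module_representable:
  assumes "x \<in> Obj R"
  shows "left_module R (representable R x)"
  using assms
  by (intro left_moduleI)
     (auto simp: representable_def comm_group_hom Cmp_in Cmp_Plus_right Cmp_Plus_left Cmp_Id_left Cmp_assoc Plus_in)

end

section \<open>Module homomorphisms\<close>

lemma module_hom_in:
  "\<lbrakk>t \<in> module_hom R M N; x \<in> Obj R; a \<in> elts M x\<rbrakk> \<Longrightarrow> t x a \<in> elts N x"
  by (fastforce simp: module_hom_def ab_hom_def hom_def PiE_def Pi_def)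

lemma module_hom_mult:
  "\<lbrakk>t \<in> module_hom R M N; x \<in> Obj R; a \<in> elts M x; b \<in> elts M x\<rbrakk> \<Longrightarrow>
    t x (a \<otimes>\<^bsub>Ob M x\<^esub> b) = t x a \<otimes>\<^bsub>Ob N x\<^esub> t x b"
  by (fastforce simp: module_hom_def ab_hom_def hom_def PiE_def Pi_def)

lemma module_hom_Ar:
  "\<lbrakk>t \<in> module_hom R M N; x \<in> Obj R; y \<in> Obj R; f \<in> Hom R x y; a \<in> elts M x\<rbrakk> \<Longrightarrow>
    t y (Ar M x y f a) = Ar N x y f (t x a)"
  by (simp add: module_hom_def)

lemma module_homI:
  assumes "t \<in> extensional (Obj R)" "\<And>x. x \<in> Obj R \<Longrightarrow> t x \<in> extensional (elts M x)"
    and "\<And>x a. \<lbrakk>x \<in> Obj R; a \<in> elts M x\<rbrakk> \<Longrightarrow> t x a \<in> elts N x"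
    and "\<And>x a b. \<lbrakk>x \<in> Obj R; a \<in> elts M x; b \<in> elts M x\<rbrakk> \<Longrightarrow>
      t x (a \<otimes>\<^bsub>Ob M x\<^esub> b) = t x a \<otimes>\<^bsub>Ob N x\<^esub> t x b"
    and "\<And>x y f a. \<lbrakk>x \<in> Obj R; y \<in> Obj R; f \<in> Hom R x y; a \<in> elts M x\<rbrakk> \<Longrightarrow>
      t y (Ar M x y f a) = Ar N x y f (t x a)"
  shows "t \<in> module_hom R M N"
  using assms by (auto simp: module_hom_def ab_hom_def hom_def PiE_def)

lemma module_hom_eqI:
  assumes "s \<in> module_hom R M N" "t \<in> module_hom R M N"
    and "\<And>x a. \<lbrakk>x \<in> Obj R; a \<in> elts M x\<rbrakk> \<Longrightarrow> s x a = t x a"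
  shows "s = t"
proof (rule extensionalityI[of _ "Obj R"])
  show "s \<in> extensional (Obj R)" "t \<in> extensional (Obj R)"
    using assms(1,2) by (auto simp: module_hom_def PiE_def)
  show "s x = t x" if "x \<in> Obj R" for x
    using assms that
    by (intro extensionalityI[of _ "elts M x"]) (auto simp: module_hom_def ab_hom_def PiE_def Pi_def)
qed

lemma LMod_simps [simp]:
  "Obj (LMod R) = {M. left_module R M}"
  "Hom (LMod R) = module_hom R"
  "\<lbrakk>x \<in> Obj R; a \<in> elts M x\<rbrakk> \<Longrightarrow> Id (LMod R) M x a = a"
  "\<lbrakk>x \<in> Obj R; a \<in> elts L x\<rbrakk> \<Longrightarrow> Cmp (LMod R) L M N t s x a = t x (s x a)"
  by (simp_all add: LMod_def compose_def)

context preadditive_cat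
begin

lemma module_hom_one:
  assumes "t \<in> module_hom R M N" "x \<in> Obj R" "left_module R M" "left_module R N"
  shows "t x \<one>\<^bsub>Ob M x\<^esub> = \<one>\<^bsub>Ob N x\<^esub>"
proof -
  have "group_hom (Ob M x) (Ob N x) (t x)"
    using assms(2) lmodule.group_Ob[OF lmodule[OF assms(3)]] lmodule.group_Ob[OF lmodule[OF assms(4)]]
      module_hom_in[OF assms(1,2)] module_hom_mult[OF assms(1,2)]
    by (auto simp: group_hom_def group_hom_axioms_def hom_def)
  then show ?thesis by (rule group_hom.hom_one)
qed

lemma module_hom_Id:
  assumes "left_module R M"
  shows "Id (LMod R) M \<in> module_hom R M M"
proof -
  interpret lmodule R M by (rule lmodule) fact
  show ?thesis
    by (rule module_homI) (auto simp: Ar_in LMod_def group.is_monoid[OF group_Ob, THEN monoid.m_closed])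
qed

lemma module_hom_Cmp:
  assumes "left_module R L" "s \<in> module_hom R L M" "t \<in> module_hom R M N"
  shows "Cmp (LMod R) L M N t s \<in> module_hom R L N"
proof -
  interpret lmodule R L by (rule lmodule) fact
  show ?thesis
    using assms(2,3)
    by (intro module_homI)
       (auto simp: Ar_in LMod_def compose_def module_hom_in module_hom_mult module_hom_Ar
          group.is_monoid[OF group_Ob, THEN monoid.m_closed])
qed

lemma category_LMod: "category (LMod R :: (('o, 'h, 'u) module, 'o \<Rightarrow> 'u \<Rightarrow> 'u) cat)"
  unfolding category_def
  by (auto intro!: module_hom_Id module_hom_Cmp module_hom_eqI[of _ R] simp: module_hom_in)

text \<open>
  Homomorphisms are mostly found as functional relations: \<open>T x a b\<close> says that \<open>a\<close> is built from
  generators in some way and \<open>b\<close> is built in the same way from their prescribed images.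
\<close>

lemma module_hom_of_relation:
  assumes M: "left_module R M"
    and total: "\<And>x a. \<lbrakk>x \<in> Obj R; a \<in> elts M x\<rbrakk> \<Longrightarrow> \<exists>b. T x a b"
    and unique: "\<And>x a b b'. \<lbrakk>x \<in> Obj R; T x a b; T x a b'\<rbrakk> \<Longrightarrow> b = b'"
    and closed: "\<And>x a b. \<lbrakk>x \<in> Obj R; T x a b\<rbrakk> \<Longrightarrow> a \<in> elts M x \<and> b \<in> elts N x"
    and mult: "\<And>x a b a' b'. \<lbrakk>x \<in> Obj R; T x a b; T x a' b'\<rbrakk> \<Longrightarrow> T x (a \<otimes>\<^bsub>Ob M x\<^esub> a') (b \<otimes>\<^bsub>Ob N x\<^esub> b')"
    and Ar: "\<And>x y f a b. \<lbrakk>x \<in> Obj R; y \<in> Obj R; f \<in> Hom R x y; T x a b\<rbrakk> \<Longrightarrow> T y (Ar M x y f a) (Ar N x y f b)"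
  obtains t where "t \<in> module_hom R M N" "\<And>x a b. \<lbrakk>x \<in> Obj R; T x a b\<rbrakk> \<Longrightarrow> t x a = b"
proof -
  interpret lmodule R M by (rule lmodule) fact
  define t where "t = (\<lambda>x\<in>Obj R. \<lambda>a\<in>elts M x. THE b. T x a b)"
  have t: "t x a = b" if "x \<in> Obj R" "T x a b" for x a b
    using that closed unique by (auto simp: t_def intro!: the_equality)
  have T: "T x a (t x a)" if "x \<in> Obj R" "a \<in> elts M x" for x a
    using that total t by blast
  have "t \<in> module_hom R M N"
  proof (rule module_homI)
    show "t \<in> extensional (Obj R)" by (simp add: t_def)
    show "t x \<in> extensional (elts M x)" if "x \<in> Obj R" for x
      using that by (simp add: t_def)
    show "t x a \<in> elts N x" if "x \<in> Obj R" "a \<in> elts M x" for x a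
      using closed[OF that(1) T[OF that]] by simp
  qed (blast intro: t T mult Ar)+
  with t show thesis by (rule that[rotated])
qed

section \<open>Finite presentations\<close>

text \<open>
  The group structure on the union of the images is forced by the condition that every \<open>v i x\<close> is
  a homomorphism, and directedness lets any three elements be computed with in a single \<open>D i\<close>, which
  gives the group axioms. With one module this builds quotients, with a directed system its colimit;
  the result lives in \<open>'u\<close> whatever the type \<open>'w\<close> of the given modules.
\<close>

lemma directed_quotient:
  fixes D :: "'i \<Rightarrow> ('o, 'h, 'w) module" and v :: "'i \<Rightarrow> 'o \<Rightarrow> 'w \<Rightarrow> 'u"
  assumes nonempty: "I \<noteq> {}"
    and D: "\<And>i. i \<in> I \<Longrightarrow> left_module R (D i)"
    and directed: "\<And>i j. \<lbrakk>i \<in> I; j \<in> I\<rbrakk> \<Longrightarrow> \<exists>k\<in>I. \<forall>x\<in>Obj R.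
      v i x ` elts (D i) x \<union> v j x ` elts (D j) x \<subseteq> v k x ` elts (D k) x"
    and v_mult: "\<And>i j x a b a' b'. \<lbrakk>i \<in> I; j \<in> I; x \<in> Obj R;
      a \<in> elts (D i) x; b \<in> elts (D i) x;
      a' \<in> elts (D j) x; b' \<in> elts (D j) x; v i x a = v j x a'; v i x b = v j x b'\<rbrakk> \<Longrightarrow>
      v i x (a \<otimes>\<^bsub>Ob (D i) x\<^esub> b) = v j x (a' \<otimes>\<^bsub>Ob (D j) x\<^esub> b')"
    and v_Ar: "\<And>i j x y f a a'. \<lbrakk>i \<in> I; j \<in> I; x \<in> Obj R; y \<in> Obj R; f \<in> Hom R x y;
      a \<in> elts (D i) x; a' \<in> elts (D j) x; v i x a = v j x a'\<rbrakk> \<Longrightarrow>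
      v i y (Ar (D i) x y f a) = v j y (Ar (D j) x y f a')"
  obtains N :: "('o, 'h, 'u) module" where "left_module R N"
    and "\<And>x. x \<in> Obj R \<Longrightarrow> elts N x = (\<Union>i\<in>I. v i x ` elts (D i) x)"
    and "\<And>i x a b. \<lbrakk>i \<in> I; x \<in> Obj R; a \<in> elts (D i) x; b \<in> elts (D i) x\<rbrakk> \<Longrightarrow>
      v i x a \<otimes>\<^bsub>Ob N x\<^esub> v i x b = v i x (a \<otimes>\<^bsub>Ob (D i) x\<^esub> b)"
    and "\<And>i x. \<lbrakk>i \<in> I; x \<in> Obj R\<rbrakk> \<Longrightarrow> \<one>\<^bsub>Ob N x\<^esub> = v i x \<one>\<^bsub>Ob (D i) x\<^esub>"
    and "\<And>i x y f a. \<lbrakk>i \<in> I; x \<in> Obj R; y \<in> Obj R; f \<in> Hom R x y; a \<in> elts (D i) x\<rbrakk> \<Longrightarrow>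
      Ar N x y f (v i x a) = v i y (Ar (D i) x y f a)"
proof -
  define U where "U x = (\<Union>i\<in>I. v i x ` elts (D i) x)" for x
  define m where "m x u w = (THE t. \<exists>i\<in>I. \<exists>a\<in>elts (D i) x. \<exists>b\<in>elts (D i) x.
    u = v i x a \<and> w = v i x b \<and> t = v i x (a \<otimes>\<^bsub>Ob (D i) x\<^esub> b))" for x u w
  define A where "A x y f u = (THE t. \<exists>i\<in>I. \<exists>a\<in>elts (D i) x.
    u = v i x a \<and> t = v i y (Ar (D i) x y f a))" for x y f u
  define e where "e x = v (SOME i. i \<in> I) x \<one>\<^bsub>Ob (D (SOME i. i \<in> I)) x\<^esub>" for x
  define N where "N = \<lparr>Ob = (\<lambda>x. \<lparr>carrier = U x, mult = m x, one = e x\<rparr>),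
    Ar = (\<lambda>x y f. \<lambda>u\<in>U x. A x y f u)\<rparr>"
  note modules = lmodule[OF D]
  note gr = lmodule.group_Ob[OF modules] lmodule.comm_group_Ob[OF modules]
  have U: "v i x a \<in> U x" if "i \<in> I" "a \<in> elts (D i) x" for i x a
    using that by (auto simp: U_def)
  have m: "m x (v i x a) (v i x b) = v i x (a \<otimes>\<^bsub>Ob (D i) x\<^esub> b)"
    if "i \<in> I" "x \<in> Obj R" "a \<in> elts (D i) x" "b \<in> elts (D i) x" for i x a b
    unfolding m_def
  proof (rule the_equality)
    fix t
    assume "\<exists>j\<in>I. \<exists>a'\<in>elts (D j) x. \<exists>b'\<in>elts (D j) x.
      v i x a = v j x a' \<and> v i x b = v j x b' \<and> t = v j x (a' \<otimes>\<^bsub>Ob (D j) x\<^esub> b')"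
    then obtain j a' b' where "j \<in> I" "a' \<in> elts (D j) x" "b' \<in> elts (D j) x"
      "v i x a = v j x a'" "v i x b = v j x b'" "t = v j x (a' \<otimes>\<^bsub>Ob (D j) x\<^esub> b')" by blast
    with v_mult[of i j x a b a' b'] that show "t = v i x (a \<otimes>\<^bsub>Ob (D i) x\<^esub> b)" by simp
  qed (use that in blast)
  have A: "A x y f (v i x a) = v i y (Ar (D i) x y f a)"
    if "i \<in> I" "x \<in> Obj R" "y \<in> Obj R" "f \<in> Hom R x y" "a \<in> elts (D i) x" for i x y f a
    unfolding A_def
  proof (rule the_equality)
    fix t
    assume "\<exists>j\<in>I. \<exists>a'\<in>elts (D j) x. v i x a = v j x a' \<and> t = v j y (Ar (D j) x y f a')"
    then obtain j a' where "j \<in> I" "a' \<in> elts (D j) x"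
      "v i x a = v j x a'" "t = v j y (Ar (D j) x y f a')" by blast
    with v_Ar[of i j x y f a a'] that show "t = v i y (Ar (D i) x y f a)" by simp
  qed (use that in blast)
  have two: "\<exists>i\<in>I. \<exists>a\<in>elts (D i) x. \<exists>b\<in>elts (D i) x. u = v i x a \<and> w = v i x b"
    if x: "x \<in> Obj R" and uw: "u \<in> U x" "w \<in> U x" for x u w
  proof -
    obtain i j where ij: "i \<in> I" "j \<in> I" and u: "u \<in> v i x ` elts (D i) x"
      and w: "w \<in> v j x ` elts (D j) x"
      using uw unfolding U_def by blast
    obtain k where k: "k \<in> I" and "v i x ` elts (D i) x \<subseteq> v k x ` elts (D k) x"
      "v j x ` elts (D j) x \<subseteq> v k x ` elts (D k) x"
      using directed[OF ij] x by auto
    then have "u \<in> v k x ` elts (D k) x" "w \<in> v k x ` elts (D k) x"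
      using u w by auto
    with k show ?thesis by blast
  qed
  have three: "\<exists>i\<in>I. \<exists>a\<in>elts (D i) x. \<exists>b\<in>elts (D i) x. \<exists>c\<in>elts (D i) x.
      u = v i x a \<and> w = v i x b \<and> t = v i x c"
    if x: "x \<in> Obj R" and uwt: "u \<in> U x" "w \<in> U x" "t \<in> U x" for x u w t
  proof -
    obtain i a b where i: "i \<in> I" and ab: "a \<in> elts (D i) x" "b \<in> elts (D i) x"
      and uw': "u = v i x a" "w = v i x b"
      using two[OF x uwt(1,2)] by blast
    obtain j where j: "j \<in> I" and t: "t \<in> v j x ` elts (D j) x"
      using uwt(3) unfolding U_def by blast
    obtain k where k: "k \<in> I" and "v i x ` elts (D i) x \<subseteq> v k x ` elts (D k) x"
      "v j x ` elts (D j) x \<subseteq> v k x ` elts (D k) x"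
      using directed[OF i j] x by auto
    then have "u \<in> v k x ` elts (D k) x" "w \<in> v k x ` elts (D k) x"
      "t \<in> v k x ` elts (D k) x"
      using t ab uw' by auto
    with k show ?thesis by blast
  qed
  have one: "v i x \<one>\<^bsub>Ob (D i) x\<^esub> = v k x \<one>\<^bsub>Ob (D k) x\<^esub>"
    if ik: "i \<in> I" "k \<in> I" "x \<in> Obj R" for i k x
  proof -
    have *: "v i x \<one>\<^bsub>Ob (D i) x\<^esub> = v k x \<one>\<^bsub>Ob (D k) x\<^esub>"
      if ik': "i \<in> I" "k \<in> I" and sub: "v i x ` elts (D i) x \<subseteq> v k x ` elts (D k) x" for i k
    proof -
      interpret Gi: group "Ob (D i) x" using gr(1)[OF ik'(1) ik(3)] .
      interpret Gk: group "Ob (D k) x" using gr(1)[OF ik'(2) ik(3)] .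
      obtain a where a: "a \<in> elts (D k) x" "v i x \<one>\<^bsub>Ob (D i) x\<^esub> = v k x a"
        using sub Gi.one_closed by blast
      have idem: "v k x a = v k x (a \<otimes>\<^bsub>Ob (D k) x\<^esub> a)"
        using v_mult[OF ik' ik(3) _ _ a(1) a(1) a(2) a(2)] a(2) by simp
      \<comment> \<open>Cancelling \<open>a\<close> in this idempotent identity is possible already before passing to \<open>N\<close>.\<close>
      have "v k x (a \<otimes>\<^bsub>Ob (D k) x\<^esub> inv\<^bsub>Ob (D k) x\<^esub> a) =
          v k x ((a \<otimes>\<^bsub>Ob (D k) x\<^esub> a) \<otimes>\<^bsub>Ob (D k) x\<^esub> inv\<^bsub>Ob (D k) x\<^esub> a)"
        by (rule v_mult) (use ik' ik a idem in auto)
      then show ?thesis using a by (simp add: Gk.m_assoc)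
    qed
    obtain l where l: "l \<in> I"
      "v i x ` elts (D i) x \<subseteq> v l x ` elts (D l) x"
      "v k x ` elts (D k) x \<subseteq> v l x ` elts (D l) x"
      using directed[OF ik(1,2)] ik(3) by auto
    show ?thesis using *[OF ik(1) l(1,2)] *[OF ik(2) l(1) l(3)] by simp
  qed
  have e: "e x = v i x \<one>\<^bsub>Ob (D i) x\<^esub>" if "i \<in> I" "x \<in> Obj R" for i x
    unfolding e_def using nonempty that by (intro one) (simp_all add: some_in_eq)
  have N_simps: "elts N x = U x" "mult (Ob N x) = m x" "one (Ob N x) = e x"
    "Ar N x y f = (\<lambda>u\<in>U x. A x y f u)" for x y f
    by (simp_all add: N_def)
  have comm: "comm_group (Ob N x)" if x: "x \<in> Obj R" for x
  proof (rule comm_groupI; unfold N_simps)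
    fix u w assume uw: "u \<in> U x" "w \<in> U x"
    obtain i a b where i: "i \<in> I" "a \<in> elts (D i) x" "b \<in> elts (D i) x" "u = v i x a" "w = v i x b"
      using two[OF x uw] by blast
    interpret comm_group "Ob (D i) x" using gr(2)[OF i(1) x] .
    show "m x u w \<in> U x" "m x u w = m x w u"
      using i x by (simp_all add: m U m_comm)
  next
    fix u w t assume uwt: "u \<in> U x" "w \<in> U x" "t \<in> U x"
    obtain i a b c where i: "i \<in> I" "a \<in> elts (D i) x" "b \<in> elts (D i) x" "c \<in> elts (D i) x"
      "u = v i x a" "w = v i x b" "t = v i x c"
      using three[OF x uwt] by blast
    interpret comm_group "Ob (D i) x" using gr(2)[OF i(1) x] .
    show "m x (m x u w) t = m x u (m x w t)"
      using i x by (simp add: m m_assoc)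
  next
    obtain i where i: "i \<in> I" using nonempty by blast
    interpret comm_group "Ob (D i) x" using gr(2)[OF i(1) x] .
    show "e x \<in> U x" using i x by (simp add: e U)
  next
    fix u assume u: "u \<in> U x"
    obtain i a where i: "i \<in> I" "a \<in> elts (D i) x" "u = v i x a"
      using two[OF x u u] by blast
    interpret comm_group "Ob (D i) x" using gr(2)[OF i(1) x] .
    show "m x (e x) u = u" using i x by (simp add: m e)
    show "\<exists>w\<in>U x. m x w u = e x"
      using i x by (intro bexI[of _ "v i x (inv\<^bsub>Ob (D i) x\<^esub> a)"]) (simp_all add: m e U)
  qed
  have "left_module R N"
  proof (rule left_moduleI; (unfold N_simps)?)
    fix x y f u assume *: "x \<in> Obj R" "y \<in> Obj R" "f \<in> Hom R x y" "u \<in> U x"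
    obtain i a where i: "i \<in> I" "a \<in> elts (D i) x" "u = v i x a"
      using two[OF *(1,4,4)] by blast
    interpret lmodule R "D i" using modules[OF i(1)] .
    show "restrict (A x y f) (U x) u \<in> U y"
      using * i by (simp add: A U Ar_in)
  next
    fix x y f u w assume *: "x \<in> Obj R" "y \<in> Obj R" "f \<in> Hom R x y" "u \<in> U x" "w \<in> U x"
    obtain i a b where i: "i \<in> I" "a \<in> elts (D i) x" "b \<in> elts (D i) x" "u = v i x a" "w = v i x b"
      using two[OF *(1,4,5)] by blast
    interpret lmodule R "D i" using modules[OF i(1)] .
    interpret comm_group "Ob (D i) x" using comm_group_Ob[OF *(1)] .
    show "restrict (A x y f) (U x) (m x u w) = m y (restrict (A x y f) (U x) u) (restrict (A x y f) (U x) w)"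
      using * i by (simp add: A U m Ar_in Ar_mult)
  next
    fix x u assume *: "x \<in> Obj R" "u \<in> U x"
    obtain i a where i: "i \<in> I" "a \<in> elts (D i) x" "u = v i x a"
      using two[OF *(1,2,2)] by blast
    interpret lmodule R "D i" using modules[OF i(1)] .
    show "restrict (A x x (Id R x)) (U x) u = u"
      using * i by (simp add: A U Ar_Id Id_in)
  next
    fix x y z f g u
    assume *: "x \<in> Obj R" "y \<in> Obj R" "z \<in> Obj R" "f \<in> Hom R x y" "g \<in> Hom R y z" "u \<in> U x"
    obtain i a where i: "i \<in> I" "a \<in> elts (D i) x" "u = v i x a"
      using two[OF *(1,6,6)] by blast
    interpret lmodule R "D i" using modules[OF i(1)] .
    show "restrict (A x z (Cmp R x y z g f)) (U x) u = restrict (A y z g) (U y) (restrict (A x y f) (U x) u)"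
      using * i by (simp add: A U Ar_in Ar_Cmp Cmp_in)
  next
    fix x y f g u
    assume *: "x \<in> Obj R" "y \<in> Obj R" "f \<in> Hom R x y" "g \<in> Hom R x y" "u \<in> U x"
    obtain i a where i: "i \<in> I" "a \<in> elts (D i) x" "u = v i x a"
      using two[OF *(1,5,5)] by blast
    interpret lmodule R "D i" using modules[OF i(1)] .
    show "restrict (A x y (Plus R x y f g)) (U x) u = m y (restrict (A x y f) (U x) u) (restrict (A x y g) (U x) u)"
      using * i by (simp add: A U m Ar_in Ar_Plus Plus_in)
  qed (use comm in auto)
  then show thesis
    by (rule that) (auto simp: N_simps U_def[symmetric] m e A U)
qed

text \<open>
  By the Yoneda lemma, an epimorphism \<open>R(x, -) \<rightarrow> P\<close> with kernel the image of \<open>R(y, -)\<close> is an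
  element \<open>\<xi>\<close> of \<open>P(x)\<close> that generates \<open>P\<close> and whose relations are the multiples of one arrow \<open>f\<close>.
\<close>

definition presents :: "'o \<Rightarrow> 'o \<Rightarrow> 'h \<Rightarrow> ('o, 'h, 'u) module \<Rightarrow> 'u \<Rightarrow> bool" where
  "presents x y f P \<xi> \<longleftrightarrow>
    left_module R P \<and> x \<in> Obj R \<and> y \<in> Obj R \<and> f \<in> Hom R x y \<and> \<xi> \<in> elts P x \<and>
    (\<forall>z\<in>Obj R. \<forall>a\<in>elts P z. \<exists>g\<in>Hom R x z. a = Ar P x z g \<xi>) \<and>
    (\<forall>z\<in>Obj R. \<forall>g\<in>Hom R x z. Ar P x z g \<xi> = \<one>\<^bsub>Ob P z\<^esub> \<longleftrightarrow> (\<exists>h\<in>Hom R y z. g = Cmp R x y z h f))"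

lemma presentsD:
  assumes "presents x y f P \<xi>"
  shows "left_module R P" "x \<in> Obj R" "y \<in> Obj R" "f \<in> Hom R x y" "\<xi> \<in> elts P x"
    "\<lbrakk>z \<in> Obj R; a \<in> elts P z\<rbrakk> \<Longrightarrow> \<exists>g\<in>Hom R x z. a = Ar P x z g \<xi>"
    "\<lbrakk>z \<in> Obj R; g \<in> Hom R x z\<rbrakk> \<Longrightarrow>
      Ar P x z g \<xi> = \<one>\<^bsub>Ob P z\<^esub> \<longleftrightarrow> (\<exists>h\<in>Hom R y z. g = Cmp R x y z h f)"
  using assms unfolding presents_def by blast+

lemma presents_relation:
  assumes "presents x y f P \<xi>"
  shows "Ar P x y f \<xi> = \<one>\<^bsub>Ob P y\<^esub>"
  using presentsD[OF assms] Id_in Cmp_Id_left by metis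

lemma representable_simps:
  "Ob (representable R x) y = hom_group R x y"
  "g \<in> Hom R x y \<Longrightarrow> Ar (representable R x) y z f g = Cmp R x y z f g"
  by (simp_all add: representable_def)

lemma module_hom_representable:
  assumes "t \<in> module_hom R (representable R x) N" "x \<in> Obj R" "z \<in> Obj R" "g \<in> Hom R x z"
  shows "t z g = Ar N x z g (t x (Id R x))"
  using module_hom_Ar[OF assms(1), of x z g "Id R x"] assms
  by (simp add: representable_simps Id_in Cmp_Id_right)

lemma module_hom_representableI:
  assumes "left_module R N" "x \<in> Obj R" "n \<in> elts N x"
  shows "(\<lambda>z\<in>Obj R. \<lambda>g\<in>Hom R x z. Ar N x z g n) \<in> module_hom R (representable R x) N"
proof -
  interpret lmodule R N by (rule lmodule) fact
  show ?thesis
    using assms by (intro module_homI) (auto simp: representable_simps Ar_in Ar_Plus Plus_in Ar_Cmp Cmp_in)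
qed

lemma finitely_presented_iff_presents:
  "finitely_presented R P \<longleftrightarrow> (\<exists>x y f \<xi>. presents x y f P \<xi>)"
proof
  assume fp: "finitely_presented R P"
  then obtain x y \<alpha> \<pi> where P: "left_module R P" and xy: "x \<in> Obj R" "y \<in> Obj R"
    and \<alpha>: "\<alpha> \<in> module_hom R (representable R y) (representable R x)"
    and \<pi>: "\<pi> \<in> module_hom R (representable R x) P"
    and exact: "\<forall>z\<in>Obj R. \<pi> z ` elts (representable R x) z = elts P z \<and>
         kernel (Ob (representable R x) z) (Ob P z) (\<pi> z) = \<alpha> z ` elts (representable R y) z"
    using fp[unfolded finitely_presented_def] by (elim conjE bexE) (rule that)
  define f \<xi> where "f = \<alpha> y (Id R y)" and "\<xi> = \<pi> x (Id R x)"
  have f: "f \<in> Hom R x y" and \<xi>: "\<xi> \<in> elts P x"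
    using module_hom_in[OF \<alpha> xy(2)] module_hom_in[OF \<pi> xy(1)] Id_in xy
    by (auto simp: f_def \<xi>_def representable_simps)
  have \<alpha>_eq: "\<alpha> z h = Cmp R x y z h f" if "z \<in> Obj R" "h \<in> Hom R y z" for z h
    using module_hom_representable[OF \<alpha> xy(2) that] f by (simp add: f_def representable_simps)
  have \<pi>_eq: "\<pi> z g = Ar P x z g \<xi>" if "z \<in> Obj R" "g \<in> Hom R x z" for z g
    using module_hom_representable[OF \<pi> xy(1) that] by (simp add: \<xi>_def)
  have surj: "\<exists>g\<in>Hom R x z. a = Ar P x z g \<xi>" if "z \<in> Obj R" "a \<in> elts P z" for z a
  proof -
    have "a \<in> \<pi> z ` Hom R x z" using exact that by (simp add: representable_simps)
    then show ?thesis using \<pi>_eq[OF that(1)] by blast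
  qed
  have ker: "Ar P x z g \<xi> = \<one>\<^bsub>Ob P z\<^esub> \<longleftrightarrow> (\<exists>h\<in>Hom R y z. g = Cmp R x y z h f)"
    if "z \<in> Obj R" "g \<in> Hom R x z" for z g
  proof -
    have "Ar P x z g \<xi> = \<one>\<^bsub>Ob P z\<^esub> \<longleftrightarrow> g \<in> kernel (Ob (representable R x) z) (Ob P z) (\<pi> z)"
      using that by (simp add: kernel_def representable_simps \<pi>_eq)
    also have "\<dots> \<longleftrightarrow> g \<in> \<alpha> z ` Hom R y z" using exact that by (simp add: representable_simps)
    also have "\<dots> \<longleftrightarrow> (\<exists>h\<in>Hom R y z. g = Cmp R x y z h f)"
      using \<alpha>_eq[OF that(1)] by (auto simp: image_iff)
    finally show ?thesis .
  qed
  have "presents x y f P \<xi>"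
    unfolding presents_def using P xy f \<xi> surj ker by blast
  then show "\<exists>x y f \<xi>. presents x y f P \<xi>" by blast
next
  assume "\<exists>x y f \<xi>. presents x y f P \<xi>"
  then obtain x y f \<xi> where pres: "presents x y f P \<xi>" by blast
  note P = presentsD(1)[OF pres] and xy = presentsD(2,3)[OF pres] and f = presentsD(4)[OF pres]
    and \<xi> = presentsD(5)[OF pres] and surj = presentsD(6)[OF pres] and ker = presentsD(7)[OF pres]
  interpret lmodule R P by (rule lmodule) fact
  have *: "(\<lambda>g\<in>Hom R x z. Ar P x z g \<xi>) ` Hom R x z = elts P z \<and>
      kernel (hom_group R x z) (Ob P z) (\<lambda>g\<in>Hom R x z. Ar P x z g \<xi>) =
      (\<lambda>g\<in>Hom R y z. Ar (representable R x) y z g f) ` Hom R y z" if z: "z \<in> Obj R" for z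
  proof
    show "(\<lambda>g\<in>Hom R x z. Ar P x z g \<xi>) ` Hom R x z = elts P z"
      using surj[OF z] Ar_in[OF xy(1) z _ \<xi>] by auto
    show "kernel (hom_group R x z) (Ob P z) (\<lambda>g\<in>Hom R x z. Ar P x z g \<xi>) =
      (\<lambda>g\<in>Hom R y z. Ar (representable R x) y z g f) ` Hom R y z"
      using ker[OF z] Cmp_in[OF xy z f] f by (auto simp: kernel_def representable_simps)
  qed
  let ?\<alpha> = "\<lambda>z\<in>Obj R. \<lambda>g\<in>Hom R y z. Ar (representable R x) y z g f"
    and ?\<pi> = "\<lambda>z\<in>Obj R. \<lambda>g\<in>Hom R x z. Ar P x z g \<xi>"
  have \<alpha>: "?\<alpha> \<in> module_hom R (representable R y) (representable R x)"
    using xy f by (intro module_hom_representableI left_module_representable) (simp_all add: representable_simps)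
  have \<pi>: "?\<pi> \<in> module_hom R (representable R x) P"
    using P xy \<xi> by (intro module_hom_representableI)
  have exact: "\<forall>z\<in>Obj R. ?\<pi> z ` elts (representable R x) z = elts P z \<and>
      kernel (Ob (representable R x) z) (Ob P z) (?\<pi> z) = ?\<alpha> z ` elts (representable R y) z"
    using * by (simp add: representable_simps)
  show "finitely_presented R P"
    unfolding finitely_presented_def
    by (rule conjI[OF P], rule bexI[OF _ xy(1)], rule bexI[OF _ xy(2)], rule bexI[OF _ \<alpha>],
        rule bexI[OF _ \<pi>], rule exact)
qed

text \<open>
  The module is the quotient of \<open>R(x, -)\<close> by the image of \<open>R(y, -)\<close>. A coset is coded in \<open>'u\<close> through a
  chosen representative, which is possible as \<open>R\<close> is small.
\<close>

lemma exists_presents: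
  assumes small: "|arrows R| \<le>o |UNIV :: 'u set|"
    and xy: "x \<in> Obj R" "y \<in> Obj R" and f: "f \<in> Hom R x y"
  obtains P :: "('o, 'h, 'u) module" and \<xi> where "presents x y f P \<xi>"
proof -
  obtain \<iota> :: "'o \<times> 'o \<times> 'h \<Rightarrow> 'u" where \<iota>: "inj_on \<iota> (arrows R)"
    using small card_of_ordLeq[of "arrows R" "UNIV :: 'u set"] by auto
  define H where "H z = (\<lambda>h. Cmp R x y z h f) ` Hom R y z" for z
  define C where "C z g = H z #>\<^bsub>hom_group R x z\<^esub> g" for z g
  define v where "v z g = \<iota> (x, z, SOME g'. g' \<in> C z g)" for z g
  have H: "subgroup (H z) (hom_group R x z)" if "z \<in> Obj R" for z
    using group_hom.img_is_subgroup[OF Cmp_left_group_hom[OF xy that f]] by (simp add: H_def)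
  have gr: "group (hom_group R x z)" if "z \<in> Obj R" for z
    using comm_group_hom[OF xy(1) that] by (rule comm_group.axioms(2))
  have H_sub: "H z \<subseteq> Hom R x z" if "z \<in> Obj R" for z
    using subgroup.subset[OF H[OF that]] by simp
  have C_self: "g \<in> C z g" if "z \<in> Obj R" "g \<in> Hom R x z" for z g
    using group.rcos_self[OF gr[OF that(1)] _ H[OF that(1)], of g] that by (simp add: C_def)
  have C_eq: "C z g = C z g'" if "z \<in> Obj R" "g' \<in> Hom R x z" "g \<in> C z g'" for z g g'
    using group.repr_independence[OF gr[OF that(1)] _ _ H[OF that(1)], of g g'] that by (simp add: C_def)
  have C_sub: "C z g \<subseteq> Hom R x z" if "z \<in> Obj R" "g \<in> Hom R x z" for z g
    using monoid.r_coset_subset_G[OF group.is_monoid[OF gr[OF that(1)]], of "H z" g] H_sub that by (simp add: C_def)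
  have v_iff: "v z g = v z g' \<longleftrightarrow> C z g = C z g'" if z: "z \<in> Obj R" and g: "g \<in> Hom R x z" "g' \<in> Hom R x z" for z g g'
  proof
    assume eq: "v z g = v z g'"
    let ?r = "SOME k. k \<in> C z g" and ?r' = "SOME k. k \<in> C z g'"
    have r: "?r \<in> C z g" "?r' \<in> C z g'"
      by (rule someI, rule C_self[OF z g(1)], rule someI, rule C_self[OF z g(2)])
    then have "(x, z, ?r) \<in> arrows R" "(x, z, ?r') \<in> arrows R"
      using C_sub z g xy by (auto simp: arrows_def)
    with eq \<iota> have "?r = ?r'" unfolding v_def by (auto dest: inj_onD)
    then have "C z ?r = C z ?r'" by (rule arg_cong)
    then show "C z g = C z g'" by (rule box_equals) (rule C_eq[OF z g(1) r(1)], rule C_eq[OF z g(2) r(2)])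
  qed (simp add: v_def)
  have C_mem: "g \<in> C z g' \<longleftrightarrow> (\<exists>h\<in>Hom R y z. g = Plus R x z (Cmp R x y z h f) g')" for z g g'
    by (auto simp: C_def H_def r_coset_def)
  obtain P :: "('o, 'h, 'u) module" where P: "left_module R P"
    and car: "\<And>z. z \<in> Obj R \<Longrightarrow> elts P z = v z ` Hom R x z"
    and one: "\<And>z. z \<in> Obj R \<Longrightarrow> \<one>\<^bsub>Ob P z\<^esub> = v z (Nul R x z)"
    and Ar: "\<And>z w k g. \<lbrakk>z \<in> Obj R; w \<in> Obj R; k \<in> Hom R z w; g \<in> Hom R x z\<rbrakk> \<Longrightarrow>
      Ar P z w k (v z g) = v w (Cmp R x z w k g)"
  proof (rule directed_quotient[of "UNIV :: unit set" "\<lambda>_. representable R x" "\<lambda>_. v"])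
    show "left_module R (representable R x)" by (rule left_module_representable) fact
  next
    fix z a b a' b'
    assume z: "z \<in> Obj R" and "a \<in> elts (representable R x) z" "b \<in> elts (representable R x) z"
      "a' \<in> elts (representable R x) z" "b' \<in> elts (representable R x) z"
      and v: "v z a = v z a'" "v z b = v z b'"
    then have ab: "a \<in> Hom R x z" "b \<in> Hom R x z" "a' \<in> Hom R x z" "b' \<in> Hom R x z"
      by (simp_all add: representable_simps)
    interpret comm_group "hom_group R x z" using comm_group_hom[OF xy(1) z] .
    interpret normal "H z" "hom_group R x z"
      by (rule subgroup_imp_normal[OF H[OF z]])
    have "C z (Plus R x z a b) = C z (Plus R x z a' b')"
      using rcos_sum[of a b] rcos_sum[of a' b'] ab v v_iff[OF z] by (simp add: C_def)
    then show "v z (a \<otimes>\<^bsub>Ob (representable R x) z\<^esub> b) = v z (a' \<otimes>\<^bsub>Ob (representable R x) z\<^esub> b')"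
      using ab z xy by (simp add: representable_simps v_iff Plus_in)
  next
    fix z w k a a'
    assume z: "z \<in> Obj R" "w \<in> Obj R" "k \<in> Hom R z w"
      and "a \<in> elts (representable R x) z" "a' \<in> elts (representable R x) z" "v z a = v z a'"
    then have a: "a \<in> Hom R x z" "a' \<in> Hom R x z" "C z a = C z a'"
      by (simp_all add: representable_simps v_iff)
    then obtain h where h: "h \<in> Hom R y z" "a = Plus R x z (Cmp R x y z h f) a'"
      using C_self[OF z(1) a(1)] C_mem by auto
    then have "Cmp R x z w k a = Plus R x w (Cmp R x y w (Cmp R y z w k h) f) (Cmp R x z w k a')"
      using xy z a(2) f by (simp add: Cmp_Plus_right Cmp_in Cmp_assoc)
    then have "Cmp R x z w k a \<in> C w (Cmp R x z w k a')"
      using Cmp_in[OF xy(2) z(1,2) h(1) z(3)] by (auto simp: C_mem)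
    then have "C w (Cmp R x z w k a) = C w (Cmp R x z w k a')"
      using xy z a by (intro C_eq Cmp_in)
    then show "v w (Ar (representable R x) z w k a) = v w (Ar (representable R x) z w k a')"
      using a z xy by (simp add: representable_simps v_iff Cmp_in)
  next
    fix P :: "('o, 'h, 'u) module"
    assume "left_module R P"
      "\<And>z. z \<in> Obj R \<Longrightarrow> elts P z = (\<Union>i\<in>(UNIV :: unit set). v z ` elts (representable R x) z)"
      "\<And>i z. \<lbrakk>i \<in> (UNIV :: unit set); z \<in> Obj R\<rbrakk> \<Longrightarrow> \<one>\<^bsub>Ob P z\<^esub> = v z \<one>\<^bsub>Ob (representable R x) z\<^esub>"
      "\<And>i z w k a. \<lbrakk>i \<in> (UNIV :: unit set); z \<in> Obj R; w \<in> Obj R; k \<in> Hom R z w; a \<in> elts (representable R x) z\<rbrakk> \<Longrightarrow>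
        Ar P z w k (v z a) = v w (Ar (representable R x) z w k a)"
    then show thesis by (intro that) (auto simp: representable_simps)
  qed auto
  have "presents x y f P (v x (Id R x))"
    unfolding presents_def
  proof (intro conjI ballI P xy f)
    show "v x (Id R x) \<in> elts P x" using car xy Id_in by auto
    have gen: "Ar P x z g (v x (Id R x)) = v z g" if "z \<in> Obj R" "g \<in> Hom R x z" for z g
      using Ar[OF xy(1) that Id_in[OF xy(1)]] that xy by (simp add: Cmp_Id_right)
    show "\<exists>g\<in>Hom R x z. a = Ar P x z g (v x (Id R x))" if "z \<in> Obj R" "a \<in> elts P z" for z a
      using that car gen by auto
    fix z g assume zg: "z \<in> Obj R" "g \<in> Hom R x z"
    interpret comm_group "hom_group R x z" using comm_group_hom[OF xy(1) zg(1)] .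
    have "Ar P x z g (v x (Id R x)) = \<one>\<^bsub>Ob P z\<^esub> \<longleftrightarrow> C z g = C z (Nul R x z)"
      using zg xy by (simp add: gen one v_iff Nul_in)
    also have "\<dots> \<longleftrightarrow> g \<in> C z (Nul R x z)"
      using C_self[OF zg] C_eq[OF zg(1) Nul_in[OF xy(1) zg(1)]] by blast
    also have "\<dots> \<longleftrightarrow> (\<exists>h\<in>Hom R y z. g = Cmp R x y z h f)"
      using Cmp_in[OF xy zg(1) f] r_one by (fastforce simp: C_mem)
    finally show "Ar P x z g (v x (Id R x)) = \<one>\<^bsub>Ob P z\<^esub> \<longleftrightarrow> (\<exists>h\<in>Hom R y z. g = Cmp R x y z h f)" .
  qed
  then show thesis by (rule that)
qed

text \<open>
  The element \<open>g \<cdot> \<xi>\<close> goes to \<open>g \<cdot> n\<close>. Two coefficients of the same element differ by a multiple of \<open>f\<close>, and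
  \<open>f\<close> kills \<open>n\<close>.
\<close>

lemma presents_hom:
  assumes P: "presents x y f P \<xi>" and N: "left_module R N"
    and n: "n \<in> elts N x" "Ar N x y f n = \<one>\<^bsub>Ob N y\<^esub>"
  obtains t where "t \<in> module_hom R P N" "t x \<xi> = n"
proof -
  note xy = presentsD(2,3)[OF P] and f = presentsD(4)[OF P] and \<xi> = presentsD(5)[OF P]
    and surj = presentsD(6)[OF P] and ker = presentsD(7)[OF P]
  interpret P: lmodule R P using P by (intro lmodule) (simp add: presents_def)
  interpret N: lmodule R N by (rule lmodule) fact
  define T where "T z a b \<longleftrightarrow> (\<exists>g\<in>Hom R x z. a = Ar P x z g \<xi> \<and> b = Ar N x z g n)" for z a b
  obtain t where t: "t \<in> module_hom R P N" "\<And>z a b. \<lbrakk>z \<in> Obj R; T z a b\<rbrakk> \<Longrightarrow> t z a = b"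
  proof (rule module_hom_of_relation[of P T N])
    show "left_module R P" by (rule P.left_module)
    show "\<exists>b. T z a b" if "z \<in> Obj R" "a \<in> elts P z" for z a
      using surj that unfolding T_def by blast
  next
    fix z a b b' assume z: "z \<in> Obj R" and "T z a b" "T z a b'"
    then obtain g g' where g: "g \<in> Hom R x z" "g' \<in> Hom R x z" "Ar P x z g \<xi> = Ar P x z g' \<xi>"
      and b: "b = Ar N x z g n" "b' = Ar N x z g' n" unfolding T_def by auto
    then have "Ar P x z (Minus x z g g') \<xi> = \<one>\<^bsub>Ob P z\<^esub>"
      using z xy \<xi> by (simp add: P.Ar_Minus_eq_one_iff)
    then obtain h where h: "h \<in> Hom R y z" "Minus x z g g' = Cmp R x y z h f"
      using ker[OF z Minus_in] g z xy by auto
    then have "Ar N x z (Minus x z g g') n = \<one>\<^bsub>Ob N z\<^esub>"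
      using z xy f n by (simp add: N.Ar_Cmp N.Ar_one)
    then show "b = b'" using g z xy n b by (simp add: N.Ar_Minus_eq_one_iff)
  next
    show "a \<in> elts P z \<and> b \<in> elts N z" if "z \<in> Obj R" "T z a b" for z a b
      using that xy \<xi> n P.Ar_in N.Ar_in unfolding T_def by blast
  next
    fix z a b a' b' assume z: "z \<in> Obj R" and "T z a b" "T z a' b'"
    then obtain g g' where g: "g \<in> Hom R x z" "g' \<in> Hom R x z" "a = Ar P x z g \<xi>" "a' = Ar P x z g' \<xi>"
      "b = Ar N x z g n" "b' = Ar N x z g' n" unfolding T_def by auto
    then show "T z (a \<otimes>\<^bsub>Ob P z\<^esub> a') (b \<otimes>\<^bsub>Ob N z\<^esub> b')"
      unfolding T_def using z xy \<xi> n
      by (intro bexI[of _ "Plus R x z g g'"]) (simp_all add: P.Ar_Plus N.Ar_Plus Plus_in)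
  next
    fix z w k a b assume z: "z \<in> Obj R" "w \<in> Obj R" "k \<in> Hom R z w" and "T z a b"
    then obtain g where g: "g \<in> Hom R x z" "a = Ar P x z g \<xi>" "b = Ar N x z g n" unfolding T_def by auto
    then show "T w (Ar P z w k a) (Ar N z w k b)"
      unfolding T_def using z xy \<xi> n
      by (intro bexI[of _ "Cmp R x z w k g"]) (simp_all add: P.Ar_Cmp N.Ar_Cmp Cmp_in)
  qed (rule that, blast+)
  have "T x \<xi> n" unfolding T_def
    using xy \<xi> n by (intro bexI[of _ "Id R x"]) (simp_all add: P.Ar_Id N.Ar_Id Id_in)
  with t xy that show thesis by blast
qed

lemma presents_hom_eqI:
  assumes P: "presents x y f P \<xi>" and s: "s \<in> module_hom R P N" and t: "t \<in> module_hom R P N"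
    and eq: "s x \<xi> = t x \<xi>"
  shows "s = t"
proof (rule module_hom_eqI[OF s t])
  fix z a assume z: "z \<in> Obj R" and "a \<in> elts P z"
  then obtain g where "g \<in> Hom R x z" "a = Ar P x z g \<xi>" using P unfolding presents_def by blast
  moreover have "x \<in> Obj R" "\<xi> \<in> elts P x" using P by (simp_all add: presents_def)
  ultimately show "s z a = t z a"
    using module_hom_Ar[OF s] module_hom_Ar[OF t] z eq by simp
qed

end

section \<open>Products\<close>

definition elt_product ::
    "('o, 'h, 'u) module \<Rightarrow> 'i set \<Rightarrow> ('i \<Rightarrow> 'o) \<Rightarrow> 'o \<Rightarrow> ('i \<Rightarrow> 'h) \<Rightarrow> bool" where
  "elt_product N S X p \<pi> \<longleftrightarrow>
    (\<forall>a. (\<forall>s\<in>S. a s \<in> elts N (X s)) \<longrightarrow>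
      (\<exists>!b. b \<in> elts N p \<and> (\<forall>s\<in>S. Ar N p (X s) (\<pi> s) b = a s)))"

lemma elt_productE:
  assumes "elt_product N S X p \<pi>" "\<And>s. s \<in> S \<Longrightarrow> a s \<in> elts N (X s)"
  obtains b where "b \<in> elts N p" "\<And>s. s \<in> S \<Longrightarrow> Ar N p (X s) (\<pi> s) b = a s"
  using assms unfolding elt_product_def by blast

lemma elt_product_eqI:
  assumes "elt_product N S X p \<pi>" "b \<in> elts N p" "b' \<in> elts N p"
    and "\<And>s. s \<in> S \<Longrightarrow> Ar N p (X s) (\<pi> s) b \<in> elts N (X s)"
    and "\<And>s. s \<in> S \<Longrightarrow> Ar N p (X s) (\<pi> s) b = Ar N p (X s) (\<pi> s) b'"
  shows "b = b'"
proof -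
  have "\<exists>!c. c \<in> elts N p \<and> (\<forall>s\<in>S. Ar N p (X s) (\<pi> s) c = Ar N p (X s) (\<pi> s) b)"
    by (rule mp[OF spec[OF assms(1)[unfolded elt_product_def]]]) (simp add: assms(4))
  then show ?thesis
    by (rule ex1E) (metis assms(2,3,5))
qed

lemma is_productD:
  assumes "is_product C S X p \<pi>"
  shows "p \<in> Obj C" "s \<in> S \<Longrightarrow> X s \<in> Obj C" "s \<in> S \<Longrightarrow> \<pi> s \<in> Hom C p (X s)"
  using assms by (auto simp: is_product_def)

lemma is_productE:
  assumes "is_product C S X p \<pi>" "q \<in> Obj C" "\<And>s. s \<in> S \<Longrightarrow> \<rho> s \<in> Hom C q (X s)"
  obtains h where "h \<in> Hom C q p" "\<And>s. s \<in> S \<Longrightarrow> Cmp C q p (X s) (\<pi> s) h = \<rho> s"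
  using assms unfolding is_product_def by blast

lemma is_product_eqI:
  assumes prod: "is_product C S X p \<pi>" and q: "q \<in> Obj C"
    and gh: "g \<in> Hom C q p" "h \<in> Hom C q p"
    and Cmp: "\<And>s. s \<in> S \<Longrightarrow> Cmp C q p (X s) (\<pi> s) h \<in> Hom C q (X s)"
    and eq: "\<And>s. s \<in> S \<Longrightarrow> Cmp C q p (X s) (\<pi> s) g = Cmp C q p (X s) (\<pi> s) h"
  shows "g = h"
proof -
  have "\<exists>!k. k \<in> Hom C q p \<and> (\<forall>s\<in>S. Cmp C q p (X s) (\<pi> s) k = Cmp C q p (X s) (\<pi> s) h)"
    using prod q Cmp unfolding is_product_def by simp
  with gh eq show ?thesis by blast
qed

text \<open>Only the cardinality of an index set matters.\<close>

lemma is_product_reindex: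
  assumes b: "bij_betw b T S" and prod: "is_product C T X p \<pi>"
  shows "is_product C S (\<lambda>s. X (the_inv_into T b s)) p (\<lambda>s. \<pi> (the_inv_into T b s))"
proof -
  let ?c = "the_inv_into T b"
  have c: "bij_betw ?c S T" by (rule bij_betw_the_inv_into[OF b])
  have ball: "(\<forall>s\<in>S. Q (?c s)) \<longleftrightarrow> (\<forall>t\<in>T. Q t)" for Q
    using bij_betw_imp_surj_on[OF c] by (metis imageE imageI)
  have bc: "b (?c s) = s" if "s \<in> S" for s
    using that f_the_inv_into_f_bij_betw[OF b] by simp
  have "\<exists>!h. h \<in> Hom C q p \<and> (\<forall>s\<in>S. Cmp C q p (X (?c s)) (\<pi> (?c s)) h = \<rho> s)"
    if "q \<in> Obj C" and \<rho>: "\<forall>s\<in>S. \<rho> s \<in> Hom C q (X (?c s))" for q \<rho>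
  proof -
    have "\<forall>s\<in>S. \<rho> (b (?c s)) \<in> Hom C q (X (?c s))" using \<rho> bc by simp
    then have "\<forall>t\<in>T. \<rho> (b t) \<in> Hom C q (X t)"
      by (rule iffD1[OF ball[of "\<lambda>t. \<rho> (b t) \<in> Hom C q (X t)"]])
    then have "\<exists>!h. h \<in> Hom C q p \<and> (\<forall>t\<in>T. Cmp C q p (X t) (\<pi> t) h = \<rho> (b t))"
      using prod that(1) unfolding is_product_def by simp
    moreover have "(\<forall>s\<in>S. Cmp C q p (X (?c s)) (\<pi> (?c s)) h = \<rho> s) \<longleftrightarrow>
        (\<forall>t\<in>T. Cmp C q p (X t) (\<pi> t) h = \<rho> (b t))" for h
      using ball[of "\<lambda>t. Cmp C q p (X t) (\<pi> t) h = \<rho> (b t)"] bc by simp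
    ultimately show ?thesis by simp
  qed
  moreover have "\<forall>s\<in>S. X (?c s) \<in> Obj C \<and> \<pi> (?c s) \<in> Hom C p (X (?c s))"
    using is_productD[OF prod] ball[of "\<lambda>t. X t \<in> Obj C \<and> \<pi> t \<in> Hom C p (X t)"] by simp
  ultimately show ?thesis
    using is_productD(1)[OF prod] unfolding is_product_def by simp
qed

lemma elt_product_reindex:
  assumes b: "bij_betw b T S"
    and prod: "elt_product N S (\<lambda>s. X (the_inv_into T b s)) p (\<lambda>s. \<pi> (the_inv_into T b s))"
  shows "elt_product N T X p \<pi>"
proof -
  let ?c = "the_inv_into T b"
  have ball: "(\<forall>s\<in>S. Q (?c s)) \<longleftrightarrow> (\<forall>t\<in>T. Q t)" for Q
    using bij_betw_imp_surj_on[OF bij_betw_the_inv_into[OF b]] by (metis imageE imageI)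
  show ?thesis
    unfolding elt_product_def
  proof (intro allI impI)
    fix a assume "\<forall>t\<in>T. a t \<in> elts N (X t)"
    then have "\<forall>s\<in>S. a (?c s) \<in> elts N (X (?c s))"
      by (rule iffD2[OF ball[of "\<lambda>t. a t \<in> elts N (X t)"]])
    then have "\<exists>!c. c \<in> elts N p \<and> (\<forall>s\<in>S. Ar N p (X (?c s)) (\<pi> (?c s)) c = a (?c s))"
      by (rule mp[OF spec[OF prod[unfolded elt_product_def]]])
    moreover have "(\<forall>s\<in>S. Ar N p (X (?c s)) (\<pi> (?c s)) c = a (?c s)) \<longleftrightarrow>
        (\<forall>t\<in>T. Ar N p (X t) (\<pi> t) c = a t)" for c
      by (rule ball)
    ultimately show "\<exists>!c. c \<in> elts N p \<and> (\<forall>t\<in>T. Ar N p (X t) (\<pi> t) c = a t)"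
      by simp
  qed
qed

text \<open>The integers, coded in \<open>'u\<close>, serve as a test object: a homomorphism from them picks an element.\<close>

lemma exists_infinite_cyclic_group:
  assumes "infinite (UNIV :: 'u set)"
  obtains Z :: "'u monoid" and e :: "int \<Rightarrow> 'u"
  where "comm_group Z" "carrier Z = range e"
    "\<forall>(G :: 'u monoid) a. group G \<longrightarrow> a \<in> carrier G \<longrightarrow> (\<exists>h\<in>ab_hom Z G. \<forall>n. h (e n) = a [^]\<^bsub>G\<^esub> n)"
proof -
  obtain e0 :: "nat \<Rightarrow> 'u" where "inj e0"
    using assms infinite_iff_countable_subset[of "UNIV :: 'u set"] by blast
  then have "inj (e0 \<circ> int_encode)" using inj_int_encode by (rule inj_compose)
  then obtain e :: "int \<Rightarrow> 'u" where e: "inj e" by blast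
  define d where "d = inv_into UNIV e"
  have d: "d (e n) = n" for n using e by (simp add: d_def)
  define Z where "Z = \<lparr>carrier = range e, mult = (\<lambda>u w. e (d u + d w)), one = e 0\<rparr>"
  have comm: "comm_group Z"
  proof (rule comm_groupI)
    fix u assume "u \<in> carrier Z"
    then obtain n where n: "u = e n" by (auto simp: Z_def)
    show "\<one>\<^bsub>Z\<^esub> \<otimes>\<^bsub>Z\<^esub> u = u" by (simp add: Z_def n d)
    show "\<exists>w\<in>carrier Z. w \<otimes>\<^bsub>Z\<^esub> u = \<one>\<^bsub>Z\<^esub>"
      by (rule bexI[of _ "e (- n)"]) (simp_all add: Z_def n d)
  qed (auto simp: Z_def d algebra_simps)
  have "\<exists>h\<in>ab_hom Z G. \<forall>n. h (e n) = a [^]\<^bsub>G\<^esub> n" if "group G" "a \<in> carrier G" for G :: "'u monoid" and a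
  proof -
    interpret group G by fact
    show ?thesis
      using that by (intro bexI[of _ "\<lambda>u\<in>range e. a [^]\<^bsub>G\<^esub> (d u)"])
        (auto simp: ab_hom_def hom_def Z_def d int_pow_mult)
  qed
  then show thesis using that[of Z e] comm by (simp add: Z_def)
qed

context preadditive_cat
begin

text \<open>
  Existence: the coefficients of the given elements with respect to \<open>\<xi>\<close> are the components of one
  coefficient. Uniqueness: if a coefficient \<open>d\<close> of \<open>\<xi>\<close> becomes a multiple \<open>h s \<circ> f\<close> of \<open>f\<close> in every factor,
  the \<open>h s\<close> are the components of one arrow \<open>k\<close>, and \<open>d = k \<circ> f\<close>.
\<close>

lemma presents_elt_product:
  assumes P: "presents x y f P \<xi>" and prod: "is_product R S X p \<pi>"
  shows "elt_product P S X p \<pi>"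
proof -
  note xy = presentsD(2,3)[OF P] and f = presentsD(4)[OF P] and \<xi> = presentsD(5)[OF P]
    and surj = presentsD(6)[OF P] and ker = presentsD(7)[OF P]
  interpret lmodule R P using P by (intro lmodule) (simp add: presents_def)
  note p = is_productD[OF prod]
  have unique: "b = b'" if b: "b \<in> elts P p" "b' \<in> elts P p"
    and eq: "\<And>s. s \<in> S \<Longrightarrow> Ar P p (X s) (\<pi> s) b = Ar P p (X s) (\<pi> s) b'" for b b'
  proof -
    obtain g g' where g: "g \<in> Hom R x p" "b = Ar P x p g \<xi>" and g': "g' \<in> Hom R x p" "b' = Ar P x p g' \<xi>"
      using surj[OF p(1)] b by blast
    let ?d = "Minus x p g g'"
    have d: "?d \<in> Hom R x p" using Minus_in xy p g g' by simp
    have "\<exists>h\<in>Hom R y (X s). Cmp R x p (X s) (\<pi> s) ?d = Cmp R x y (X s) h f" if s: "s \<in> S" for s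
    proof -
      have "Ar P x (X s) (Cmp R x p (X s) (\<pi> s) g) \<xi> = Ar P x (X s) (Cmp R x p (X s) (\<pi> s) g') \<xi>"
        using eq[OF s] g g' xy p s \<xi> by (simp add: Ar_Cmp)
      then have "Ar P x (X s) (Cmp R x p (X s) (\<pi> s) ?d) \<xi> = \<one>\<^bsub>Ob P (X s)\<^esub>"
        using g g' xy p s \<xi> by (simp add: Cmp_Minus_right Ar_Minus_eq_one_iff Cmp_in)
      then show ?thesis using ker d xy p s Cmp_in by simp
    qed
    then obtain h where h: "\<And>s. s \<in> S \<Longrightarrow> h s \<in> Hom R y (X s)"
      "\<And>s. s \<in> S \<Longrightarrow> Cmp R x p (X s) (\<pi> s) ?d = Cmp R x y (X s) (h s) f" by metis
    obtain k where k: "k \<in> Hom R y p" "\<And>s. s \<in> S \<Longrightarrow> Cmp R y p (X s) (\<pi> s) k = h s"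
      using is_productE[OF prod xy(2) h(1)] by blast
    have "?d = Cmp R x y p k f"
      by (rule is_product_eqI[OF prod xy(1) d])
        (use h k xy p f in \<open>simp_all add: Cmp_in Cmp_assoc\<close>)
    then have "Ar P x p ?d \<xi> = \<one>\<^bsub>Ob P p\<^esub>" using ker[OF p(1) d] k by blast
    then show "b = b'" using g g' xy p \<xi> by (simp add: Ar_Minus_eq_one_iff)
  qed
  have "\<exists>b. b \<in> elts P p \<and> (\<forall>s\<in>S. Ar P p (X s) (\<pi> s) b = a s)"
    if a: "\<forall>s\<in>S. a s \<in> elts P (X s)" for a
  proof -
    have "\<forall>s\<in>S. \<exists>g\<in>Hom R x (X s). a s = Ar P x (X s) g \<xi>" using surj p a by blast
    then obtain g where g: "\<And>s. s \<in> S \<Longrightarrow> g s \<in> Hom R x (X s)"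
      "\<And>s. s \<in> S \<Longrightarrow> a s = Ar P x (X s) (g s) \<xi>" by metis
    obtain k where k: "k \<in> Hom R x p" "\<And>s. s \<in> S \<Longrightarrow> Cmp R x p (X s) (\<pi> s) k = g s"
      using is_productE[OF prod xy(1) g(1)] by blast
    have "Ar P p (X s) (\<pi> s) (Ar P x p k \<xi>) = a s" if s: "s \<in> S" for s
      using Ar_Cmp[OF xy(1) p(1) p(2)[OF s] k(1) p(3)[OF s] \<xi>] k(2)[OF s] g(2)[OF s] by simp
    then show ?thesis using Ar_in[OF xy(1) p(1) k(1) \<xi>] by blast
  qed
  with unique show ?thesis unfolding elt_product_def by metis
qed

text \<open>
  Elements of a group are homomorphisms from the integers, so the integers as test object give the
  elementwise condition. Conversely the unique elements over the product depend additively on the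
  family, hence form the mediating homomorphism.
\<close>

lemma is_product_Ab_iff_elt_product:
  fixes N :: "('o, 'h, 'u) module"
  assumes inf: "infinite (UNIV :: 'u set)" and N: "left_module R N"
    and p: "p \<in> Obj R" "\<And>s. s \<in> S \<Longrightarrow> X s \<in> Obj R" "\<And>s. s \<in> S \<Longrightarrow> \<pi> s \<in> Hom R p (X s)"
  shows "is_product Ab S (\<lambda>s. Ob N (X s)) (Ob N p) (\<lambda>s. Ar N p (X s) (\<pi> s)) \<longleftrightarrow> elt_product N S X p \<pi>"
proof
  interpret lmodule R N by (rule lmodule) fact
  assume prod: "is_product Ab S (\<lambda>s. Ob N (X s)) (Ob N p) (\<lambda>s. Ar N p (X s) (\<pi> s))"
  obtain Z :: "'u monoid" and e :: "int \<Rightarrow> 'u" where Z: "comm_group Z" and car: "carrier Z = range e"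
    and pow: "\<forall>(G :: 'u monoid) a. group G \<longrightarrow> a \<in> carrier G \<longrightarrow>
      (\<exists>h\<in>ab_hom Z G. \<forall>n. h (e n) = a [^]\<^bsub>G\<^esub> n)"
    by (rule exists_infinite_cyclic_group[OF inf]) (rule that)
  have ZObj: "Z \<in> Obj Ab" using Z by (simp add: Ab_def)
  have Cmp_Ab: "Cmp Ab Z G K g f (e n) = g (f (e n))" for G K :: "'u monoid" and g f n
    using car by (simp add: Ab_def compose_def)
  have HomAb: "Hom Ab = ab_hom" by (simp add: Ab_def)
  have ext: "f = g" if "f \<in> ab_hom Z G" "g \<in> ab_hom Z G" "\<And>n. f (e n) = g (e n)" for f g and G :: "'u monoid"
    using that car by (intro extensionalityI[of _ "carrier Z"]) (auto simp: ab_hom_def)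
  have cl: "f (e n) \<in> carrier G" if "f \<in> ab_hom Z G" for f n and G :: "'u monoid"
    using that car by (auto simp: ab_hom_def hom_def)
  have unique: "b = b'" if b: "b \<in> elts N p" "b' \<in> elts N p"
    and eq: "\<And>s. s \<in> S \<Longrightarrow> Ar N p (X s) (\<pi> s) b = Ar N p (X s) (\<pi> s) b'" for b b'
  proof -
    interpret Np: group "Ob N p" using group_Ob p by simp
    obtain h where h: "h \<in> ab_hom Z (Ob N p)" "\<And>n. h (e n) = b [^]\<^bsub>Ob N p\<^esub> n"
      using pow group_Ob[OF p(1)] b(1) by blast
    obtain h' where h': "h' \<in> ab_hom Z (Ob N p)" "\<And>n. h' (e n) = b' [^]\<^bsub>Ob N p\<^esub> n"
      using pow group_Ob[OF p(1)] b(2) by blast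
    have "h = h'"
    proof (rule is_product_eqI[OF prod ZObj])
      show "h \<in> Hom Ab Z (Ob N p)" "h' \<in> Hom Ab Z (Ob N p)" using h h' by (simp_all add: HomAb)
      fix s assume s: "s \<in> S"
      interpret group_hom "Ob N p" "Ob N (X s)" "Ar N p (X s) (\<pi> s)"
        using Ar_group_hom p s by simp
      have "Ar N p (X s) (\<pi> s) (h u) = Ar N p (X s) (\<pi> s) (h' u)" if "u \<in> carrier Z" for u
        using that car h h' b eq[OF s] hom_int_pow by auto
      then show "Cmp Ab Z (Ob N p) (Ob N (X s)) (Ar N p (X s) (\<pi> s)) h =
          Cmp Ab Z (Ob N p) (Ob N (X s)) (Ar N p (X s) (\<pi> s)) h'"
        by (auto simp: Ab_def compose_def)
      show "Cmp Ab Z (Ob N p) (Ob N (X s)) (Ar N p (X s) (\<pi> s)) h' \<in> Hom Ab Z (Ob N (X s))"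
        using h'(1) monoid.m_closed[OF group.is_monoid[OF comm_group.axioms(2)[OF Z]]]
        by (auto simp: Ab_def ab_hom_def compose_def Pi_iff hom_def[of Z])
    qed
    then show "b = b'" using h(2)[of 1] h'(2)[of 1] b by (simp add: Np.int_pow_1)
  qed
  have "\<exists>b. b \<in> elts N p \<and> (\<forall>s\<in>S. Ar N p (X s) (\<pi> s) b = a s)"
    if a: "\<forall>s\<in>S. a s \<in> elts N (X s)" for a
  proof -
    have "\<forall>s\<in>S. \<exists>h\<in>ab_hom Z (Ob N (X s)). h (e 1) = a s"
    proof
      fix s assume s: "s \<in> S"
      interpret group "Ob N (X s)" using group_Ob p s by simp
      show "\<exists>h\<in>ab_hom Z (Ob N (X s)). h (e 1) = a s"
        using pow[rule_format, OF group_Ob[OF p(2)[OF s]] a[rule_format, OF s]] a s int_pow_1[of "a s"] by metis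
    qed
    then obtain h where h: "\<And>s. s \<in> S \<Longrightarrow> h s \<in> Hom Ab Z (Ob N (X s))" "\<And>s. s \<in> S \<Longrightarrow> h s (e 1) = a s"
      unfolding HomAb by metis
    obtain k where k: "k \<in> Hom Ab Z (Ob N p)"
      "\<And>s. s \<in> S \<Longrightarrow> Cmp Ab Z (Ob N p) (Ob N (X s)) (Ar N p (X s) (\<pi> s)) k = h s"
      using is_productE[OF prod ZObj h(1)] by blast
    have "Ar N p (X s) (\<pi> s) (k (e 1)) = a s" if s: "s \<in> S" for s
      using h(2)[OF s] unfolding k(2)[OF s, symmetric] Cmp_Ab .
    then show ?thesis using k(1) cl unfolding HomAb by blast
  qed
  with unique show "elt_product N S X p \<pi>" unfolding elt_product_def by metis
next
  interpret lmodule R N by (rule lmodule) fact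
  assume elt: "elt_product N S X p \<pi>"
  show "is_product Ab S (\<lambda>s. Ob N (X s)) (Ob N p) (\<lambda>s. Ar N p (X s) (\<pi> s))"
    unfolding is_product_def
  proof (intro conjI ballI allI impI)
    show "Ob N p \<in> Obj Ab" using comm_group_Ob p by (simp add: Ab_def)
    show "Ob N (X s) \<in> Obj Ab" if "s \<in> S" for s using comm_group_Ob p that by (simp add: Ab_def)
    show "Ar N p (X s) (\<pi> s) \<in> Hom Ab (Ob N p) (Ob N (X s))" if "s \<in> S" for s
      using Ar_ab_hom p that by (simp add: Ab_def)
    fix G :: "'u monoid" and \<rho> assume G: "G \<in> Obj Ab" and \<rho>: "\<forall>s\<in>S. \<rho> s \<in> Hom Ab G (Ob N (X s))"
    then have cG: "comm_group G" by (simp add: Ab_def)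
    then interpret G: comm_group G .
    have \<rho>_hom: "\<rho> s \<in> hom G (Ob N (X s))" "\<rho> s \<in> extensional (carrier G)" if "s \<in> S" for s
      using \<rho> that by (auto simp: Ab_def ab_hom_def)
    have ex1: "\<exists>!b. b \<in> elts N p \<and> (\<forall>s\<in>S. Ar N p (X s) (\<pi> s) b = \<rho> s u)" if "u \<in> carrier G" for u
    proof (rule mp[OF spec[OF elt[unfolded elt_product_def]]])
      show "\<forall>s\<in>S. \<rho> s u \<in> elts N (X s)" using that \<rho>_hom(1) by (auto simp: hom_def)
    qed
    define h where "h = (\<lambda>u\<in>carrier G. THE b. b \<in> elts N p \<and> (\<forall>s\<in>S. Ar N p (X s) (\<pi> s) b = \<rho> s u))"
    have h: "h u \<in> elts N p" "\<And>s. s \<in> S \<Longrightarrow> Ar N p (X s) (\<pi> s) (h u) = \<rho> s u" if "u \<in> carrier G" for u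
      using theI'[OF ex1[OF that]] that by (simp_all add: h_def)
    have h_eq: "h u = b" if "u \<in> carrier G" "b \<in> elts N p" "\<And>s. s \<in> S \<Longrightarrow> Ar N p (X s) (\<pi> s) b = \<rho> s u" for u b
      using ex1[OF that(1)] h[OF that(1)] that by blast
    interpret Np: group "Ob N p" using group_Ob p by simp
    have h_in: "h \<in> ab_hom G (Ob N p)"
      unfolding ab_hom_def hom_def
    proof (intro IntI CollectI conjI ballI Pi_I h(1))
      fix u w assume uw: "u \<in> carrier G" "w \<in> carrier G"
      show "h (u \<otimes>\<^bsub>G\<^esub> w) = h u \<otimes>\<^bsub>Ob N p\<^esub> h w"
        using uw h p \<rho>_hom by (intro h_eq) (auto simp: Ar_mult hom_def)
    qed (simp_all add: h_def)
    have h_comp: "compose (carrier G) (Ar N p (X s) (\<pi> s)) h = \<rho> s" if "s \<in> S" for s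
      using that h \<rho>_hom by (intro extensionalityI[of _ "carrier G"]) (auto simp: compose_def)
    have h_unique: "k = h" if k: "k \<in> ab_hom G (Ob N p)" "\<forall>s\<in>S. compose (carrier G) (Ar N p (X s) (\<pi> s)) k = \<rho> s" for k
    proof (rule extensionalityI[of _ "carrier G"])
      show "k u = h u" if u: "u \<in> carrier G" for u
      proof (rule h_eq[symmetric, OF u])
        show "k u \<in> elts N p" using k u by (auto simp: ab_hom_def hom_def)
        show "Ar N p (X s) (\<pi> s) (k u) = \<rho> s u" if "s \<in> S" for s
          using fun_cong[OF bspec[OF k(2) that], of u] u by (simp add: compose_def)
      qed
    qed (use k in \<open>auto simp: h_def ab_hom_def\<close>)
    show "\<exists>!h. h \<in> Hom Ab G (Ob N p) \<and> (\<forall>s\<in>S. Cmp Ab G (Ob N p) (Ob N (X s)) (Ar N p (X s) (\<pi> s)) h = \<rho> s)"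
    proof (rule ex1I[of _ h])
      show "h \<in> Hom Ab G (Ob N p) \<and> (\<forall>s\<in>S. Cmp Ab G (Ob N p) (Ob N (X s)) (Ar N p (X s) (\<pi> s)) h = \<rho> s)"
        using h_in h_comp by (simp add: Ab_def)
    qed (rule h_unique, simp_all add: Ab_def)
  qed
qed

end

section \<open>Small graphs of generators\<close>

locale small_product_cat = preadditive_cat R
  for R :: "('o, 'h, 'z) acat_scheme" +
  fixes \<kappa> :: "'l rel"
  assumes cinfinite: "cinfinite \<kappa>" and Card_order: "Card_order \<kappa>"
    and has_small_products: "has_small_products \<kappa> R"
begin

lemma small_image: "|A| <o \<kappa> \<Longrightarrow> |f ` A| <o \<kappa>"
  using card_of_image ordLeq_ordLess_trans by blast

lemma small_subset: "\<lbrakk>|B| <o \<kappa>; A \<subseteq> B\<rbrakk> \<Longrightarrow> |A| <o \<kappa>"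
  using card_of_mono1 ordLeq_ordLess_trans by blast

lemma small_Un: "\<lbrakk>|A| <o \<kappa>; |B| <o \<kappa>\<rbrakk> \<Longrightarrow> |A \<union> B| <o \<kappa>"
  using card_of_Un_ordLess_infinite_Field[of \<kappa> A B] cinfinite Card_order by (simp add: cinfinite_def)

lemma small_finite: "finite A \<Longrightarrow> |A| <o \<kappa>"
  using finite_ordLess_infinite[OF card_of_Well_order card_order_on_well_order_on[OF Card_order], of A] cinfinite
  by (simp add: cinfinite_def Field_card_of)

lemma small_bij_betw:
  fixes T :: "'t set"
  assumes "|T| <o \<kappa>"
  obtains b :: "'t \<Rightarrow> 'l" and S :: "'l set" where "bij_betw b T S" "|S| <o \<kappa>"
proof -
  have "|T| \<le>o |Field \<kappa>|"
    using assms ordLess_imp_ordLeq ordLeq_ordIso_trans ordIso_symmetric[OF card_of_Field_ordIso[OF Card_order]]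
    by blast
  then obtain b :: "'t \<Rightarrow> 'l" where "inj_on b T" using card_of_ordLeq[of T "Field \<kappa>"] by blast
  then show thesis using that[of b "b ` T"] small_image[OF assms, of b] by (simp add: bij_betw_def)
qed

lemma small_product_exists:
  assumes "|T| <o \<kappa>" "\<And>t. t \<in> T \<Longrightarrow> X t \<in> Obj R"
  obtains p \<pi> where "is_product R T X p \<pi>"
proof -
  obtain b :: "_ \<Rightarrow> 'l" and S :: "'l set" where b: "bij_betw b T S" and S: "|S| <o \<kappa>"
    by (rule small_bij_betw[OF assms(1)])
  let ?c = "the_inv_into T b"
  have "\<forall>s\<in>S. X (?c s) \<in> Obj R"
    using bij_betw_the_inv_into[OF b] assms(2) by (auto simp: bij_betw_def)
  then obtain p \<pi> where "is_product R S (\<lambda>s. X (?c s)) p \<pi>"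
    using has_small_products[unfolded has_small_products_def, THEN spec, THEN spec, of S "\<lambda>s. X (?c s)"] S
    by blast
  from is_product_reindex[OF bij_betw_the_inv_into[OF b] this]
  have prod: "is_product R T (\<lambda>t. X (?c (the_inv_into S ?c t))) p (\<lambda>t. \<pi> (the_inv_into S ?c t))" .
  have "?c (the_inv_into S ?c t) = t" if "t \<in> T" for t
    using that f_the_inv_into_f_bij_betw[OF bij_betw_the_inv_into[OF b]] by simp
  with prod have "is_product R T X p (\<lambda>t. \<pi> (the_inv_into S ?c t))"
    by (simp add: is_product_def)
  then show thesis by (rule that)
qed

definition elt_preserving :: "('o, 'h, 'u) module \<Rightarrow> bool" where
  "elt_preserving N \<longleftrightarrow>
    (\<forall>(S :: 'l set) X p \<pi>. |S| <o \<kappa> \<longrightarrow> is_product R S X p \<pi> \<longrightarrow> elt_product N S X p \<pi>)"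

lemma elt_preserving_product:
  assumes N: "elt_preserving N" and T: "|T| <o \<kappa>" and prod: "is_product R T X p \<pi>"
  shows "elt_product N T X p \<pi>"
proof -
  obtain b :: "_ \<Rightarrow> 'l" and S :: "'l set" where b: "bij_betw b T S" and S: "|S| <o \<kappa>"
    by (rule small_bij_betw[OF T])
  show ?thesis
    by (rule elt_product_reindex[OF b], rule N[unfolded elt_preserving_def, rule_format])
       (rule S, rule is_product_reindex[OF b prod])
qed

lemma finitely_presented_elt_preserving: "finitely_presented R P \<Longrightarrow> elt_preserving P"
  unfolding finitely_presented_iff_presents elt_preserving_def by (auto intro: presents_elt_product)

lemma preserves_small_products_iff:
  fixes N :: "('o, 'h, 'u) module"
  assumes "infinite (UNIV :: 'u set)" "left_module R N"
  shows "preserves_small_products \<kappa> R Ab N \<longleftrightarrow> elt_preserving N"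
proof -
  have "is_product Ab S (\<lambda>s. Ob N (X s)) (Ob N p) (\<lambda>s. Ar N p (X s) (\<pi> s)) \<longleftrightarrow> elt_product N S X p \<pi>"
    if "is_product R S X p \<pi>" for S :: "'l set" and X p \<pi>
    using is_productD[OF that] by (intro is_product_Ab_iff_elt_product assms)
  then show ?thesis unfolding preserves_small_products_def elt_preserving_def by blast
qed

definition ends :: "('v \<times> 'v \<times> 'h) set \<Rightarrow> 'v set" where
  "ends B = (\<Union>(g, g', f)\<in>B. {g, g'})"

definition compatible ::
    "('v \<Rightarrow> 'o) \<Rightarrow> ('v \<times> 'v \<times> 'h) set \<Rightarrow> ('o, 'h, 'w) module \<Rightarrow> ('v \<Rightarrow> 'w) \<Rightarrow> bool" where
  "compatible ob B N n \<longleftrightarrow>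
    (\<forall>g\<in>ends B. n g \<in> elts N (ob g)) \<and>
    (\<forall>(g, g', f)\<in>B. Ar N (ob g) (ob g') f (n g) = n g')"

text \<open>
  A graph \<open>B\<close> of arrows of \<open>R\<close> is a diagram of representables, contravariantly. If it is small its
  colimit among the product preserving modules is finitely presented: the generator \<open>\<eta>\<close>, of
  degree the product \<open>p\<close> of all vertices, stands for the family of its components at the vertices,
  and one relation in a second product stands for all edges.
\<close>

definition graph_module ::
    "('v \<Rightarrow> 'o) \<Rightarrow> ('v \<times> 'v \<times> 'h) set \<Rightarrow> ('o, 'h, 'u) module \<Rightarrow> 'o \<Rightarrow> ('v \<Rightarrow> 'h) \<Rightarrow> 'u \<Rightarrow> bool" where
  "graph_module ob B P p \<pi> \<eta> \<longleftrightarrow>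
    finitely_presented R P \<and> is_product R (ends B) ob p \<pi> \<and> \<eta> \<in> elts P p \<and>
    (\<forall>z\<in>Obj R. \<forall>a\<in>elts P z. \<exists>k\<in>Hom R p z. a = Ar P p z k \<eta>) \<and>
    compatible ob B P (\<lambda>g. Ar P p (ob g) (\<pi> g) \<eta>) \<and>
    (\<forall>(N :: ('o, 'h, 'u) module) n. left_module R N \<longrightarrow> elt_preserving N \<longrightarrow> compatible ob B N n \<longrightarrow>
      (\<exists>t\<in>module_hom R P N. \<forall>g\<in>ends B. t (ob g) (Ar P p (ob g) (\<pi> g) \<eta>) = n g))"

lemma small_ends: "|B| <o \<kappa> \<Longrightarrow> |ends B| <o \<kappa>"
  by (rule small_subset[of "fst ` B \<union> (fst \<circ> snd) ` B"])
     (auto simp: ends_def image_iff intro!: small_Un small_image, force+)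

lemma exists_graph_module:
  fixes ob :: "'v \<Rightarrow> 'o"
  assumes small: "|arrows R| \<le>o |UNIV :: 'u set|" and B: "|B| <o \<kappa>"
    and edges: "\<And>g g' f. (g, g', f) \<in> B \<Longrightarrow> ob g \<in> Obj R \<and> ob g' \<in> Obj R \<and> f \<in> Hom R (ob g) (ob g')"
  obtains P :: "('o, 'h, 'u) module" and p \<pi> \<eta> where "graph_module ob B P p \<pi> \<eta>"
proof -
  have ob: "ob g \<in> Obj R" if "g \<in> ends B" for g using that edges by (auto simp: ends_def)
  obtain p \<pi> where p: "is_product R (ends B) ob p \<pi>"
    using small_product_exists[OF small_ends[OF B]] ob by blast
  note p_simps = is_productD[OF p]
  define src tgt :: "'v \<times> 'v \<times> 'h \<Rightarrow> 'v" where "src = (\<lambda>(g, g', f). g)" and "tgt = (\<lambda>(g, g', f). g')"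
  define lab :: "'v \<times> 'v \<times> 'h \<Rightarrow> 'h" where "lab = (\<lambda>(g, g', f). f)"
  have e: "src e \<in> ends B" "tgt e \<in> ends B" "lab e \<in> Hom R (ob (src e)) (ob (tgt e))" if "e \<in> B" for e
    using that edges by (cases e; force simp: ends_def src_def tgt_def lab_def)+
  obtain y \<rho> where y: "is_product R B (\<lambda>e. ob (tgt e)) y \<rho>"
    using small_product_exists[OF B, of "\<lambda>e. ob (tgt e)"] ob e by blast
  note y_simps = is_productD[OF y]
  \<comment> \<open>The relation of an edge says that its arrow sends the component of \<open>\<eta>\<close> at the source to the one
    at the target; in the product \<open>y\<close> of all targets these become the single relation \<open>f\<close>.\<close>
  define rel where "rel e = Minus p (ob (tgt e)) (Cmp R p (ob (src e)) (ob (tgt e)) (lab e) (\<pi> (src e))) (\<pi> (tgt e))" for e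
  have rel_in: "rel e \<in> Hom R p (ob (tgt e))" if "e \<in> B" for e
    unfolding rel_def using e[OF that] p_simps by (intro Minus_in Cmp_in) auto
  obtain f where f: "f \<in> Hom R p y" "\<And>e. e \<in> B \<Longrightarrow> Cmp R p y (ob (tgt e)) (\<rho> e) f = rel e"
    using is_productE[OF y p_simps(1) rel_in] by blast
  have rel_iff: "Ar N p (ob (tgt e)) (rel e) a = \<one>\<^bsub>Ob N (ob (tgt e))\<^esub> \<longleftrightarrow>
      Ar N (ob (src e)) (ob (tgt e)) (lab e) (Ar N p (ob (src e)) (\<pi> (src e)) a) = Ar N p (ob (tgt e)) (\<pi> (tgt e)) a"
    if "left_module R N" "e \<in> B" "a \<in> elts N p" for N :: "('o, 'h, 'u) module" and e a
  proof -
    interpret lmodule R N by (rule lmodule) fact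
    show ?thesis
      unfolding rel_def using e[OF that(2)] p_simps that(3)
      by (simp add: Ar_Minus_eq_one_iff Cmp_in Ar_Cmp)
  qed
  obtain P :: "('o, 'h, 'u) module" and \<eta> where P: "presents p y f P \<eta>"
    by (rule exists_presents[OF small p_simps(1) y_simps(1) f(1)])
  then have modP: "left_module R P" and \<eta>: "\<eta> \<in> elts P p" by (simp_all add: presents_def)
  interpret P: lmodule R P by (rule lmodule) fact
  have "Ar P p y f \<eta> = \<one>\<^bsub>Ob P y\<^esub>"
    using P by (rule presents_relation)
  then have "Ar P p (ob (tgt e)) (rel e) \<eta> = \<one>\<^bsub>Ob P (ob (tgt e))\<^esub>" if "e \<in> B" for e
    using f(2)[OF that] P.Ar_Cmp[OF p_simps(1) y_simps(1) _ f(1) _ \<eta>] y_simps that P.Ar_one by metis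
  then have rels: "Ar P (ob (src e)) (ob (tgt e)) (lab e) (Ar P p (ob (src e)) (\<pi> (src e)) \<eta>) = Ar P p (ob (tgt e)) (\<pi> (tgt e)) \<eta>"
    if "e \<in> B" for e
    using rel_iff[OF modP that \<eta>] that by simp
  have comp: "compatible ob B P (\<lambda>g. Ar P p (ob g) (\<pi> g) \<eta>)"
    unfolding compatible_def
  proof (intro conjI ballI)
    show "Ar P p (ob g) (\<pi> g) \<eta> \<in> elts P (ob g)" if "g \<in> ends B" for g
      using P.Ar_in p_simps that \<eta> by simp
    show "case e of (g, g', f) \<Rightarrow> Ar P (ob g) (ob g') f (Ar P p (ob g) (\<pi> g) \<eta>) = Ar P p (ob g') (\<pi> g') \<eta>"
      if "e \<in> B" for e
      using rels[OF that] by (auto simp: src_def tgt_def lab_def)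
  qed
  have univ: "\<exists>t\<in>module_hom R P N. \<forall>g\<in>ends B. t (ob g) (Ar P p (ob g) (\<pi> g) \<eta>) = n g"
    if N: "left_module R N" "elt_preserving N" and n: "compatible ob B N n" for N :: "('o, 'h, 'u) module" and n
  proof -
    interpret N: lmodule R N by (rule lmodule) fact
    have n_in: "n g \<in> elts N (ob g)" if "g \<in> ends B" for g
      using n that unfolding compatible_def by blast
    obtain b where b: "b \<in> elts N p" "\<And>g. g \<in> ends B \<Longrightarrow> Ar N p (ob g) (\<pi> g) b = n g"
      using elt_productE[OF elt_preserving_product[OF N(2) small_ends[OF B] p], of n] n_in by blast
    have "Ar N (ob (src e)) (ob (tgt e)) (lab e) (n (src e)) = n (tgt e)" if "e \<in> B" for e
      using n that unfolding compatible_def by (auto simp: src_def tgt_def lab_def)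
    then have rel1: "Ar N p (ob (tgt e)) (rel e) b = \<one>\<^bsub>Ob N (ob (tgt e))\<^esub>" if "e \<in> B" for e
      using rel_iff[OF N(1) that b(1)] b(2) e[OF that] that by simp
    have "Ar N p y f b = \<one>\<^bsub>Ob N y\<^esub>"
    proof -
      have "elt_product N B (\<lambda>e. ob (tgt e)) y \<rho>" by (rule elt_preserving_product[OF N(2) B y])
      moreover have "\<forall>e\<in>B. \<one>\<^bsub>Ob N (ob (tgt e))\<^esub> \<in> elts N (ob (tgt e))"
        using N.group_Ob[THEN group.is_monoid, THEN monoid.one_closed] y_simps by simp
      ultimately have ex1: "\<exists>!c. c \<in> elts N y \<and>
          (\<forall>e\<in>B. Ar N y (ob (tgt e)) (\<rho> e) c = \<one>\<^bsub>Ob N (ob (tgt e))\<^esub>)"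
        unfolding elt_product_def by (elim allE[of _ "\<lambda>e. \<one>\<^bsub>Ob N (ob (tgt e))\<^esub>"]) blast
      have "Ar N p y f b \<in> elts N y" "\<one>\<^bsub>Ob N y\<^esub> \<in> elts N y"
        using N.Ar_in[OF p_simps(1) y_simps(1) f(1) b(1)] N.group_Ob[OF y_simps(1), THEN group.is_monoid, THEN monoid.one_closed] by simp_all
      moreover have "Ar N y (ob (tgt e)) (\<rho> e) (Ar N p y f b) = \<one>\<^bsub>Ob N (ob (tgt e))\<^esub>" if "e \<in> B" for e
        using N.Ar_Cmp[OF p_simps(1) y_simps(1) _ f(1) _ b(1), of "ob (tgt e)" "\<rho> e"] rel1[OF that] f(2)[OF that] y_simps that by simp
      moreover have "Ar N y (ob (tgt e)) (\<rho> e) \<one>\<^bsub>Ob N y\<^esub> = \<one>\<^bsub>Ob N (ob (tgt e))\<^esub>" if "e \<in> B" for e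
        using N.Ar_one y_simps that by simp
      ultimately show ?thesis using ex1 by blast
    qed
    then obtain t where t: "t \<in> module_hom R P N" "t p \<eta> = b"
      using presents_hom[OF P N(1) b(1)] by blast
    have "t (ob g) (Ar P p (ob g) (\<pi> g) \<eta>) = n g" if "g \<in> ends B" for g
      using module_hom_Ar[OF t(1) p_simps(1) _ _ \<eta>] p_simps that t(2) b(2) by simp
    with t(1) show ?thesis by blast
  qed
  have "graph_module ob B P p \<pi> \<eta>"
    unfolding graph_module_def
  proof (intro conjI allI impI p \<eta> comp univ)
    show "finitely_presented R P" using P finitely_presented_iff_presents by blast
    show "\<forall>z\<in>Obj R. \<forall>a\<in>elts P z. \<exists>k\<in>Hom R p z. a = Ar P p z k \<eta>"
      using P by (simp add: presents_def)
  qed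
  then show thesis by (rule that)
qed

text \<open>
  A homomorphism is determined by the image of the generator \<open>\<eta>\<close>, and this image is determined by
  its components since \<open>N\<close> preserves the product of the vertices.
\<close>

lemma graph_module_hom_eqI:
  assumes P: "graph_module ob B P p \<pi> \<eta>" and B: "|B| <o \<kappa>" and N: "left_module R N" "elt_preserving N"
    and st: "s \<in> module_hom R P N" "t \<in> module_hom R P N"
    and eq: "\<And>g. g \<in> ends B \<Longrightarrow> s (ob g) (Ar P p (ob g) (\<pi> g) \<eta>) = t (ob g) (Ar P p (ob g) (\<pi> g) \<eta>)"
  shows "s = t"
proof -
  interpret N: lmodule R N by (rule lmodule) fact
  have prod: "is_product R (ends B) ob p \<pi>" and \<eta>: "\<eta> \<in> elts P p"
    and gen: "\<And>z a. \<lbrakk>z \<in> Obj R; a \<in> elts P z\<rbrakk> \<Longrightarrow> \<exists>k\<in>Hom R p z. a = Ar P p z k \<eta>"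
    using P unfolding graph_module_def by blast+
  note p = is_productD[OF prod]
  have elt: "elt_product N (ends B) ob p \<pi>" by (rule elt_preserving_product[OF N(2) small_ends[OF B] prod])
  have eq': "s p \<eta> = t p \<eta>"
  proof (rule elt_product_eqI[OF elt])
    show "s p \<eta> \<in> elts N p" "t p \<eta> \<in> elts N p"
      using module_hom_in[OF st(1) p(1) \<eta>] module_hom_in[OF st(2) p(1) \<eta>] by simp_all
    then show "Ar N p (ob g) (\<pi> g) (s p \<eta>) \<in> elts N (ob g)" if "g \<in> ends B" for g
      using N.Ar_in p that by simp
    show "Ar N p (ob g) (\<pi> g) (s p \<eta>) = Ar N p (ob g) (\<pi> g) (t p \<eta>)" if "g \<in> ends B" for g
      using module_hom_Ar[OF st(1) p(1) _ _ \<eta>] module_hom_Ar[OF st(2) p(1) _ _ \<eta>] p that eq by simp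
  qed
  show ?thesis
  proof (rule module_hom_eqI[OF st])
    fix z a assume z: "z \<in> Obj R" "a \<in> elts P z"
    then obtain k where "k \<in> Hom R p z" "a = Ar P p z k \<eta>" using gen by blast
    then show "s z a = t z a"
      using module_hom_Ar[OF st(1) p(1) z(1) _ \<eta>] module_hom_Ar[OF st(2) p(1) z(1) _ \<eta>] eq' by simp
  qed
qed

end

section \<open>Directed colimits are computed on elements\<close>

lemma poset_cat_simps [simp]:
  "Obj (poset_cat I r) = I"
  "u \<in> Hom (poset_cat I r) i j \<longleftrightarrow> (i, j) \<in> r"
  by (simp_all add: poset_cat_def)

lemma directed_posetD:
  assumes "directed_poset \<kappa> I r"
  shows "i \<in> I \<Longrightarrow> (i, i) \<in> r" "\<lbrakk>(i, j) \<in> r; (j, k) \<in> r\<rbrakk> \<Longrightarrow> (i, k) \<in> r"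
    "(i, j) \<in> r \<Longrightarrow> i \<in> I \<and> j \<in> I"
    "\<lbrakk>S \<subseteq> I; |S| <o \<kappa>\<rbrakk> \<Longrightarrow> \<exists>u\<in>I. \<forall>s\<in>S. (s, u) \<in> r"
  using assms unfolding directed_poset_def partial_order_on_def preorder_on_def refl_on_def
  by (blast dest: transD)+

locale directed_diagram = preadditive_cat R for R :: "('o, 'h, 'z) acat_scheme" +
  fixes I :: "'i set" and r and D :: "('i, unit, ('o, 'h, 'u) module, 'o \<Rightarrow> 'u \<Rightarrow> 'u) ftor"
  assumes r_refl: "i \<in> I \<Longrightarrow> (i, i) \<in> r"
    and r_trans: "\<lbrakk>(i, j) \<in> r; (j, k) \<in> r\<rbrakk> \<Longrightarrow> (i, k) \<in> r"
    and r_sub: "(i, j) \<in> r \<Longrightarrow> i \<in> I \<and> j \<in> I"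
    and nonempty: "I \<noteq> {}"
    and bound: "\<lbrakk>i \<in> I; j \<in> I\<rbrakk> \<Longrightarrow> \<exists>k\<in>I. (i, k) \<in> r \<and> (j, k) \<in> r"
    and D: "is_functor (poset_cat I r) (LMod R) D"
begin

abbreviation A :: "'i \<Rightarrow> ('o, 'h, 'u) module" where "A \<equiv> Ob D"

abbreviation t :: "'i \<Rightarrow> 'i \<Rightarrow> 'o \<Rightarrow> 'u \<Rightarrow> 'u" where "t i j \<equiv> Ar D i j ()"

lemma A_module: "i \<in> I \<Longrightarrow> left_module R (A i)"
  using D by (simp add: is_functor_def)

lemma t_hom: "(i, j) \<in> r \<Longrightarrow> t i j \<in> module_hom R (A i) (A j)"
  using D r_sub by (simp add: is_functor_def)

lemma t_in: "\<lbrakk>(i, j) \<in> r; x \<in> Obj R; a \<in> elts (A i) x\<rbrakk> \<Longrightarrow> t i j x a \<in> elts (A j) x"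
  by (rule module_hom_in[OF t_hom])

lemma t_refl:
  assumes "i \<in> I" "x \<in> Obj R" "a \<in> elts (A i) x"
  shows "t i i x a = a"
proof -
  have "t i i = Id (LMod R) (A i)"
    using D assms(1) by (simp add: is_functor_def poset_cat_def[of I r])
  then show ?thesis using assms by simp
qed

lemma t_trans:
  assumes "(i, j) \<in> r" "(j, k) \<in> r" "x \<in> Obj R" "a \<in> elts (A i) x"
  shows "t i k x a = t j k x (t i j x a)"
proof -
  have "\<forall>i\<in>I. \<forall>j\<in>I. \<forall>k\<in>I. \<forall>u\<in>Hom (poset_cat I r) i j. \<forall>w\<in>Hom (poset_cat I r) j k.
      Ar D i k (Cmp (poset_cat I r) i j k w u) = Cmp (LMod R) (A i) (A j) (A k) (Ar D j k w) (Ar D i j u)"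
    using D by (simp add: is_functor_def)
  moreover have "i \<in> I" "j \<in> I" "k \<in> I" using assms(1,2) r_sub by blast+
  moreover have "() \<in> Hom (poset_cat I r) i j" "() \<in> Hom (poset_cat I r) j k" using assms by simp_all
  ultimately have "Ar D i k (Cmp (poset_cat I r) i j k () ()) = Cmp (LMod R) (A i) (A j) (A k) (t j k) (t i j)"
    by blast
  then show ?thesis using assms(3,4) by simp
qed

lemma cocone_t:
  assumes "is_cocone (poset_cat I r) (LMod R) D M c" "(i, j) \<in> r" "x \<in> Obj R" "a \<in> elts (A i) x"
  shows "c j x (t i j x a) = c i x a"
proof -
  have "Cmp (LMod R) (A i) (A j) M (c j) (t i j) = c i"
    using assms(1,2) r_sub by (simp add: is_cocone_def)
  from fun_cong[OF fun_cong[OF this], of x a] show ?thesis using assms(3,4) by simp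
qed

definition germ_eq :: "'o \<Rightarrow> 'i \<times> 'u \<Rightarrow> 'i \<times> 'u \<Rightarrow> bool" where
  "germ_eq x = (\<lambda>(i, a) (j, b). \<exists>k. (i, k) \<in> r \<and> (j, k) \<in> r \<and> t i k x a = t j k x b)"

lemma germ_eq_later:
  assumes "x \<in> Obj R" "(i, k) \<in> r" "(j, k) \<in> r" "(k, l) \<in> r"
    and "a \<in> elts (A i) x" "b \<in> elts (A j) x" "t i k x a = t j k x b"
  shows "t i l x a = t j l x b"
  using t_trans[OF assms(2,4,1,5)] t_trans[OF assms(3,4,1,6)] assms(7) by simp

lemma germ_eq_sym: "germ_eq x u w \<Longrightarrow> germ_eq x w u"
  unfolding germ_eq_def by (auto split: prod.splits)

lemma germ_eq_trans:
  assumes x: "x \<in> Obj R" and car: "a \<in> elts (A i) x" "b \<in> elts (A j) x" "c \<in> elts (A k) x"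
    and eq: "germ_eq x (i, a) (j, b)" "germ_eq x (j, b) (k, c)"
  shows "germ_eq x (i, a) (k, c)"
proof -
  obtain l l' where l: "(i, l) \<in> r" "(j, l) \<in> r" "t i l x a = t j l x b"
    and l': "(j, l') \<in> r" "(k, l') \<in> r" "t j l' x b = t k l' x c"
    using eq by (auto simp: germ_eq_def)
  obtain n where n: "(l, n) \<in> r" "(l', n) \<in> r" using bound l l' r_sub by meson
  have "t i n x a = t k n x c"
    using germ_eq_later[OF x l(1,2) n(1) car(1,2) l(3)] germ_eq_later[OF x l'(1,2) n(2) car(2,3) l'(3)] by simp
  then show ?thesis using r_trans l(1) l'(2) n unfolding germ_eq_def by blast
qed

text \<open>
  The set-theoretic colimit, with a germ represented by a chosen pair of an index and an element.
\<close>

lemma exists_germ_module: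
  assumes small: "|I \<times> (UNIV :: 'u set)| \<le>o |UNIV :: 'u set|"
  obtains N :: "('o, 'h, 'u) module" and v where "left_module R N"
    and "\<And>i. i \<in> I \<Longrightarrow> v i \<in> module_hom R (A i) N"
    and "\<And>x. x \<in> Obj R \<Longrightarrow> elts N x = (\<Union>i\<in>I. v i x ` elts (A i) x)"
    and "\<And>i j x a b. \<lbrakk>i \<in> I; j \<in> I; x \<in> Obj R; a \<in> elts (A i) x; b \<in> elts (A j) x\<rbrakk> \<Longrightarrow>
      v i x a = v j x b \<longleftrightarrow> germ_eq x (i, a) (j, b)"
proof -
  obtain e :: "'i \<times> 'u \<Rightarrow> 'u" where e: "inj_on e (I \<times> UNIV)"
    using small card_of_ordLeq[of "I \<times> (UNIV :: 'u set)" "UNIV :: 'u set"] by blast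
  define good where "good x u \<longleftrightarrow> fst u \<in> I \<and> snd u \<in> elts (A (fst u)) x" for x and u :: "'i \<times> 'u"
  define rep where "rep x u = (SOME w. good x w \<and> germ_eq x u w)" for x u
  define v where "v i x a = e (rep x (i, a))" for i x a
  have germ_refl: "germ_eq x u u" if "good x u" for x u
    using that r_refl by (cases u) (auto simp: germ_eq_def good_def)
  have rep: "good x (rep x u)" "germ_eq x u (rep x u)" if "good x u" for x u
    using someI[of "\<lambda>w. good x w \<and> germ_eq x u w" u] germ_refl[OF that] that by (simp_all add: rep_def)
  have gtrans: "germ_eq x u y" if "x \<in> Obj R" "good x u" "good x w" "good x y" "germ_eq x u w" "germ_eq x w y" for x u w y
    using germ_eq_trans[OF that(1), of "snd u" "fst u" "snd w" "fst w" "snd y" "fst y"] that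
    by (simp add: good_def)
  have v_iff: "v i x a = v j x b \<longleftrightarrow> germ_eq x (i, a) (j, b)"
    if *: "i \<in> I" "j \<in> I" "x \<in> Obj R" "a \<in> elts (A i) x" "b \<in> elts (A j) x" for i j x a b
  proof -
    have g: "good x (i, a)" "good x (j, b)" using * by (simp_all add: good_def)
    show ?thesis
    proof
      assume "v i x a = v j x b"
      moreover have "rep x (i, a) \<in> I \<times> UNIV" "rep x (j, b) \<in> I \<times> UNIV"
        using rep(1)[OF g(1)] rep(1)[OF g(2)] by (simp_all add: good_def mem_Times_iff)
      ultimately have "rep x (i, a) = rep x (j, b)" using e unfolding v_def by (auto dest: inj_onD)
      then show "germ_eq x (i, a) (j, b)"
        using gtrans[OF *(3) g(1) rep(1)[OF g(2)] g(2) _ germ_eq_sym[OF rep(2)[OF g(2)]]] rep(2)[OF g(1)] by simp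
    next
      assume eq: "germ_eq x (i, a) (j, b)"
      have "(good x w \<and> germ_eq x (i, a) w) \<longleftrightarrow> (good x w \<and> germ_eq x (j, b) w)" for w
        using gtrans[OF *(3) g(1) g(2) _ eq] gtrans[OF *(3) g(2) g(1) _ germ_eq_sym[OF eq]] by blast
      then show "v i x a = v j x b" by (simp add: v_def rep_def)
    qed
  qed
  have v_t: "v i x a = v k x (t i k x a)" if "(i, k) \<in> r" "x \<in> Obj R" "a \<in> elts (A i) x" for i k x a
  proof -
    have "i \<in> I" "k \<in> I" using that r_sub by auto
    moreover have "germ_eq x (i, a) (k, t i k x a)"
      using that t_refl[OF \<open>k \<in> I\<close> that(2) t_in[OF that]] r_refl[OF \<open>k \<in> I\<close>] by (auto simp: germ_eq_def)
    ultimately show ?thesis using v_iff that t_in by simp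
  qed
  have germ_mult: "germ_eq x (i, a \<otimes>\<^bsub>Ob (A i) x\<^esub> b) (j, a' \<otimes>\<^bsub>Ob (A j) x\<^esub> b')"
    if *: "x \<in> Obj R" "i \<in> I" "j \<in> I" "a \<in> elts (A i) x" "b \<in> elts (A i) x"
      "a' \<in> elts (A j) x" "b' \<in> elts (A j) x"
      and eq: "germ_eq x (i, a) (j, a')" "germ_eq x (i, b) (j, b')" for x i j a b a' b'
  proof -
    obtain l l' where l: "(i, l) \<in> r" "(j, l) \<in> r" "t i l x a = t j l x a'"
      and l': "(i, l') \<in> r" "(j, l') \<in> r" "t i l' x b = t j l' x b'"
      using eq by (auto simp: germ_eq_def)
    obtain n where n: "(l, n) \<in> r" "(l', n) \<in> r" using bound l l' r_sub by meson
    have "t i n x a = t j n x a'" "t i n x b = t j n x b'"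
      using germ_eq_later[OF *(1) l(1,2) n(1) *(4,6) l(3)] germ_eq_later[OF *(1) l'(1,2) n(2) *(5,7) l'(3)] by simp_all
    moreover have r: "(i, n) \<in> r" "(j, n) \<in> r" using r_trans l n by blast+
    ultimately have "t i n x (a \<otimes>\<^bsub>Ob (A i) x\<^esub> b) = t j n x (a' \<otimes>\<^bsub>Ob (A j) x\<^esub> b')"
      using module_hom_mult[OF t_hom[OF r(1)] *(1,4,5)] module_hom_mult[OF t_hom[OF r(2)] *(1,6,7)] by simp
    with r show ?thesis by (auto simp: germ_eq_def)
  qed
  have germ_Ar: "germ_eq y (i, Ar (A i) x y f a) (j, Ar (A j) x y f a')"
    if *: "x \<in> Obj R" "y \<in> Obj R" "f \<in> Hom R x y" "a \<in> elts (A i) x" "a' \<in> elts (A j) x"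
      and eq: "germ_eq x (i, a) (j, a')" for x y f i j a a'
  proof -
    obtain l where l: "(i, l) \<in> r" "(j, l) \<in> r" "t i l x a = t j l x a'"
      using eq by (auto simp: germ_eq_def)
    then have "t i l y (Ar (A i) x y f a) = t j l y (Ar (A j) x y f a')"
      using module_hom_Ar[OF t_hom[OF l(1)] *(1-4)] module_hom_Ar[OF t_hom[OF l(2)] *(1-3,5)] by simp
    with l show ?thesis by (auto simp: germ_eq_def)
  qed
  have A_closed: "a \<otimes>\<^bsub>Ob (A i) x\<^esub> b \<in> elts (A i) x"
    if "i \<in> I" "x \<in> Obj R" "a \<in> elts (A i) x" "b \<in> elts (A i) x" for i x a b
    using lmodule.group_Ob[OF lmodule[OF A_module[OF that(1)]] that(2)] that(3,4)
    by (intro monoid.m_closed group.is_monoid)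
  have A_Ar: "Ar (A i) x y f a \<in> elts (A i) y"
    if "i \<in> I" "x \<in> Obj R" "y \<in> Obj R" "f \<in> Hom R x y" "a \<in> elts (A i) x" for i x y f a
    by (rule lmodule.Ar_in[OF lmodule[OF A_module[OF that(1)]] that(2-5)])
  obtain N :: "('o, 'h, 'u) module" where N: "left_module R N"
    and car: "\<And>x. x \<in> Obj R \<Longrightarrow> elts N x = (\<Union>i\<in>I. v i x ` elts (A i) x)"
    and mult: "\<And>i x a b. \<lbrakk>i \<in> I; x \<in> Obj R; a \<in> elts (A i) x; b \<in> elts (A i) x\<rbrakk> \<Longrightarrow>
      v i x a \<otimes>\<^bsub>Ob N x\<^esub> v i x b = v i x (a \<otimes>\<^bsub>Ob (A i) x\<^esub> b)"
    and Ar: "\<And>i x y f a. \<lbrakk>i \<in> I; x \<in> Obj R; y \<in> Obj R; f \<in> Hom R x y; a \<in> elts (A i) x\<rbrakk> \<Longrightarrow>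
      Ar N x y f (v i x a) = v i y (Ar (A i) x y f a)"
  proof (rule directed_quotient[of I A v])
    show "I \<noteq> {}" by (rule nonempty)
    show "left_module R (A i)" if "i \<in> I" for i by (rule A_module[OF that])
    show "\<exists>k\<in>I. \<forall>x\<in>Obj R. v i x ` elts (A i) x \<union> v j x ` elts (A j) x \<subseteq> v k x ` elts (A k) x"
      if ij: "i \<in> I" "j \<in> I" for i j
    proof -
      obtain k where k: "k \<in> I" "(i, k) \<in> r" "(j, k) \<in> r" using bound[OF ij] by blast
      have "v i x ` elts (A i) x \<subseteq> v k x ` elts (A k) x"
        "v j x ` elts (A j) x \<subseteq> v k x ` elts (A k) x" if "x \<in> Obj R" for x
        using v_t[OF k(2) that] v_t[OF k(3) that] t_in[OF k(2) that] t_in[OF k(3) that] by auto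
      with k(1) show ?thesis by blast
    qed
    show "v i x (a \<otimes>\<^bsub>Ob (A i) x\<^esub> b) = v j x (a' \<otimes>\<^bsub>Ob (A j) x\<^esub> b')"
      if "i \<in> I" "j \<in> I" "x \<in> Obj R" "a \<in> elts (A i) x" "b \<in> elts (A i) x"
        "a' \<in> elts (A j) x" "b' \<in> elts (A j) x" "v i x a = v j x a'" "v i x b = v j x b'"
      for i j x a b a' b'
      using that germ_mult[OF that(3,1,2,4-7)] by (simp add: v_iff A_closed)
    show "v i y (Ar (A i) x y f a) = v j y (Ar (A j) x y f a')"
      if "i \<in> I" "j \<in> I" "x \<in> Obj R" "y \<in> Obj R" "f \<in> Hom R x y" "a \<in> elts (A i) x"
        "a' \<in> elts (A j) x" "v i x a = v j x a'" for i j x y f a a'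
      using that germ_Ar[OF that(3-7)] by (simp add: v_iff A_Ar)
  qed (rule that)
  define w where "w i = (\<lambda>x\<in>Obj R. \<lambda>a\<in>elts (A i) x. v i x a)" for i
  show thesis
  proof (rule that[OF N, of w])
    show "w i \<in> module_hom R (A i) N" if i: "i \<in> I" for i
      using i by (intro module_homI) (auto simp: w_def car mult Ar A_closed A_Ar)
    show "elts N x = (\<Union>i\<in>I. w i x ` elts (A i) x)" if "x \<in> Obj R" for x
      using that by (simp add: car w_def)
    show "w i x a = w j x b \<longleftrightarrow> germ_eq x (i, a) (j, b)"
      if "i \<in> I" "j \<in> I" "x \<in> Obj R" "a \<in> elts (A i) x" "b \<in> elts (A j) x" for i j x a b
      using that v_iff by (simp add: w_def)
  qed
qed

text \<open>
  The universal property compares \<open>M\<close> with the module \<open>N\<close> of germs. The map \<open>h : M \<rightarrow> N\<close> shows that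
  elements with equal image in \<open>M\<close> have equal germs; the map \<open>k : N \<rightarrow> M\<close> satisfies \<open>k \<circ> h = id\<close>, so \<open>M\<close>
  is covered by the stages as \<open>N\<close> is.
\<close>

lemma
  assumes small: "|I \<times> (UNIV :: 'u set)| \<le>o |UNIV :: 'u set|"
    and colim: "is_colimit (poset_cat I r) (LMod R) D M c"
  shows colimit_surj: "\<And>x m. \<lbrakk>x \<in> Obj R; m \<in> elts M x\<rbrakk> \<Longrightarrow> \<exists>i\<in>I. \<exists>a\<in>elts (A i) x. c i x a = m"
    and colimit_eq: "\<And>x i j a b. \<lbrakk>x \<in> Obj R; i \<in> I; j \<in> I; a \<in> elts (A i) x; b \<in> elts (A j) x;
      c i x a = c j x b\<rbrakk> \<Longrightarrow> germ_eq x (i, a) (j, b)"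
proof -
  obtain N :: "('o, 'h, 'u) module" and v where N: "left_module R N"
    and v: "\<And>i. i \<in> I \<Longrightarrow> v i \<in> module_hom R (A i) N"
    and car: "\<And>x. x \<in> Obj R \<Longrightarrow> elts N x = (\<Union>i\<in>I. v i x ` elts (A i) x)"
    and v_iff: "\<And>i j x a b. \<lbrakk>i \<in> I; j \<in> I; x \<in> Obj R; a \<in> elts (A i) x; b \<in> elts (A j) x\<rbrakk> \<Longrightarrow>
      v i x a = v j x b \<longleftrightarrow> germ_eq x (i, a) (j, b)"
    by (rule exists_germ_module[OF small]) (rule that)
  have cocone: "is_cocone (poset_cat I r) (LMod R) D M c"
    using colim by (simp add: is_colimit_def)
  then have M: "left_module R M" and c: "\<And>i. i \<in> I \<Longrightarrow> c i \<in> module_hom R (A i) M"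
    by (simp_all add: is_cocone_def)
  note c_t = cocone_t[OF cocone]
  have "is_cocone (poset_cat I r) (LMod R) D N v"
    unfolding is_cocone_def
  proof (intro conjI ballI)
    fix i j u assume "i \<in> Obj (poset_cat I r)" "j \<in> Obj (poset_cat I r)" "u \<in> Hom (poset_cat I r) i j"
    then have ij: "i \<in> I" "j \<in> I" "(i, j) \<in> r" by simp_all
    show "Cmp (LMod R) (A i) (A j) N (v j) (Ar D i j u) = v i"
    proof (rule module_hom_eqI[OF module_hom_Cmp[OF A_module[OF ij(1)] _ v[OF ij(2)]] v[OF ij(1)]])
      show "Ar D i j u \<in> module_hom R (A i) (A j)" using t_hom[OF ij(3)] by simp
      fix x a assume x: "x \<in> Obj R" "a \<in> elts (A i) x"
      have "germ_eq x (j, t i j x a) (i, a)"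
        using ij x t_refl[OF ij(2) x(1) t_in[OF ij(3) x]] r_refl[OF ij(2)] by (auto simp: germ_eq_def)
      then show "Cmp (LMod R) (A i) (A j) N (v j) (Ar D i j u) x a = v i x a"
        using x ij t_in[OF ij(3)] by (simp add: v_iff)
    qed
  qed (use N v in simp_all)
  then obtain h where h: "h \<in> module_hom R M N" "\<And>i. i \<in> I \<Longrightarrow> Cmp (LMod R) (A i) M N h (c i) = v i"
    using colim unfolding is_colimit_def by simp blast
  have h_c: "h x (c i x a) = v i x a" if "i \<in> I" "x \<in> Obj R" "a \<in> elts (A i) x" for i x a
    using fun_cong[OF fun_cong[OF h(2)[OF that(1)]], of x a] that by simp
  show eq: "germ_eq x (i, a) (j, b)" if "x \<in> Obj R" "i \<in> I" "j \<in> I" "a \<in> elts (A i) x" "b \<in> elts (A j) x"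
      "c i x a = c j x b" for x i j a b
    using h_c[of i x a] h_c[of j x b] v_iff[of i j x a b] that by simp
  define T where "T x w m \<longleftrightarrow> (\<exists>i\<in>I. \<exists>a\<in>elts (A i) x. w = v i x a \<and> m = c i x a)" for x w m
  obtain k where k: "k \<in> module_hom R N M" "\<And>x w m. \<lbrakk>x \<in> Obj R; T x w m\<rbrakk> \<Longrightarrow> k x w = m"
  proof (rule module_hom_of_relation[of N T M])
    show "left_module R N" by fact
    show "\<exists>m. T x w m" if "x \<in> Obj R" "w \<in> elts N x" for x w
      using that car unfolding T_def by auto
  next
    fix x w m m' assume x: "x \<in> Obj R" and "T x w m" "T x w m'"
    then obtain i a j b where ia: "i \<in> I" "a \<in> elts (A i) x" "m = c i x a" "w = v i x a"
      and jb: "j \<in> I" "b \<in> elts (A j) x" "m' = c j x b" "w = v j x b"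
      unfolding T_def by auto
    have "germ_eq x (i, a) (j, b)"
      by (rule iffD1[OF v_iff[OF ia(1) jb(1) x ia(2) jb(2)] trans[OF ia(4)[symmetric] jb(4)]])
    then obtain l where "(i, l) \<in> r" "(j, l) \<in> r" "t i l x a = t j l x b" by (auto simp: germ_eq_def)
    then show "m = m'" using c_t[of i l x a] c_t[of j l x b] ia jb x by simp
  next
    show "w \<in> elts N x \<and> m \<in> elts M x" if "x \<in> Obj R" "T x w m" for x w m
      using that module_hom_in[OF v] module_hom_in[OF c] unfolding T_def by blast
  next
    fix x w m w' m' assume x: "x \<in> Obj R" and "T x w m" "T x w' m'"
    then obtain i a j b where ia: "i \<in> I" "a \<in> elts (A i) x" "m = c i x a" "w = v i x a"
      and jb: "j \<in> I" "b \<in> elts (A j) x" "m' = c j x b" "w' = v j x b"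
      unfolding T_def by auto
    obtain l where l: "l \<in> I" "(i, l) \<in> r" "(j, l) \<in> r" using bound ia(1) jb(1) by blast
    let ?a = "t i l x a" and ?b = "t j l x b"
    have ab: "?a \<in> elts (A l) x" "?b \<in> elts (A l) x" using t_in l x ia jb by simp_all
    have "germ_eq x (i, a) (l, ?a)" "germ_eq x (j, b) (l, ?b)"
      using l t_refl[OF l(1) x ab(1)] t_refl[OF l(1) x ab(2)] r_refl[OF l(1)] by (auto simp: germ_eq_def)
    then have "w = v l x ?a" "w' = v l x ?b" using v_iff ia jb l x ab by simp_all
    moreover have "m = c l x ?a" "m' = c l x ?b" using c_t l x ia jb by simp_all
    moreover have "?a \<otimes>\<^bsub>Ob (A l) x\<^esub> ?b \<in> elts (A l) x"
      using lmodule.group_Ob[OF lmodule[OF A_module[OF l(1)]] x] ab by (intro monoid.m_closed group.is_monoid)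
    ultimately show "T x (w \<otimes>\<^bsub>Ob N x\<^esub> w') (m \<otimes>\<^bsub>Ob M x\<^esub> m')"
      unfolding T_def using l(1) module_hom_mult[OF v[OF l(1)] x ab] module_hom_mult[OF c[OF l(1)] x ab]
      by (intro bexI[of _ l] bexI[of _ "?a \<otimes>\<^bsub>Ob (A l) x\<^esub> ?b"]) simp_all
  next
    fix x y f w m assume x: "x \<in> Obj R" "y \<in> Obj R" "f \<in> Hom R x y" and "T x w m"
    then obtain i a where ia: "i \<in> I" "a \<in> elts (A i) x" "m = c i x a" "w = v i x a"
      unfolding T_def by auto
    then show "T y (Ar N x y f w) (Ar M x y f m)"
      unfolding T_def using x module_hom_Ar[OF v[OF ia(1)] x ia(2)] module_hom_Ar[OF c[OF ia(1)] x ia(2)]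
        lmodule.Ar_in[OF lmodule[OF A_module[OF ia(1)]] x ia(2)]
      by (intro bexI[of _ i] bexI[of _ "Ar (A i) x y f a"]) simp_all
  qed (rule that, blast+)
  have k_v: "k x (v i x a) = c i x a" if "i \<in> I" "x \<in> Obj R" "a \<in> elts (A i) x" for i x a
    using k(2)[OF that(2)] that unfolding T_def by blast
  have "Cmp (LMod R) M N M k h = Id (LMod R) M"
  proof -
    have 1: "Cmp (LMod R) M N M k h \<in> module_hom R M M" using M h(1) k(1) by (rule module_hom_Cmp)
    have 2: "Id (LMod R) M \<in> module_hom R M M" using M by (rule module_hom_Id)
    have "Cmp (LMod R) (A i) M M f (c i) = c i"
      if "i \<in> I" "f \<in> module_hom R M M" "\<And>x a. \<lbrakk>x \<in> Obj R; a \<in> elts (A i) x\<rbrakk> \<Longrightarrow> f x (c i x a) = c i x a" for i f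
      using that by (intro module_hom_eqI[OF module_hom_Cmp[OF A_module c] c]) simp_all
    then have "\<forall>i\<in>I. Cmp (LMod R) (A i) M M (Cmp (LMod R) M N M k h) (c i) = c i"
      "\<forall>i\<in>I. Cmp (LMod R) (A i) M M (Id (LMod R) M) (c i) = c i"
      using 1 2 h_c k_v module_hom_in[OF c] by simp_all
    moreover have "\<exists>!f. f \<in> module_hom R M M \<and> (\<forall>i\<in>I. Cmp (LMod R) (A i) M M f (c i) = c i)"
      using colim cocone unfolding is_colimit_def by simp
    ultimately show ?thesis using 1 2 by blast
  qed
  then have k_h: "k x (h x m) = m" if "x \<in> Obj R" "m \<in> elts M x" for x m
    using that LMod_simps(3,4) by metis
  show "\<exists>i\<in>I. \<exists>a\<in>elts (A i) x. c i x a = m" if x: "x \<in> Obj R" "m \<in> elts M x" for x m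
  proof -
    have "h x m \<in> elts N x" using module_hom_in[OF h(1) x] .
    then obtain i a where "i \<in> I" "a \<in> elts (A i) x" "h x m = v i x a" using car[OF x(1)] by blast
    then show ?thesis using k_h[OF x] k_v[OF _ x(1)] by metis
  qed
qed

end

context small_product_cat
begin

text \<open>
  Fewer than \<open>\<kappa>\<close> elements, or equalities between elements, of the colimit are all realised at one
  stage, because \<open>\<kappa>\<close>-directedness bounds their indices; there the product property holds.
\<close>

lemma directed_colimit_elt_preserving:
  fixes M :: "('o, 'h, 'u) module" and I :: "'i set"
  assumes size: "|I \<times> (UNIV :: 'u set)| \<le>o |UNIV :: 'u set|"
    and I: "directed_poset \<kappa> I r" and D: "is_functor (poset_cat I r) (LMod R) D"
    and preserving: "\<And>i. i \<in> I \<Longrightarrow> elt_preserving (Ob D i)"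
    and colim: "is_colimit (poset_cat I r) (LMod R) D M c"
  shows "elt_preserving M"
proof -
  note po = directed_posetD[OF I]
  interpret directed_diagram R I r D
  proof
    show "(i, k) \<in> r" if "(i, j) \<in> r" "(j, k) \<in> r" for i j k using po(2) that .
    show "I \<noteq> {}" using po(4)[of "{}"] small_finite by auto
    show "\<exists>k\<in>I. (i, k) \<in> r \<and> (j, k) \<in> r" if "i \<in> I" "j \<in> I" for i j
      using po(4)[of "{i, j}"] small_finite[of "{i, j}"] that by auto
  qed (use po D in auto)
  note surj = colimit_surj[OF size colim] and eq = colimit_eq[OF size colim]
  have cocone: "is_cocone (poset_cat I r) (LMod R) D M c"
    using colim by (simp add: is_colimit_def)
  then have M: "left_module R M" and c: "\<And>i. i \<in> I \<Longrightarrow> c i \<in> module_hom R (A i) M"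
    by (simp_all add: is_cocone_def)
  note c_t = cocone_t[OF cocone]
  show ?thesis
    unfolding elt_preserving_def
  proof (intro allI impI)
    fix S :: "'l set" and X p \<pi>
    assume S: "|S| <o \<kappa>" and prod: "is_product R S X p \<pi>"
    note p = is_productD[OF prod]
    have elt: "elt_product (A i) S X p \<pi>" if "i \<in> I" for i
      by (rule elt_preserving_product[OF preserving[OF that] S prod])
    have unique: "b = b'" if b: "b \<in> elts M p" "b' \<in> elts M p"
      and pb: "\<And>s. s \<in> S \<Longrightarrow> Ar M p (X s) (\<pi> s) b = Ar M p (X s) (\<pi> s) b'" for b b'
    proof -
      obtain i a j a' where ia: "i \<in> I" "a \<in> elts (A i) p" "c i p a = b"
        and ja: "j \<in> I" "a' \<in> elts (A j) p" "c j p a' = b'"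
        using surj[OF p(1)] b by metis
      have "germ_eq (X s) (i, Ar (A i) p (X s) (\<pi> s) a) (j, Ar (A j) p (X s) (\<pi> s) a')" if s: "s \<in> S" for s
      proof (rule eq[OF p(2)[OF s] ia(1) ja(1)])
        show "Ar (A i) p (X s) (\<pi> s) a \<in> elts (A i) (X s)"
          by (rule lmodule.Ar_in[OF lmodule[OF A_module[OF ia(1)]] p(1) p(2)[OF s] p(3)[OF s] ia(2)])
        show "Ar (A j) p (X s) (\<pi> s) a' \<in> elts (A j) (X s)"
          by (rule lmodule.Ar_in[OF lmodule[OF A_module[OF ja(1)]] p(1) p(2)[OF s] p(3)[OF s] ja(2)])
        show "c i (X s) (Ar (A i) p (X s) (\<pi> s) a) = c j (X s) (Ar (A j) p (X s) (\<pi> s) a')"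
          using module_hom_Ar[OF c[OF ia(1)] p(1) p(2)[OF s] p(3)[OF s] ia(2)]
            module_hom_Ar[OF c[OF ja(1)] p(1) p(2)[OF s] p(3)[OF s] ja(2)] pb[OF s] ia(3) ja(3) by simp
      qed
      then have "\<forall>s\<in>S. \<exists>l. (i, l) \<in> r \<and> (j, l) \<in> r \<and>
          t i l (X s) (Ar (A i) p (X s) (\<pi> s) a) = t j l (X s) (Ar (A j) p (X s) (\<pi> s) a')"
        by (simp add: germ_eq_def)
      then obtain l where l: "\<And>s. s \<in> S \<Longrightarrow> (i, l s) \<in> r" "\<And>s. s \<in> S \<Longrightarrow> (j, l s) \<in> r"
          "\<And>s. s \<in> S \<Longrightarrow> t i (l s) (X s) (Ar (A i) p (X s) (\<pi> s) a) = t j (l s) (X s) (Ar (A j) p (X s) (\<pi> s) a')"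
        by metis
      have "insert i (insert j (l ` S)) \<subseteq> I" using ia ja l r_sub by blast
      moreover have "|insert i (insert j (l ` S))| <o \<kappa>"
        using small_Un[OF small_finite[of "{i, j}"] small_image[OF S, of l]] by simp
      ultimately obtain u where u: "u \<in> I" "(i, u) \<in> r" "(j, u) \<in> r" "\<And>s. s \<in> S \<Longrightarrow> (l s, u) \<in> r"
        using po(4) by (metis insert_iff image_eqI)
      have tu: "t i u p a \<in> elts (A u) p" "t j u p a' \<in> elts (A u) p"
        using t_in u p ia ja by simp_all
      have proj: "Ar (A u) p (X s) (\<pi> s) (t i u p a) = Ar (A u) p (X s) (\<pi> s) (t j u p a')" if s: "s \<in> S" for s
      proof -
        have "t i u (X s) (Ar (A i) p (X s) (\<pi> s) a) = t j u (X s) (Ar (A j) p (X s) (\<pi> s) a')"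
          by (rule germ_eq_later[OF p(2)[OF s] l(1)[OF s] l(2)[OF s] u(4)[OF s] _ _ l(3)[OF s]])
             (rule lmodule.Ar_in[OF lmodule[OF A_module[OF ia(1)]] p(1) p(2)[OF s] p(3)[OF s] ia(2)],
              rule lmodule.Ar_in[OF lmodule[OF A_module[OF ja(1)]] p(1) p(2)[OF s] p(3)[OF s] ja(2)])
        then show ?thesis
          using module_hom_Ar[OF t_hom[OF u(2)] p(1) p(2)[OF s] p(3)[OF s] ia(2)]
            module_hom_Ar[OF t_hom[OF u(3)] p(1) p(2)[OF s] p(3)[OF s] ja(2)] by simp
      qed
      have "t i u p a = t j u p a'"
        by (rule elt_product_eqI[OF elt[OF u(1)] tu _ proj])
           (rule lmodule.Ar_in[OF lmodule[OF A_module[OF u(1)]] p(1) p(2) p(3) tu(1)])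
      then show "b = b'" using c_t[OF u(2) p(1) ia(2)] c_t[OF u(3) p(1) ja(2)] ia(3) ja(3) by simp
    qed
    have "\<exists>b. b \<in> elts M p \<and> (\<forall>s\<in>S. Ar M p (X s) (\<pi> s) b = m s)"
      if m: "\<forall>s\<in>S. m s \<in> elts M (X s)" for m
    proof -
      have "\<forall>s\<in>S. \<exists>i a. i \<in> I \<and> a \<in> elts (A i) (X s) \<and> c i (X s) a = m s"
        using surj p(2) m by blast
      then obtain i a where ia: "\<And>s. s \<in> S \<Longrightarrow> i s \<in> I \<and> a s \<in> elts (A (i s)) (X s) \<and> c (i s) (X s) (a s) = m s"
        by metis
      have "i ` S \<subseteq> I" using ia by blast
      then obtain u where u: "u \<in> I" "\<And>s. s \<in> S \<Longrightarrow> (i s, u) \<in> r"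
        using po(4)[of "i ` S"] small_image[OF S, of i] by blast
      have "t (i s) u (X s) (a s) \<in> elts (A u) (X s)" if "s \<in> S" for s
        using t_in u(2) ia p(2) that by simp
      then obtain b where b: "b \<in> elts (A u) p" "\<And>s. s \<in> S \<Longrightarrow> Ar (A u) p (X s) (\<pi> s) b = t (i s) u (X s) (a s)"
        using elt_productE[OF elt[OF u(1)], of "\<lambda>s. t (i s) u (X s) (a s)"] by blast
      have "Ar M p (X s) (\<pi> s) (c u p b) = m s" if s: "s \<in> S" for s
        using module_hom_Ar[OF c[OF u(1)] p(1) p(2)[OF s] p(3)[OF s] b(1)] b(2)[OF s]
          c_t[OF u(2)[OF s] p(2)[OF s], of "a s"] ia[OF s] by simp
      then show ?thesis using module_hom_in[OF c[OF u(1)] p(1) b(1)] by blast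
    qed
    with unique show "elt_product M S X p \<pi>" unfolding elt_product_def by metis
  qed
qed

end

section \<open>Filtered comma categories\<close>

lemma comma_simps:
  "Obj (comma C A m) = {(p, f). p \<in> Obj C \<and> p \<in> A \<and> f \<in> Hom C p m}"
  "Hom (comma C A m) (p, f) (q, g) = {t \<in> Hom C p q. Cmp C p q m g t = f}"
  "Id (comma C A m) (p, f) = Id C p"
  "Cmp (comma C A m) (p, f) (q, g) (r, h) = Cmp C p q r"
  by (simp_all add: comma_def)

lemma category_comma:
  assumes C: "category C" and m: "m \<in> Obj C"
  shows "category (comma C A m)"
  unfolding category_def
proof (intro conjI ballI)
  fix u assume "u \<in> Obj (comma C A m)"
  then show "Id (comma C A m) u \<in> Hom (comma C A m) u u"
    using C m by (cases u) (simp add: comma_simps category_def)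
next
  fix u v w s t
  assume "u \<in> Obj (comma C A m)" "v \<in> Obj (comma C A m)" "w \<in> Obj (comma C A m)"
    "s \<in> Hom (comma C A m) u v" "t \<in> Hom (comma C A m) v w"
  then show "Cmp (comma C A m) u v w t s \<in> Hom (comma C A m) u w"
    using C m by (cases u; cases v; cases w) (simp add: comma_simps category_def)
next
  fix u v s
  assume "u \<in> Obj (comma C A m)" "v \<in> Obj (comma C A m)" "s \<in> Hom (comma C A m) u v"
  then show "Cmp (comma C A m) u u v s (Id (comma C A m) u) = s" "Cmp (comma C A m) u v v (Id (comma C A m) v) s = s"
    using C m by (cases u; cases v; simp add: comma_simps category_def)+
next
  fix a b c d f g h
  assume "a \<in> Obj (comma C A m)" "b \<in> Obj (comma C A m)" "c \<in> Obj (comma C A m)" "d \<in> Obj (comma C A m)"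
    "f \<in> Hom (comma C A m) a b" "g \<in> Hom (comma C A m) b c" "h \<in> Hom (comma C A m) c d"
  then show "Cmp (comma C A m) a c d h (Cmp (comma C A m) a b c g f) = Cmp (comma C A m) a b d (Cmp (comma C A m) b c d h g) f"
    using C m by (cases a; cases b; cases c; cases d) (simp add: comma_simps category_def)
qed

context small_product_cat
begin

text \<open>A small diagram may be indexed by any type; it is renamed into \<open>'l\<close>.\<close>

lemma filtered_category_cocone:
  fixes V :: "'v set" and H :: "'v \<Rightarrow> 'v \<Rightarrow> 'm set"
  assumes filtered: "filtered_category \<kappa> C" and C: "category C"
    and A: "\<And>i. i \<in> V \<Longrightarrow> A i \<in> Obj C"
    and H: "\<And>i j. \<lbrakk>i \<in> V; j \<in> V\<rbrakk> \<Longrightarrow> H i j \<subseteq> Hom C (A i) (A j)"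
    and H_Id: "\<And>i. i \<in> V \<Longrightarrow> Id C (A i) \<in> H i i"
    and H_Cmp: "\<And>i j k f g. \<lbrakk>i \<in> V; j \<in> V; k \<in> V; f \<in> H i j; g \<in> H j k\<rbrakk> \<Longrightarrow>
      Cmp C (A i) (A j) (A k) g f \<in> H i k"
    and small: "|{(i, j, f). i \<in> V \<and> j \<in> V \<and> f \<in> H i j}| <o \<kappa>"
  obtains n c where "n \<in> Obj C" "\<And>i. i \<in> V \<Longrightarrow> c i \<in> Hom C (A i) n"
    "\<And>i j f. \<lbrakk>i \<in> V; j \<in> V; f \<in> H i j\<rbrakk> \<Longrightarrow> Cmp C (A i) (A j) n (c j) f = c i"
proof -
  define E where "E = {(i, j, f). i \<in> V \<and> j \<in> V \<and> f \<in> H i j}"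
  define L where "L = (\<Union>i\<in>V. \<Union>j\<in>V. H i j)"
  have E: "|E| <o \<kappa>" using small by (simp add: E_def)
  have "|V| <o \<kappa>"
    by (rule small_subset[OF small_image[OF E, of fst]]) (use H_Id in \<open>force simp: E_def image_iff\<close>)
  then obtain b :: "'v \<Rightarrow> 'l" and S where b: "bij_betw b V S" by (rule small_bij_betw)
  have "|L| <o \<kappa>"
    by (rule small_subset[OF small_image[OF E, of "\<lambda>(i, j, f). f"]]) (force simp: E_def L_def image_iff)
  then obtain l :: "'m \<Rightarrow> 'l" and S' where l: "bij_betw l L S'" by (rule small_bij_betw)
  define b' l' where "b' = the_inv_into V b" and "l' = the_inv_into L l"
  have b': "b' s \<in> V" "b (b' s) = s" if "s \<in> S" for s
    using that bij_betwE[OF bij_betw_the_inv_into[OF b]] f_the_inv_into_f_bij_betw[OF b] by (auto simp: b'_def)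
  have bb: "b i \<in> S" "b' (b i) = i" if "i \<in> V" for i
    using that b by (auto simp: b'_def the_inv_into_f_f bij_betw_def)
  have ll: "l' (l f) = f" if "i \<in> V" "j \<in> V" "f \<in> H i j" for i j f
    using that l by (auto simp: l'_def L_def intro!: the_inv_into_f_f bij_betw_imp_inj_on)
  define J :: "('l, 'l) cat" where "J = \<lparr>Obj = S, Hom = (\<lambda>s t. l ` H (b' s) (b' t)),
    Id = (\<lambda>s. l (Id C (A (b' s)))), Cmp = (\<lambda>s t u g f. l (Cmp C (A (b' s)) (A (b' t)) (A (b' u)) (l' g) (l' f)))\<rparr>"
  define D where "D = \<lparr>Ob = (\<lambda>s. A (b' s)), Ar = (\<lambda>(s :: 'l) (t :: 'l) f. l' f)\<rparr>"
  have J: "Obj J = S" "Hom J s t = l ` H (b' s) (b' t)" "Id J s = l (Id C (A (b' s)))"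
    "Cmp J s t u g f = l (Cmp C (A (b' s)) (A (b' t)) (A (b' u)) (l' g) (l' f))" for s t u g f
    by (simp_all add: J_def)
  have HC: "f \<in> Hom C (A i) (A j)" if "i \<in> V" "j \<in> V" "f \<in> H i j" for i j f using H that by blast
  have "category J"
    unfolding category_def
  proof (intro conjI ballI; unfold J(1,2))
    fix s assume "s \<in> S"
    then show "Id J s \<in> l ` H (b' s) (b' s)" using H_Id b' by (simp add: J)
  next
    fix s t u f g
    assume *: "s \<in> S" "t \<in> S" "u \<in> S" "f \<in> l ` H (b' s) (b' t)" "g \<in> l ` H (b' t) (b' u)"
    then obtain f' g' where f': "f' \<in> H (b' s) (b' t)" "f = l f'" "g' \<in> H (b' t) (b' u)" "g = l g'" by blast
    note V = b'(1)[OF *(1)] b'(1)[OF *(2)] b'(1)[OF *(3)]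
    show "Cmp J s t u g f \<in> l ` H (b' s) (b' u)"
      using H_Cmp[OF V f'(1,3)] ll[OF V(1,2) f'(1)] ll[OF V(2,3) f'(3)] by (simp add: J f')
  next
    fix s t f
    assume *: "s \<in> S" "t \<in> S" "f \<in> l ` H (b' s) (b' t)"
    then obtain f' where f': "f' \<in> H (b' s) (b' t)" "f = l f'" by blast
    have "l' (l f') = f'" "l' (l (Id C (A (b' s)))) = Id C (A (b' s))" "l' (l (Id C (A (b' t)))) = Id C (A (b' t))"
      using ll[OF _ _ f'(1)] ll[OF _ _ H_Id] b'(1) * by auto
    then show "Cmp J s s t f (Id J s) = f" "Cmp J s t t (Id J t) f = f"
      using HC[OF _ _ f'(1)] b'(1) * f' A C by (simp_all add: J category_def)
  next
    fix s t u w f g h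
    assume *: "s \<in> S" "t \<in> S" "u \<in> S" "w \<in> S"
      "f \<in> l ` H (b' s) (b' t)" "g \<in> l ` H (b' t) (b' u)" "h \<in> l ` H (b' u) (b' w)"
    then obtain f' g' h' where f': "f' \<in> H (b' s) (b' t)" "f = l f'" "g' \<in> H (b' t) (b' u)" "g = l g'"
      "h' \<in> H (b' u) (b' w)" "h = l h'" by blast
    note V = b'(1)[OF *(1)] b'(1)[OF *(2)] b'(1)[OF *(3)] b'(1)[OF *(4)]
    note lls = ll[OF V(1,2) f'(1)] ll[OF V(2,3) f'(3)] ll[OF V(3,4) f'(5)]
      ll[OF V(1,3) H_Cmp[OF V(1-3) f'(1,3)]] ll[OF V(2,4) H_Cmp[OF V(2-4) f'(3,5)]]
    show "Cmp J s u w h (Cmp J s t u g f) = Cmp J s t w (Cmp J t u w h g) f"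
      using C A[OF V(1)] A[OF V(2)] A[OF V(3)] A[OF V(4)] HC[OF V(1,2) f'(1)] HC[OF V(2,3) f'(3)] HC[OF V(3,4) f'(5)]
      by (simp add: J f' lls category_def)
  qed
  moreover have "|arrows J| <o \<kappa>"
  proof (rule small_subset[OF small_image[OF E]])
    show "arrows J \<subseteq> (\<lambda>(i, j, f). (b i, b j, l f)) ` E"
    proof
      fix a assume "a \<in> arrows J"
      then obtain s t f where a: "a = (s, t, l f)" "s \<in> S" "t \<in> S" "f \<in> H (b' s) (b' t)"
        by (auto simp: arrows_def J)
      then show "a \<in> (\<lambda>(i, j, f). (b i, b j, l f)) ` E"
        using b' by (intro image_eqI[of _ _ "(b' s, b' t, f)"]) (simp_all add: E_def)
    qed
  qed
  moreover have "is_functor J C D"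
    unfolding is_functor_def
  proof (intro conjI ballI; unfold J(1,2))
    fix s assume s: "s \<in> S"
    show "Ob D s \<in> Obj C" using A b' s by (simp add: D_def)
    show "Ar D s s (Id J s) = Id C (Ob D s)" using ll[OF _ _ H_Id] b' s by (simp add: D_def J)
  next
    fix s t f assume *: "s \<in> S" "t \<in> S" "f \<in> l ` H (b' s) (b' t)"
    then show "Ar D s t f \<in> Hom C (Ob D s) (Ob D t)"
      using ll[OF b'(1) b'(1)] HC[OF b'(1) b'(1)] by (auto simp: D_def)
  next
    fix s t u f g assume *: "s \<in> S" "t \<in> S" "u \<in> S" "f \<in> l ` H (b' s) (b' t)" "g \<in> l ` H (b' t) (b' u)"
    then obtain f' g' where f': "f' \<in> H (b' s) (b' t)" "f = l f'" "g' \<in> H (b' t) (b' u)" "g = l g'" by blast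
    note V = b'(1)[OF *(1)] b'(1)[OF *(2)] b'(1)[OF *(3)]
    show "Ar D s u (Cmp J s t u g f) = Cmp C (Ob D s) (Ob D t) (Ob D u) (Ar D t u g) (Ar D s t f)"
      using ll[OF V(1,2) f'(1)] ll[OF V(2,3) f'(3)] ll[OF V(1,3) H_Cmp[OF V f'(1,3)]]
      by (simp add: D_def J f')
  qed
  ultimately obtain n c where nc: "is_cocone J C D n c"
    using filtered unfolding filtered_category_def by blast
  show thesis
  proof (rule that[of n "\<lambda>i. c (b i)"])
    show "n \<in> Obj C" using nc by (simp add: is_cocone_def)
    show "c (b i) \<in> Hom C (A i) n" if "i \<in> V" for i
      using nc bb[OF that] by (auto simp: is_cocone_def J D_def)
    show "Cmp C (A i) (A j) n (c (b j)) f = c (b i)" if *: "i \<in> V" "j \<in> V" "f \<in> H i j" for i j f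
    proof -
      have "\<forall>s\<in>S. \<forall>t\<in>S. \<forall>g\<in>l ` H (b' s) (b' t). Cmp C (A (b' s)) (A (b' t)) n (c t) (l' g) = c s"
        using nc by (simp add: is_cocone_def J D_def)
      then have "Cmp C (A (b' (b i))) (A (b' (b j))) n (c (b j)) (l' (l f)) = c (b i)"
        using bb[OF *(1)] bb[OF *(2)] *(3) by (metis imageI)
      then show ?thesis using bb * ll by simp
    qed
  qed
qed

text \<open>
  Empty sets \<open>U s\<close> give a common target for the family of all \<open>a s\<close>. Two arrows in \<open>U s\<close> are
  coequalised by \<open>d\<close>, for all \<open>s\<close> simultaneously.
\<close>

lemma filtered_category_fan:
  fixes S :: "'s set"
  assumes filtered: "filtered_category \<kappa> C" and C: "category C" and S: "|S| <o \<kappa>"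
    and a: "\<And>s. s \<in> S \<Longrightarrow> a s \<in> Obj C" and b: "b \<in> Obj C"
    and U: "\<And>s. s \<in> S \<Longrightarrow> U s \<subseteq> Hom C (a s) b" and U2: "\<And>s. s \<in> S \<Longrightarrow> U s \<subseteq> {u s, v s}"
  obtains n c d where "n \<in> Obj C" "\<And>s. s \<in> S \<Longrightarrow> c s \<in> Hom C (a s) n" "d \<in> Hom C b n"
    "\<And>s f. \<lbrakk>s \<in> S; f \<in> U s\<rbrakk> \<Longrightarrow> Cmp C (a s) b n d f = c s"
proof -
  define V where "V = insert None (Some ` S)"
  define A where "A = case_option b a"
  define H where "H i j = (if i = j then {Id C (A i)} else case i of None \<Rightarrow> {} |
    Some s \<Rightarrow> (case j of None \<Rightarrow> U s | Some _ \<Rightarrow> {}))" for i j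
  have A: "A i \<in> Obj C" if "i \<in> V" for i using that a b by (auto simp: V_def A_def)
  have HC: "H i j \<subseteq> Hom C (A i) (A j)" if "i \<in> V" "j \<in> V" for i j
  proof -
    have "Id C (A i) \<in> Hom C (A i) (A i)" using C A[OF that(1)] by (simp add: category_def)
    then show ?thesis
      using that U[THEN subsetD] by (auto simp: H_def V_def A_def split: if_splits)
  qed
  have small: "|{(i, j, f). i \<in> V \<and> j \<in> V \<and> f \<in> H i j}| <o \<kappa>"
  proof (rule small_subset)
    show "{(i, j, f). i \<in> V \<and> j \<in> V \<and> f \<in> H i j} \<subseteq> {(None, None, Id C b)} \<union>
      ((\<lambda>s. (Some s, Some s, Id C (a s))) ` S \<union> ((\<lambda>s. (Some s, None, u s)) ` S \<union> (\<lambda>s. (Some s, None, v s)) ` S))"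
      using U2[THEN subsetD] by (auto simp: H_def V_def A_def image_iff split: if_splits) blast+
    show "|{(None, None, Id C b)} \<union>
      ((\<lambda>s. (Some s, Some s, Id C (a s))) ` S \<union> ((\<lambda>s. (Some s, None, u s)) ` S \<union> (\<lambda>s. (Some s, None, v s)) ` S))| <o \<kappa>"
      by (intro small_Un small_image S small_finite) simp
  qed
  have H_Cmp: "Cmp C (A i) (A j) (A k) g f \<in> H i k" if "i \<in> V" "j \<in> V" "k \<in> V" "f \<in> H i j" "g \<in> H j k" for i j k f g
  proof -
    have unit: "Cmp C x x y h (Id C x) = h" "Cmp C x y y (Id C y) h = h"
      if "x \<in> Obj C" "y \<in> Obj C" "h \<in> Hom C x y" for x y h
      using C that by (simp_all add: category_def)
    have "i = j \<or> j = k" using that by (auto simp: H_def split: if_splits option.splits)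
    then show ?thesis
    proof
      assume "i = j"
      then have "f = Id C (A j)" using that(4) by (simp add: H_def)
      then show ?thesis using \<open>i = j\<close> that A unit(1) HC[OF that(2,3)] by auto
    next
      assume "j = k"
      then have "g = Id C (A j)" using that(5) by (simp add: H_def)
      then show ?thesis using \<open>j = k\<close> that A unit(2) HC[OF that(1,2)] by auto
    qed
  qed
  obtain n c where nc: "n \<in> Obj C" "\<And>i. i \<in> V \<Longrightarrow> c i \<in> Hom C (A i) n"
    "\<And>i j f. \<lbrakk>i \<in> V; j \<in> V; f \<in> H i j\<rbrakk> \<Longrightarrow> Cmp C (A i) (A j) n (c j) f = c i"
  proof (rule filtered_category_cocone[OF filtered C, of V A H])
    show "Id C (A i) \<in> H i i" for i by (simp add: H_def)
    show "A i \<in> Obj C" if "i \<in> V" for i by (rule A[OF that])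
    show "H i j \<subseteq> Hom C (A i) (A j)" if "i \<in> V" "j \<in> V" for i j by (rule HC[OF that])
    show "Cmp C (A i) (A j) (A k) g f \<in> H i k" if "i \<in> V" "j \<in> V" "k \<in> V" "f \<in> H i j" "g \<in> H j k" for i j k f g
      by (rule H_Cmp[OF that])
  qed (rule small, rule that, blast+)
  show thesis
  proof (rule that[of n "\<lambda>s. c (Some s)" "c None"])
    show "n \<in> Obj C" by fact
    show "c (Some s) \<in> Hom C (a s) n" if "s \<in> S" for s using nc(2)[of "Some s"] that by (simp add: V_def A_def)
    show "c None \<in> Hom C b n" using nc(2)[of None] by (simp add: V_def A_def)
    show "Cmp C (a s) b n (c None) f = c (Some s)" if "s \<in> S" "f \<in> U s" for s f
      using nc(3)[of "Some s" None f] that by (simp add: V_def A_def H_def)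
  qed
qed

text \<open>
  The representable modules, moved into \<open>'u\<close> as the quotients by the relation zero.
\<close>

lemma exists_free_modules:
  assumes small: "|arrows R| \<le>o |UNIV :: 'u set|"
  obtains Y :: "'o \<Rightarrow> ('o, 'h, 'u) module" and \<upsilon>
  where "\<And>x. x \<in> Obj R \<Longrightarrow> presents x x (Nul R x x) (Y x) (\<upsilon> x)"
proof -
  have "\<exists>Y :: ('o, 'h, 'u) module. \<exists>\<upsilon>. presents x x (Nul R x x) Y \<upsilon>" if x: "x \<in> Obj R" for x
    using exists_presents[OF small x x Nul_in[OF x x]] by blast
  then show thesis using that by metis
qed

text \<open>
  A family of elements \<open>m s\<close> is a family of maps from representables to \<open>M\<close>. A cocone on these in the
  comma category is a finitely presented \<open>P\<close> over \<open>M\<close> with a family of preimages of the \<open>m s\<close>; this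
  family comes from an element of \<open>P(p)\<close>, whose image in \<open>M\<close> is the required element. If all
  projections of \<open>m \<in> M(p)\<close> vanish, then for every \<open>s\<close> the map induced by \<open>\<pi> s\<close> and the zero map
  are parallel arrows over \<open>M\<close> from the representable of \<open>X s\<close>, over the element zero, to that of \<open>p\<close>,
  over \<open>m\<close>. A cocone then yields a preimage of \<open>m\<close> in some \<open>P(p)\<close> with vanishing projections, so \<open>m\<close> is zero.
\<close>

lemma filtered_comma_elt_preserving:
  fixes M :: "('o, 'h, 'u) module"
  assumes small: "|arrows R| \<le>o |UNIV :: 'u set|" and M: "left_module R M"
    and filtered: "filtered_category \<kappa> (comma (LMod R) {P. finitely_presented R P} M)"
  shows "elt_preserving M"
  unfolding elt_preserving_def
proof (intro allI impI)
  interpret M: lmodule R M by (rule lmodule) fact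
  let ?C = "comma (LMod R) {P. finitely_presented R P} M"
  fix S :: "'l set" and X p \<pi>
  assume S: "|S| <o \<kappa>" and prod: "is_product R S X p \<pi>"
  note p = is_productD[OF prod]
  have C: "category ?C" using category_LMod M by (intro category_comma) simp_all
  have C_Obj: "(P, f) \<in> Obj ?C \<longleftrightarrow> finitely_presented R P \<and> f \<in> module_hom R P M" for P f
    by (auto simp: comma_simps finitely_presented_def)
  have C_Hom: "t \<in> Hom ?C (P, f) (Q, g) \<longleftrightarrow> t \<in> module_hom R P Q \<and> Cmp (LMod R) P Q M g t = f" for P Q f g t
    by (simp add: comma_simps)
  obtain Y :: "'o \<Rightarrow> ('o, 'h, 'u) module" and \<upsilon> where Y: "\<And>x. x \<in> Obj R \<Longrightarrow> presents x x (Nul R x x) (Y x) (\<upsilon> x)"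
    by (rule exists_free_modules[OF small]) (rule that)
  have Y_fp: "finitely_presented R (Y x)" if "x \<in> Obj R" for x
    using Y[OF that] finitely_presented_iff_presents by blast
  have Y_mod: "left_module R (Y x)" and \<upsilon>: "\<upsilon> x \<in> elts (Y x) x"
    if "x \<in> Obj R" for x
    using Y[OF that] by (simp_all add: presents_def)
  have Y_hom: "\<exists>t\<in>module_hom R (Y x) N. t x (\<upsilon> x) = n"
    if "x \<in> Obj R" "left_module R N" "n \<in> elts N x" for x n and N :: "('o, 'h, 'u) module"
    using presents_hom[OF Y[OF that(1)] that(2,3)] lmodule.Ar_Nul[OF lmodule[OF that(2)] that(1,1,3)] by blast
  have "\<forall>x m. \<exists>t. x \<in> Obj R \<longrightarrow> m \<in> elts M x \<longrightarrow> t \<in> module_hom R (Y x) M \<and> t x (\<upsilon> x) = m"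
    using Y_hom[OF _ M] by metis
  then obtain F where F: "\<And>x m. \<lbrakk>x \<in> Obj R; m \<in> elts M x\<rbrakk> \<Longrightarrow> F x m \<in> module_hom R (Y x) M"
    "\<And>x m. \<lbrakk>x \<in> Obj R; m \<in> elts M x\<rbrakk> \<Longrightarrow> F x m x (\<upsilon> x) = m"
    by metis
  have Y_Obj: "(Y x, F x m) \<in> Obj ?C" if "x \<in> Obj R" "m \<in> elts M x" for x m
    using C_Obj F(1) Y_fp that by simp
  have one: "\<one>\<^bsub>Ob M x\<^esub> \<in> elts M x" if "x \<in> Obj R" for x
    using M.group_Ob[OF that] by (simp add: group.is_monoid monoid.one_closed)
  have surj: "\<exists>b. b \<in> elts M p \<and> (\<forall>s\<in>S. Ar M p (X s) (\<pi> s) b = m s)"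
    if m: "\<forall>s\<in>S. m s \<in> elts M (X s)" for m
  proof -
    obtain n c where n: "n \<in> Obj ?C" and c: "\<And>s. s \<in> S \<Longrightarrow> c s \<in> Hom ?C (Y (X s), F (X s) (m s)) n"
    proof (rule filtered_category_fan[OF filtered C S])
      show "(Y (X s), F (X s) (m s)) \<in> Obj ?C" if "s \<in> S" for s using Y_Obj p(2) m that by simp
      show "(Y p, F p \<one>\<^bsub>Ob M p\<^esub>) \<in> Obj ?C" using Y_Obj p(1) one by simp
      show "{} \<subseteq> Hom ?C (Y (X s), F (X s) (m s)) (Y p, F p \<one>\<^bsub>Ob M p\<^esub>)" for s by simp
    qed (auto intro: that)
    obtain P \<phi> where n_eq: "n = (P, \<phi>)" by force
    have P: "finitely_presented R P" "\<phi> \<in> module_hom R P M" using n C_Obj n_eq by simp_all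
    have c1: "c s \<in> module_hom R (Y (X s)) P" "Cmp (LMod R) (Y (X s)) P M \<phi> (c s) = F (X s) (m s)" if "s \<in> S" for s
      using c[OF that] C_Hom n_eq by simp_all
    let ?a = "\<lambda>s. c s (X s) (\<upsilon> (X s))"
    have a: "?a s \<in> elts P (X s)" if "s \<in> S" for s
      using module_hom_in[OF c1(1)[OF that] p(2)[OF that] \<upsilon>] p(2) that by simp
    have \<phi>a: "\<phi> (X s) (?a s) = m s" if "s \<in> S" for s
      using fun_cong[OF fun_cong[OF c1(2)[OF that]], of "X s" "\<upsilon> (X s)"] p(2) \<upsilon> F(2) m that by simp
    obtain b where b: "b \<in> elts P p" "\<And>s. s \<in> S \<Longrightarrow> Ar P p (X s) (\<pi> s) b = ?a s"
      using elt_productE[OF elt_preserving_product[OF finitely_presented_elt_preserving[OF P(1)] S prod] a] by blast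
    have "Ar M p (X s) (\<pi> s) (\<phi> p b) = m s" if s: "s \<in> S" for s
      using module_hom_Ar[OF P(2) p(1) p(2)[OF s] p(3)[OF s] b(1)] b(2)[OF s] \<phi>a[OF s] by simp
    then show ?thesis using module_hom_in[OF P(2) p(1) b(1)] by blast
  qed
  have ker: "m = \<one>\<^bsub>Ob M p\<^esub>" if m: "m \<in> elts M p" and m0: "\<And>s. s \<in> S \<Longrightarrow> Ar M p (X s) (\<pi> s) m = \<one>\<^bsub>Ob M (X s)\<^esub>" for m
  proof -
    interpret Yp: lmodule R "Y p" using Y_mod[OF p(1)] by (rule lmodule)
    have Yp_one: "\<one>\<^bsub>Ob (Y p) x\<^esub> \<in> elts (Y p) x" if "x \<in> Obj R" for x
      using Yp.group_Ob[OF that] by (simp add: group.is_monoid monoid.one_closed)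
    have "\<forall>s. \<exists>t. s \<in> S \<longrightarrow> t \<in> module_hom R (Y (X s)) (Y p) \<and> t (X s) (\<upsilon> (X s)) = Ar (Y p) p (X s) (\<pi> s) (\<upsilon> p)"
      using Y_hom[OF p(2) Yp.left_module Yp.Ar_in[OF p(1) p(2) p(3) \<upsilon>[OF p(1)]]] by metis
    then obtain u where u: "\<And>s. s \<in> S \<Longrightarrow> u s \<in> module_hom R (Y (X s)) (Y p)"
      "\<And>s. s \<in> S \<Longrightarrow> u s (X s) (\<upsilon> (X s)) = Ar (Y p) p (X s) (\<pi> s) (\<upsilon> p)" by metis
    have "\<forall>s. \<exists>t. s \<in> S \<longrightarrow> t \<in> module_hom R (Y (X s)) (Y p) \<and> t (X s) (\<upsilon> (X s)) = \<one>\<^bsub>Ob (Y p) (X s)\<^esub>"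
      using Y_hom[OF p(2) Yp.left_module Yp_one[OF p(2)]] by metis
    then obtain v where v: "\<And>s. s \<in> S \<Longrightarrow> v s \<in> module_hom R (Y (X s)) (Y p)"
      "\<And>s. s \<in> S \<Longrightarrow> v s (X s) (\<upsilon> (X s)) = \<one>\<^bsub>Ob (Y p) (X s)\<^esub>" by metis
    have over: "t \<in> Hom ?C (Y (X s), F (X s) \<one>\<^bsub>Ob M (X s)\<^esub>) (Y p, F p m)"
      if s: "s \<in> S" and t: "t \<in> module_hom R (Y (X s)) (Y p)"
        and eq: "F p m (X s) (t (X s) (\<upsilon> (X s))) = \<one>\<^bsub>Ob M (X s)\<^esub>" for s t
      unfolding C_Hom
    proof (rule conjI[OF t], rule presents_hom_eqI[OF Y[OF p(2)[OF s]]])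
      show "Cmp (LMod R) (Y (X s)) (Y p) M (F p m) t \<in> module_hom R (Y (X s)) M"
        by (rule module_hom_Cmp[OF Y_mod[OF p(2)[OF s]] t F(1)[OF p(1) m]])
      show "F (X s) \<one>\<^bsub>Ob M (X s)\<^esub> \<in> module_hom R (Y (X s)) M" by (rule F(1)[OF p(2)[OF s] one[OF p(2)[OF s]]])
      show "Cmp (LMod R) (Y (X s)) (Y p) M (F p m) t (X s) (\<upsilon> (X s)) = F (X s) \<one>\<^bsub>Ob M (X s)\<^esub> (X s) (\<upsilon> (X s))"
        using p(2)[OF s] \<upsilon> eq F(2)[OF p(2)[OF s] one[OF p(2)[OF s]]] by simp
    qed
    obtain n c d where n: "n \<in> Obj ?C" and d: "d \<in> Hom ?C (Y p, F p m) n"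
      and eq: "\<And>s f. \<lbrakk>s \<in> S; f \<in> {u s, v s}\<rbrakk> \<Longrightarrow> Cmp ?C (Y (X s), F (X s) \<one>\<^bsub>Ob M (X s)\<^esub>) (Y p, F p m) n d f = c s"
    proof (rule filtered_category_fan[OF filtered C S])
      show "(Y (X s), F (X s) \<one>\<^bsub>Ob M (X s)\<^esub>) \<in> Obj ?C" if "s \<in> S" for s using Y_Obj p(2) one that by simp
      show "(Y p, F p m) \<in> Obj ?C" using Y_Obj p(1) m by simp
      fix s assume s: "s \<in> S"
      have "F p m (X s) (u s (X s) (\<upsilon> (X s))) = \<one>\<^bsub>Ob M (X s)\<^esub>"
        using module_hom_Ar[OF F(1)[OF p(1) m] p(1) p(2)[OF s] p(3)[OF s] \<upsilon>[OF p(1)]] u(2)[OF s] F(2)[OF p(1) m] m0[OF s] by simp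
      moreover have "F p m (X s) (v s (X s) (\<upsilon> (X s))) = \<one>\<^bsub>Ob M (X s)\<^esub>"
        using module_hom_one[OF F(1)[OF p(1) m] p(2)[OF s] Yp.left_module M] v(2)[OF s] by simp
      ultimately show "{u s, v s} \<subseteq> Hom ?C (Y (X s), F (X s) \<one>\<^bsub>Ob M (X s)\<^esub>) (Y p, F p m)"
        using over[OF s u(1)[OF s]] over[OF s v(1)[OF s]] by simp
    qed (rule subset_refl, rule that, assumption+)
    obtain P \<phi> where n_eq: "n = (P, \<phi>)" by force
    have P: "finitely_presented R P" "\<phi> \<in> module_hom R P M" using n C_Obj n_eq by simp_all
    then have P_mod: "left_module R P" by (simp add: finitely_presented_def)
    interpret P: lmodule R P using P_mod by (rule lmodule)
    have d1: "d \<in> module_hom R (Y p) P" "Cmp (LMod R) (Y p) P M \<phi> d = F p m" using d C_Hom n_eq by simp_all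
    have b: "d p (\<upsilon> p) \<in> elts P p" using module_hom_in[OF d1(1) p(1) \<upsilon>[OF p(1)]] .
    have one_P: "\<one>\<^bsub>Ob P x\<^esub> \<in> elts P x" if "x \<in> Obj R" for x
      using P.group_Ob[OF that] by (simp add: group.is_monoid monoid.one_closed)
    have "d p (\<upsilon> p) = \<one>\<^bsub>Ob P p\<^esub>"
    proof (rule elt_product_eqI[OF elt_preserving_product[OF finitely_presented_elt_preserving[OF P(1)] S prod] b one_P[OF p(1)]])
      fix s assume s: "s \<in> S"
      show "Ar P p (X s) (\<pi> s) (d p (\<upsilon> p)) \<in> elts P (X s)" by (rule P.Ar_in[OF p(1) p(2)[OF s] p(3)[OF s] b])
      have "Cmp (LMod R) (Y (X s)) (Y p) P d (u s) = Cmp (LMod R) (Y (X s)) (Y p) P d (v s)"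
        using eq[OF s, of "u s"] eq[OF s, of "v s"] by (simp add: n_eq comma_simps)
      from fun_cong[OF fun_cong[OF this], of "X s" "\<upsilon> (X s)"]
      have "d (X s) (Ar (Y p) p (X s) (\<pi> s) (\<upsilon> p)) = d (X s) \<one>\<^bsub>Ob (Y p) (X s)\<^esub>"
        using p(2)[OF s] \<upsilon> u(2)[OF s] v(2)[OF s] by simp
      then show "Ar P p (X s) (\<pi> s) (d p (\<upsilon> p)) = Ar P p (X s) (\<pi> s) \<one>\<^bsub>Ob P p\<^esub>"
        using module_hom_Ar[OF d1(1) p(1) p(2)[OF s] p(3)[OF s] \<upsilon>[OF p(1)]]
          module_hom_one[OF d1(1) p(2)[OF s] Yp.left_module P_mod] P.Ar_one[OF p(1) p(2)[OF s] p(3)[OF s]] by simp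
    qed
    moreover have "\<phi> p (d p (\<upsilon> p)) = m"
      using fun_cong[OF fun_cong[OF d1(2)], of p "\<upsilon> p"] p(1) \<upsilon> F(2)[OF p(1) m] by simp
    ultimately show ?thesis using module_hom_one[OF P(2) p(1) P_mod M] by simp
  qed
  have "b = b'" if b: "b \<in> elts M p" "b' \<in> elts M p"
    and eq: "\<And>s. s \<in> S \<Longrightarrow> Ar M p (X s) (\<pi> s) b = Ar M p (X s) (\<pi> s) b'" for b b'
  proof -
    interpret group "Ob M p" using M.group_Ob[OF p(1)] .
    have "b \<otimes>\<^bsub>Ob M p\<^esub> inv\<^bsub>Ob M p\<^esub> b' = \<one>\<^bsub>Ob M p\<^esub>"
    proof (rule ker)
      show "b \<otimes>\<^bsub>Ob M p\<^esub> inv\<^bsub>Ob M p\<^esub> b' \<in> elts M p" using b by simp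
      fix s assume s: "s \<in> S"
      interpret group_hom "Ob M p" "Ob M (X s)" "Ar M p (X s) (\<pi> s)" using M.Ar_group_hom p s by simp
      show "Ar M p (X s) (\<pi> s) (b \<otimes>\<^bsub>Ob M p\<^esub> inv\<^bsub>Ob M p\<^esub> b') = \<one>\<^bsub>Ob M (X s)\<^esub>"
        using b eq[OF s] by simp
    qed
    then show ?thesis using b inv_equality[of b "inv\<^bsub>Ob M p\<^esub> b'"] by simp
  qed
  with surj show "elt_product M S X p \<pi>" unfolding elt_product_def by metis
qed

end

section \<open>Small graphs of elements\<close>

locale element_graphs = small_product_cat R \<kappa>
  for R :: "('o, 'h, 'z) acat_scheme" and \<kappa> :: "'l rel" +
  fixes M :: "('o, 'h, 'u) module"
  assumes small_arrows: "|arrows R| \<le>o |UNIV :: 'u set|"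
    and M: "left_module R M" and M_preserving: "elt_preserving M"
begin

sublocale M: lmodule R M
  by unfold_locales (rule M)

text \<open>
  The arrows of the category of elements of \<open>M\<close>.
\<close>

definition Elt :: "(('o \<times> 'u) \<times> ('o \<times> 'u) \<times> 'h) set" where
  "Elt = {((x, m), (y, n), f). x \<in> Obj R \<and> y \<in> Obj R \<and> f \<in> Hom R x y \<and>
    m \<in> elts M x \<and> n = Ar M x y f m}"

definition subgraph :: "(('o \<times> 'u) \<times> ('o \<times> 'u) \<times> 'h) set \<Rightarrow> bool" where
  "subgraph B \<longleftrightarrow> B \<subseteq> Elt \<and> |B| <o \<kappa>"

lemma subgraph_ends: "\<lbrakk>subgraph B; g \<in> ends B\<rbrakk> \<Longrightarrow> fst g \<in> Obj R \<and> snd g \<in> elts M (fst g)"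
  using M.Ar_in by (fastforce simp: subgraph_def ends_def Elt_def)

lemma subgraph_edge: "\<lbrakk>subgraph B; (g, g', f) \<in> B\<rbrakk> \<Longrightarrow> Ar M (fst g) (fst g') f (snd g) = snd g'"
  by (auto simp: subgraph_def Elt_def)

lemma compatible_snd: "subgraph B \<Longrightarrow> compatible fst B M snd"
  unfolding compatible_def by (simp add: subgraph_ends subgraph_edge split_beta)

lemma subgraph_Un: "\<lbrakk>subgraph B; subgraph B'\<rbrakk> \<Longrightarrow> subgraph (B \<union> B')"
  by (simp add: subgraph_def small_Un)

text \<open>
  A chosen universal solution for each small graph \<open>B\<close> of elements: the module \<open>P B\<close> with generator
  \<open>\<eta> B\<close> in degree \<open>deg B\<close>. The component \<open>\<zeta> B g\<close> of the generator is the element of \<open>P B\<close> that stands for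
  the vertex \<open>g\<close>.
\<close>

definition graph_data where
  "graph_data B = (SOME (Q :: ('o, 'h, 'u) module, p, \<pi>, \<xi>). graph_module fst B Q p \<pi> \<xi>)"

definition P where "P B = fst (graph_data B)"
definition deg where "deg B = fst (snd (graph_data B))"
definition proj where "proj B = fst (snd (snd (graph_data B)))"
definition \<eta> where "\<eta> B = snd (snd (snd (graph_data B)))"

definition \<zeta> where "\<zeta> B = (\<lambda>g. Ar (P B) (deg B) (fst g) (proj B g) (\<eta> B))"

lemma graph_module_P:
  assumes "subgraph B"
  shows "graph_module fst B (P B) (deg B) (proj B) (\<eta> B)"
proof -
  have edges: "fst g \<in> Obj R \<and> fst g' \<in> Obj R \<and> f \<in> Hom R (fst g) (fst g')" if "(g, g', f) \<in> B" for g g' f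
    using assms that by (auto simp: subgraph_def Elt_def)
  obtain Q :: "('o, 'h, 'u) module" and p \<pi> \<xi> where "graph_module fst B Q p \<pi> \<xi>"
    using exists_graph_module[of B fst, OF small_arrows _ edges] assms unfolding subgraph_def by blast
  then have "case (Q, p, \<pi>, \<xi>) of (Q, p, \<pi>, \<xi>) \<Rightarrow> graph_module fst B Q p \<pi> \<xi>" by simp
  then have "case graph_data B of (Q, p, \<pi>, \<xi>) \<Rightarrow> graph_module fst B Q p \<pi> \<xi>"
    unfolding graph_data_def by (rule someI)
  then show ?thesis by (simp add: P_def deg_def proj_def \<eta>_def split_beta)
qed

lemma P_finitely_presented: "subgraph B \<Longrightarrow> finitely_presented R (P B)"
  using graph_module_P by (simp add: graph_module_def)

lemma P_preserving: "subgraph B \<Longrightarrow> elt_preserving (P B)"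
  using P_finitely_presented finitely_presented_elt_preserving by blast

lemma P_module: "subgraph B \<Longrightarrow> left_module R (P B)"
  using P_finitely_presented by (simp add: finitely_presented_def)

lemma P_product: "subgraph B \<Longrightarrow> is_product R (ends B) fst (deg B) (proj B)"
  using graph_module_P by (simp add: graph_module_def)

lemma \<eta>_in: "subgraph B \<Longrightarrow> \<eta> B \<in> elts (P B) (deg B)"
  using graph_module_P by (simp add: graph_module_def)

lemma \<eta>_generates:
  "\<lbrakk>subgraph B; z \<in> Obj R; a \<in> elts (P B) z\<rbrakk> \<Longrightarrow> \<exists>k\<in>Hom R (deg B) z. a = Ar (P B) (deg B) z k (\<eta> B)"
  using graph_module_P by (simp add: graph_module_def)

lemma compatible_\<zeta>: "subgraph B \<Longrightarrow> compatible fst B (P B) (\<zeta> B)"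
  using graph_module_P by (simp add: graph_module_def \<zeta>_def)

lemma \<zeta>_in: "\<lbrakk>subgraph B; g \<in> ends B\<rbrakk> \<Longrightarrow> \<zeta> B g \<in> elts (P B) (fst g)"
  using compatible_\<zeta> by (simp add: compatible_def)

lemma \<zeta>_edge: "\<lbrakk>subgraph B; (g, g', f) \<in> B\<rbrakk> \<Longrightarrow> Ar (P B) (fst g) (fst g') f (\<zeta> B g) = \<zeta> B g'"
  using compatible_\<zeta> by (fastforce simp: compatible_def)

lemma ends_edge: "(g, g', f) \<in> B \<Longrightarrow> g \<in> ends B" "(g, g', f) \<in> B \<Longrightarrow> g' \<in> ends B"
  by (auto simp: ends_def)

lemma P_hom:
  fixes N :: "('o, 'h, 'u) module"
  assumes "subgraph B" "left_module R N" "elt_preserving N" "compatible fst B N n"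
  shows "\<exists>t. t \<in> module_hom R (P B) N \<and> (\<forall>g\<in>ends B. t (fst g) (\<zeta> B g) = n g)"
  using graph_module_P[OF assms(1)] assms(2-4) unfolding graph_module_def \<zeta>_def by blast

lemma P_hom_eqI:
  assumes "subgraph B" "left_module R N" "elt_preserving N"
    and "s \<in> module_hom R (P B) N" "t \<in> module_hom R (P B) N"
    and "\<And>g. g \<in> ends B \<Longrightarrow> s (fst g) (\<zeta> B g) = t (fst g) (\<zeta> B g)"
  shows "s = t"
  using graph_module_hom_eqI[OF graph_module_P[OF assms(1)] _ assms(2-5)] assms(1,6)
  by (simp add: \<zeta>_def subgraph_def)

definition transition :: "_ \<Rightarrow> _ \<Rightarrow> 'o \<Rightarrow> 'u \<Rightarrow> 'u" where
  "transition B B' = (SOME t. t \<in> module_hom R (P B) (P B') \<and> (\<forall>g\<in>ends B. t (fst g) (\<zeta> B g) = \<zeta> B' g))"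

lemma transition:
  assumes "subgraph B" "subgraph B'" "B \<subseteq> B'"
  shows "transition B B' \<in> module_hom R (P B) (P B')"
    and "g \<in> ends B \<Longrightarrow> transition B B' (fst g) (\<zeta> B g) = \<zeta> B' g"
proof -
  have "compatible fst B (P B') (\<zeta> B')"
    using compatible_\<zeta>[OF assms(2)] assms(3) unfolding compatible_def ends_def by blast
  then have "\<exists>t. t \<in> module_hom R (P B) (P B') \<and> (\<forall>g\<in>ends B. t (fst g) (\<zeta> B g) = \<zeta> B' g)"
    using P_hom assms P_module P_preserving by blast
  from someI_ex[OF this] show "transition B B' \<in> module_hom R (P B) (P B')"
    "g \<in> ends B \<Longrightarrow> transition B B' (fst g) (\<zeta> B g) = \<zeta> B' g"
    by (simp_all add: transition_def)
qed

definition leg :: "_ \<Rightarrow> 'o \<Rightarrow> 'u \<Rightarrow> 'u" where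
  "leg B = (SOME t. t \<in> module_hom R (P B) M \<and> (\<forall>g\<in>ends B. t (fst g) (\<zeta> B g) = snd g))"

lemma leg:
  assumes "subgraph B"
  shows "leg B \<in> module_hom R (P B) M"
    and "g \<in> ends B \<Longrightarrow> leg B (fst g) (\<zeta> B g) = snd g"
proof -
  have "\<exists>t. t \<in> module_hom R (P B) M \<and> (\<forall>g\<in>ends B. t (fst g) (\<zeta> B g) = snd g)"
    using P_hom assms M M_preserving compatible_snd by blast
  from someI_ex[OF this] show "leg B \<in> module_hom R (P B) M"
    "g \<in> ends B \<Longrightarrow> leg B (fst g) (\<zeta> B g) = snd g"
    by (simp_all add: leg_def)
qed

text \<open>
  The graph of a diagram over \<open>M\<close> has as vertices the images in \<open>M\<close> of the generators \<open>\<xi> j\<close>, with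
  edges for the relation of each module and for the effect of each arrow of \<open>J\<close> on generators. Arrows
  \<open>u : i \<rightarrow> j\<close> of the diagram become edges from the vertex of \<open>j\<close> to that of \<open>i\<close>, since they express the
  image of \<open>\<xi> i\<close> as a multiple of \<open>\<xi> j\<close>. The module of this graph receives each \<open>Q j\<close> and maps to \<open>M\<close>.
\<close>

lemma filtered_category_comma:
  "filtered_category \<kappa> (comma (LMod R) {P. finitely_presented R P} M)" (is "filtered_category \<kappa> ?C")
  unfolding filtered_category_def
proof (intro allI impI, elim conjE)
  fix J :: "('l, 'l) cat" and D :: "('l, 'l, ('o, 'h, 'u) module \<times> ('o \<Rightarrow> 'u \<Rightarrow> 'u), 'o \<Rightarrow> 'u \<Rightarrow> 'u) ftor"
  assume J: "category J" and J_small: "|arrows J| <o \<kappa>" and D: "is_functor J ?C D"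
  define Q where "Q j = fst (Ob D j)" for j
  define \<phi> where "\<phi> j = snd (Ob D j)" for j
  have Ob_D: "Ob D j = (Q j, \<phi> j)" for j by (simp add: Q_def \<phi>_def)
  have "\<forall>j\<in>Obj J. Ob D j \<in> Obj ?C" using D by (simp add: is_functor_def)
  then have Q_fp: "finitely_presented R (Q j)" and \<phi>: "\<phi> j \<in> module_hom R (Q j) M" if "j \<in> Obj J" for j
    using that Ob_D[of j] by (auto simp: comma_simps)
  have Q_mod: "left_module R (Q j)" if "j \<in> Obj J" for j
    using Q_fp[OF that] by (simp add: finitely_presented_def)
  have "\<forall>i\<in>Obj J. \<forall>j\<in>Obj J. \<forall>u\<in>Hom J i j. Ar D i j u \<in> Hom ?C (Q i, \<phi> i) (Q j, \<phi> j)"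
    using D Ob_D by (simp add: is_functor_def)
  then have Du: "Ar D i j u \<in> module_hom R (Q i) (Q j)" "Cmp (LMod R) (Q i) (Q j) M (\<phi> j) (Ar D i j u) = \<phi> i"
    if "i \<in> Obj J" "j \<in> Obj J" "u \<in> Hom J i j" for i j u
    using that by (simp_all add: comma_simps)
  have "\<exists>x y f \<xi>. presents x y f (Q j) \<xi>" if "j \<in> Obj J" for j
    using Q_fp[OF that] unfolding finitely_presented_iff_presents .
  then obtain x y f \<xi> where pres: "\<And>j. j \<in> Obj J \<Longrightarrow> presents (x j) (y j) (f j) (Q j) (\<xi> j)" by metis
  note x = presentsD(2)[OF pres] and y = presentsD(3)[OF pres] and f = presentsD(4)[OF pres]
    and \<xi> = presentsD(5)[OF pres] and gen = presentsD(6)[OF pres]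
  have f\<xi>: "Ar (Q j) (x j) (y j) (f j) (\<xi> j) = \<one>\<^bsub>Ob (Q j) (y j)\<^esub>" if "j \<in> Obj J" for j
    using presents_relation[OF pres[OF that]] .
  define m where "m j = \<phi> j (x j) (\<xi> j)" for j
  have m: "m j \<in> elts M (x j)" if "j \<in> Obj J" for j
    unfolding m_def by (rule module_hom_in[OF \<phi>[OF that] x[OF that] \<xi>[OF that]])
  have fm: "Ar M (x j) (y j) (f j) (m j) = \<one>\<^bsub>Ob M (y j)\<^esub>" if "j \<in> Obj J" for j
    using module_hom_Ar[OF \<phi>[OF that] x[OF that] y[OF that] f[OF that] \<xi>[OF that]] f\<xi>[OF that]
      module_hom_one[OF \<phi>[OF that] y[OF that] Q_mod[OF that] M] by (simp add: m_def)
  have "\<forall>i j u. \<exists>g. i \<in> Obj J \<longrightarrow> j \<in> Obj J \<longrightarrow> u \<in> Hom J i j \<longrightarrow>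
      g \<in> Hom R (x j) (x i) \<and> Ar D i j u (x i) (\<xi> i) = Ar (Q j) (x j) (x i) g (\<xi> j)"
    using gen module_hom_in[OF Du(1) x \<xi>] x by metis
  then obtain g where g: "\<And>i j u. \<lbrakk>i \<in> Obj J; j \<in> Obj J; u \<in> Hom J i j\<rbrakk> \<Longrightarrow> g i j u \<in> Hom R (x j) (x i)"
    "\<And>i j u. \<lbrakk>i \<in> Obj J; j \<in> Obj J; u \<in> Hom J i j\<rbrakk> \<Longrightarrow> Ar D i j u (x i) (\<xi> i) = Ar (Q j) (x j) (x i) (g i j u) (\<xi> j)"
    by metis
  have gm: "Ar M (x j) (x i) (g i j u) (m j) = m i" if "i \<in> Obj J" "j \<in> Obj J" "u \<in> Hom J i j" for i j u
  proof -
    have "Ar M (x j) (x i) (g i j u) (m j) = \<phi> j (x i) (Ar D i j u (x i) (\<xi> i))"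
      using module_hom_Ar[OF \<phi>[OF that(2)] x[OF that(2)] x[OF that(1)] g(1)[OF that] \<xi>[OF that(2)]] g(2)[OF that]
      by (simp add: m_def)
    also have "\<dots> = m i"
      using fun_cong[OF fun_cong[OF Du(2)[OF that]], of "x i" "\<xi> i"] x[OF that(1)] \<xi>[OF that(1)] by (simp add: m_def)
    finally show ?thesis .
  qed
  \<comment> \<open>The zero arrows force the relation \<open>f j\<close> of \<open>Q j\<close> to hold at the vertex of \<open>j\<close>.\<close>
  define B where "B = (\<lambda>j. ((x j, m j), (y j, \<one>\<^bsub>Ob M (y j)\<^esub>), f j)) ` Obj J
    \<union> (\<lambda>j. ((x j, m j), (y j, \<one>\<^bsub>Ob M (y j)\<^esub>), Nul R (x j) (y j))) ` Obj J
    \<union> (\<lambda>(i, j, u). ((x j, m j), (x i, m i), g i j u)) ` arrows J"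
  have "|Obj J| <o \<kappa>"
    by (rule small_subset[OF small_image[OF J_small, of fst]])
       (use J in \<open>force simp: arrows_def category_def image_iff\<close>)
  then have "|B| <o \<kappa>" unfolding B_def by (intro small_Un small_image J_small)
  moreover have "B \<subseteq> Elt"
    using x y f m fm g gm Nul_in M.Ar_Nul by (auto simp: B_def Elt_def arrows_def)
  ultimately have B: "subgraph B" by (simp add: subgraph_def)
  interpret PB: lmodule R "P B" using P_module[OF B] by (rule lmodule)
  have edge1: "((x j, m j), (y j, \<one>\<^bsub>Ob M (y j)\<^esub>), f j) \<in> B"
    and edge2: "((x j, m j), (y j, \<one>\<^bsub>Ob M (y j)\<^esub>), Nul R (x j) (y j)) \<in> B" if "j \<in> Obj J" for j
    using that by (auto simp: B_def)
  have edge3: "((x j, m j), (x i, m i), g i j u) \<in> B" if "i \<in> Obj J" "j \<in> Obj J" "u \<in> Hom J i j" for i j u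
    using that by (force simp: B_def arrows_def)
  have \<zeta>_vertex: "\<zeta> B (x j, m j) \<in> elts (P B) (x j)" if "j \<in> Obj J" for j
    using \<zeta>_in[OF B ends_edge(1)[OF edge1[OF that]]] by simp
  have "Ar (P B) (x j) (y j) (f j) (\<zeta> B (x j, m j)) = \<one>\<^bsub>Ob (P B) (y j)\<^esub>" if "j \<in> Obj J" for j
    using \<zeta>_edge[OF B edge1[OF that]] \<zeta>_edge[OF B edge2[OF that]]
      PB.Ar_Nul[OF x[OF that] y[OF that] \<zeta>_vertex[OF that]] by simp
  then have "\<forall>j. \<exists>t. j \<in> Obj J \<longrightarrow> t \<in> module_hom R (Q j) (P B) \<and> t (x j) (\<xi> j) = \<zeta> B (x j, m j)"
    using presents_hom[OF pres P_module[OF B] \<zeta>_vertex] by metis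
  then obtain c where c: "\<And>j. j \<in> Obj J \<Longrightarrow> c j \<in> module_hom R (Q j) (P B)"
    "\<And>j. j \<in> Obj J \<Longrightarrow> c j (x j) (\<xi> j) = \<zeta> B (x j, m j)" by metis
  have "is_cocone J ?C D (P B, leg B) c"
    unfolding is_cocone_def
  proof (intro conjI ballI)
    show "(P B, leg B) \<in> Obj ?C"
      using P_finitely_presented[OF B] P_module[OF B] leg(1)[OF B] by (simp add: comma_simps)
  next
    fix j assume j: "j \<in> Obj J"
    have "Cmp (LMod R) (Q j) (P B) M (leg B) (c j) = \<phi> j"
    proof (rule presents_hom_eqI[OF pres[OF j] module_hom_Cmp[OF Q_mod[OF j] c(1)[OF j] leg(1)[OF B]] \<phi>[OF j]])
      show "Cmp (LMod R) (Q j) (P B) M (leg B) (c j) (x j) (\<xi> j) = \<phi> j (x j) (\<xi> j)"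
        using x[OF j] \<xi>[OF j] c(2)[OF j] leg(2)[OF B ends_edge(1)[OF edge1[OF j]]] by (simp add: m_def)
    qed
    then show "c j \<in> Hom ?C (Ob D j) (P B, leg B)"
      using c(1)[OF j] by (simp add: Ob_D comma_simps)
  next
    fix i j u assume ij: "i \<in> Obj J" "j \<in> Obj J" "u \<in> Hom J i j"
    have "Cmp (LMod R) (Q i) (Q j) (P B) (c j) (Ar D i j u) = c i"
    proof (rule presents_hom_eqI[OF pres[OF ij(1)] module_hom_Cmp[OF Q_mod[OF ij(1)] Du(1)[OF ij] c(1)[OF ij(2)]] c(1)[OF ij(1)]])
      have "c j (x i) (Ar D i j u (x i) (\<xi> i)) = Ar (P B) (x j) (x i) (g i j u) (\<zeta> B (x j, m j))"
        using module_hom_Ar[OF c(1)[OF ij(2)] x[OF ij(2)] x[OF ij(1)] g(1)[OF ij] \<xi>[OF ij(2)]] g(2)[OF ij] c(2)[OF ij(2)]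
        by simp
      also have "\<dots> = c i (x i) (\<xi> i)"
        using \<zeta>_edge[OF B edge3[OF ij]] c(2)[OF ij(1)] by simp
      finally show "Cmp (LMod R) (Q i) (Q j) (P B) (c j) (Ar D i j u) (x i) (\<xi> i) = c i (x i) (\<xi> i)"
        using x[OF ij(1)] \<xi>[OF ij(1)] by simp
    qed
    then show "Cmp ?C (Ob D i) (Ob D j) (P B, leg B) (c j) (Ar D i j u) = c i"
      by (simp add: Ob_D comma_simps)
  qed
  then show "\<exists>n c. is_cocone J ?C D n c" by blast
qed

lemma transition_refl:
  assumes B: "subgraph B"
  shows "transition B B = Id (LMod R) (P B)"
  by (rule P_hom_eqI[OF B P_module[OF B] P_preserving[OF B] transition(1)[OF B B subset_refl] module_hom_Id[OF P_module[OF B]]])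
     (simp add: transition(2)[OF B B subset_refl] subgraph_ends[OF B] \<zeta>_in[OF B])

lemma ends_mono: "\<lbrakk>B \<subseteq> B'; g \<in> ends B\<rbrakk> \<Longrightarrow> g \<in> ends B'"
  unfolding ends_def by blast

lemma transition_transition:
  assumes B: "subgraph B" "subgraph B'" "subgraph B''" and sub: "B \<subseteq> B'" "B' \<subseteq> B''"
  shows "transition B B'' = Cmp (LMod R) (P B) (P B') (P B'') (transition B' B'') (transition B B')"
  by (rule P_hom_eqI[OF B(1) P_module[OF B(3)] P_preserving[OF B(3)] transition(1)[OF B(1,3) subset_trans[OF sub]]
        module_hom_Cmp[OF P_module[OF B(1)] transition(1)[OF B(1,2) sub(1)] transition(1)[OF B(2,3) sub(2)]]])
     (simp add: transition(2)[OF B(1,3) subset_trans[OF sub]] transition(2)[OF B(1,2) sub(1)] transition(2)[OF B(2,3) sub(2)]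
        ends_mono[OF sub(1)] subgraph_ends[OF B(1)] \<zeta>_in[OF B(1)])

lemma leg_transition:
  assumes B: "subgraph B" "subgraph B'" and sub: "B \<subseteq> B'"
  shows "Cmp (LMod R) (P B) (P B') M (leg B') (transition B B') = leg B"
  by (rule P_hom_eqI[OF B(1) M M_preserving module_hom_Cmp[OF P_module[OF B(1)] transition(1)[OF B sub] leg(1)[OF B(2)]] leg(1)[OF B(1)]])
     (simp add: transition(2)[OF B sub] leg(2)[OF B(1)] leg(2)[OF B(2)] ends_mono[OF sub] subgraph_ends[OF B(1)] \<zeta>_in[OF B(1)])

text \<open>
  Every element \<open>k \<cdot> \<eta> B\<close> of \<open>P B\<close> becomes, at a later stage, the element that stands for its image in
  \<open>M\<close>. Add the image of \<open>\<eta> B\<close> as a vertex, with the projections as edges: they force \<open>\<eta> B\<close> to agree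
  with the element of this vertex, and one more edge \<open>k\<close> does the rest.
\<close>

lemma transition_eq_\<zeta>:
  assumes B: "subgraph B" and z: "z \<in> Obj R" and a: "a \<in> elts (P B) z"
  obtains B' where "subgraph B'" "B \<subseteq> B'" "(z, leg B z a) \<in> ends B'" "transition B B' z a = \<zeta> B' (z, leg B z a)"
proof -
  obtain k where k: "k \<in> Hom R (deg B) z" "a = Ar (P B) (deg B) z k (\<eta> B)" using \<eta>_generates[OF B z a] by blast
  note p = is_productD[OF P_product[OF B]]
  define w where "w = (deg B, leg B (deg B) (\<eta> B))"
  have w: "leg B (deg B) (\<eta> B) \<in> elts M (deg B)" by (rule module_hom_in[OF leg(1)[OF B] p(1) \<eta>_in[OF B]])
  define B' where "B' = B \<union> ((\<lambda>g. (w, g, proj B g)) ` ends B \<union> {(w, (z, leg B z a), k)})"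
  have "Ar M (deg B) (fst g) (proj B g) (snd w) = snd g" if "g \<in> ends B" for g
    using module_hom_Ar[OF leg(1)[OF B] p(1) p(2)[OF that] p(3)[OF that] \<eta>_in[OF B]] leg(2)[OF B that]
    by (simp add: w_def \<zeta>_def)
  then have "(\<lambda>g. (w, g, proj B g)) ` ends B \<subseteq> Elt"
    using p w by (auto simp: w_def Elt_def)
  moreover have "Ar M (deg B) z k (snd w) = leg B z a"
    using module_hom_Ar[OF leg(1)[OF B] p(1) z k(1) \<eta>_in[OF B]] k(2) by (simp add: w_def)
  then have "(w, (z, leg B z a), k) \<in> Elt" using p(1) z k w by (simp add: w_def Elt_def)
  moreover have "|{(w, (z, leg B z a), k)}| <o \<kappa>" by (rule small_finite) simp
  then have "|B'| <o \<kappa>"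
    using B unfolding B'_def subgraph_def by (intro small_Un small_image small_ends) simp_all
  ultimately have B': "subgraph B'"
    using B unfolding B'_def subgraph_def by simp
  have sub: "B \<subseteq> B'" by (auto simp: B'_def)
  have edges: "(w, g, proj B g) \<in> B'" if "g \<in> ends B" for g using that by (auto simp: B'_def)
  have edge_k: "(w, (z, leg B z a), k) \<in> B'" by (simp add: B'_def)
  note t = transition[OF B B' sub]
  have w_end: "\<zeta> B' w \<in> elts (P B') (deg B)"
    using \<zeta>_in[OF B' ends_edge(1)[OF edge_k]] by (simp add: w_def)
  have "transition B B' (deg B) (\<eta> B) = \<zeta> B' w"
  proof (rule elt_product_eqI[OF elt_preserving_product[OF P_preserving[OF B'] _ P_product[OF B]]])
    show "|ends B| <o \<kappa>" using B small_ends[of B] by (simp add: subgraph_def)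
    show "transition B B' (deg B) (\<eta> B) \<in> elts (P B') (deg B)" by (rule module_hom_in[OF t(1) p(1) \<eta>_in[OF B]])
    show "\<zeta> B' w \<in> elts (P B') (deg B)" by (rule w_end)
    fix g assume g: "g \<in> ends B"
    have *: "Ar (P B') (deg B) (fst g) (proj B g) (transition B B' (deg B) (\<eta> B)) = \<zeta> B' g"
      using module_hom_Ar[OF t(1) p(1) p(2)[OF g] p(3)[OF g] \<eta>_in[OF B]] t(2)[OF g] by (simp add: \<zeta>_def)
    then show "Ar (P B') (deg B) (fst g) (proj B g) (transition B B' (deg B) (\<eta> B)) \<in> elts (P B') (fst g)"
      using \<zeta>_in[OF B' ends_mono[OF sub g]] by simp
    show "Ar (P B') (deg B) (fst g) (proj B g) (transition B B' (deg B) (\<eta> B)) = Ar (P B') (deg B) (fst g) (proj B g) (\<zeta> B' w)"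
      using * \<zeta>_edge[OF B' edges[OF g]] by (simp add: w_def)
  qed
  then have "transition B B' z a = \<zeta> B' (z, leg B z a)"
    using module_hom_Ar[OF t(1) p(1) z k(1) \<eta>_in[OF B]] k(2) \<zeta>_edge[OF B' edge_k] by (simp add: w_def)
  then show thesis using that B' sub ends_edge(2)[OF edge_k] by blast
qed

definition loop :: "'o \<times> 'u \<Rightarrow> (('o \<times> 'u) \<times> ('o \<times> 'u) \<times> 'h) set" where
  "loop g = {(g, g, Id R (fst g))}"

lemma loop:
  assumes "x \<in> Obj R" "m \<in> elts M x"
  shows "subgraph (loop (x, m))" "(x, m) \<in> ends (loop (x, m))"
  using assms M.Ar_Id Id_in small_finite[of "loop (x, m)"] by (auto simp: loop_def subgraph_def Elt_def ends_def)

text \<open>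
  The existence half of the universal property of \<open>M\<close> as colimit of the modules \<open>P B\<close>: an element \<open>m\<close>
  goes to the image of the element that stands for it, at any stage that has it as a vertex. This
  is additive and natural because sums and multiples can be forced by further edges.
\<close>

lemma exists_hom_from_legs:
  fixes N :: "('o, 'h, 'u) module"
  assumes N: "left_module R N" and d: "\<And>B. subgraph B \<Longrightarrow> d B \<in> module_hom R (P B) N"
    and d_trans: "\<And>B B'. \<lbrakk>subgraph B; subgraph B'; B \<subseteq> B'\<rbrakk> \<Longrightarrow> Cmp (LMod R) (P B) (P B') N (d B') (transition B B') = d B"
  obtains h where "h \<in> module_hom R M N" "\<And>B. subgraph B \<Longrightarrow> Cmp (LMod R) (P B) M N h (leg B) = d B"
proof -
  interpret N: lmodule R N using N by (rule lmodule)
  have d_t: "d B' x (transition B B' x a) = d B x a"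
    if "subgraph B" "subgraph B'" "B \<subseteq> B'" "x \<in> Obj R" "a \<in> elts (P B) x" for B B' x a
    using fun_cong[OF fun_cong[OF d_trans[OF that(1-3)]], of x a] that by simp
  define h where "h = (\<lambda>x\<in>Obj R. \<lambda>m\<in>elts M x. d (loop (x, m)) x (\<zeta> (loop (x, m)) (x, m)))"
  have h: "h x m = d B x (\<zeta> B (x, m))" if B: "subgraph B" and g: "(x, m) \<in> ends B" for B x m
  proof -
    have x: "x \<in> Obj R" "m \<in> elts M x" using subgraph_ends[OF that] by simp_all
    note l = loop[OF x]
    have B': "subgraph (B \<union> loop (x, m))" by (rule subgraph_Un[OF B l(1)])
    have "d B x (\<zeta> B (x, m)) = d (B \<union> loop (x, m)) x (\<zeta> (B \<union> loop (x, m)) (x, m))"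
      using d_t[OF B B' _ x(1), of "\<zeta> B (x, m)"] transition(2)[OF B B' _ g] \<zeta>_in[OF B g] by simp
    also have "\<dots> = d (loop (x, m)) x (\<zeta> (loop (x, m)) (x, m))"
      using d_t[OF l(1) B' _ x(1), of "\<zeta> (loop (x, m)) (x, m)"] transition(2)[OF l(1) B' _ l(2)] \<zeta>_in[OF l] by simp
    finally show ?thesis using x by (simp add: h_def)
  qed
  have "h \<in> module_hom R M N"
  proof (rule module_homI)
    fix x m assume x: "x \<in> Obj R" and m: "m \<in> elts M x"
    show "h x m \<in> elts N x"
      using h[OF loop[OF x m]] module_hom_in[OF d[OF loop(1)[OF x m]] x] \<zeta>_in[OF loop[OF x m]] by simp
  next
    fix x m m' assume x: "x \<in> Obj R" and m: "m \<in> elts M x" "m' \<in> elts M x"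
    \<comment> \<open>Both elements and their sum are images of one element over the product of two copies of \<open>x\<close>.\<close>
    have bool_small: "|UNIV :: bool set| <o \<kappa>" by (rule small_finite) simp
    then obtain q \<rho> where q: "is_product R (UNIV :: bool set) (\<lambda>_. x) q \<rho>"
      by (rule small_product_exists) (rule x)
    note qs = is_productD[OF q]
    have \<rho>: "\<rho> b \<in> Hom R q x" for b using qs(3) by simp
    obtain n where n: "n \<in> elts M q" "\<And>b. Ar M q x (\<rho> b) n = (if b then m else m')"
    proof (rule elt_productE[OF elt_preserving_product[OF M_preserving bool_small q], of "\<lambda>b. if b then m else m'"])
      show "(if b then m else m') \<in> elts M x" for b using m by simp
    qed (rule that, assumption, blast)
    let ?s = "m \<otimes>\<^bsub>Ob M x\<^esub> m'" and ?r = "Plus R q x (\<rho> True) (\<rho> False)"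
    define B where "B = {((q, n), (x, m), \<rho> True), ((q, n), (x, m'), \<rho> False), ((q, n), (x, ?s), ?r)}"
    have "|B| <o \<kappa>" by (rule small_finite) (simp add: B_def)
    moreover have "B \<subseteq> Elt"
      using qs(1) x \<rho> n Plus_in M.Ar_Plus[OF qs(1) x \<rho> \<rho> n(1)] by (auto simp: B_def Elt_def)
    ultimately have B: "subgraph B" by (simp add: subgraph_def)
    have e: "((q, n), (x, m), \<rho> True) \<in> B" "((q, n), (x, m'), \<rho> False) \<in> B" "((q, n), (x, ?s), ?r) \<in> B"
      by (simp_all add: B_def)
    interpret PB: lmodule R "P B" using P_module[OF B] by (rule lmodule)
    have \<zeta>n: "\<zeta> B (q, n) \<in> elts (P B) q" using \<zeta>_in[OF B ends_edge(1)[OF e(1)]] by simp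
    have "\<zeta> B (x, ?s) = \<zeta> B (x, m) \<otimes>\<^bsub>Ob (P B) x\<^esub> \<zeta> B (x, m')"
      using \<zeta>_edge[OF B e(1)] \<zeta>_edge[OF B e(2)] \<zeta>_edge[OF B e(3)] PB.Ar_Plus[OF qs(1) x \<rho> \<rho> \<zeta>n] by simp
    then show "h x ?s = h x m \<otimes>\<^bsub>Ob N x\<^esub> h x m'"
      using h[OF B ends_edge(2)[OF e(1)]] h[OF B ends_edge(2)[OF e(2)]] h[OF B ends_edge(2)[OF e(3)]]
        module_hom_mult[OF d[OF B] x] \<zeta>_in[OF B ends_edge(2)[OF e(1)]] \<zeta>_in[OF B ends_edge(2)[OF e(2)]] by simp
  next
    fix x y f m assume x: "x \<in> Obj R" "y \<in> Obj R" "f \<in> Hom R x y" and m: "m \<in> elts M x"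
    define B where "B = {((x, m), (y, Ar M x y f m), f)}"
    have B: "subgraph B" using x m small_finite[of B] by (auto simp: B_def subgraph_def Elt_def)
    have e: "((x, m), (y, Ar M x y f m), f) \<in> B" by (simp add: B_def)
    show "h y (Ar M x y f m) = Ar N x y f (h x m)"
      using h[OF B ends_edge(1)[OF e]] h[OF B ends_edge(2)[OF e]] \<zeta>_edge[OF B e]
        module_hom_Ar[OF d[OF B] x, of "\<zeta> B (x, m)"] \<zeta>_in[OF B ends_edge(1)[OF e]] by simp
  qed (simp_all add: h_def)
  moreover have "Cmp (LMod R) (P B) M N h (leg B) = d B" if B: "subgraph B" for B
  proof (rule module_hom_eqI[OF module_hom_Cmp[OF P_module[OF B] leg(1)[OF B] \<open>h \<in> _\<close>] d[OF B]])
    fix z a assume z: "z \<in> Obj R" and a: "a \<in> elts (P B) z"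
    obtain B' where B': "subgraph B'" "B \<subseteq> B'" "(z, leg B z a) \<in> ends B'" "transition B B' z a = \<zeta> B' (z, leg B z a)"
      by (rule transition_eq_\<zeta>[OF B z a])
    show "Cmp (LMod R) (P B) M N h (leg B) z a = d B z a"
      using d_t[OF B B'(1,2) z a] B'(4) h[OF B'(1,3)] z a by simp
  qed
  ultimately show thesis by (rule that)
qed

lemma hom_from_M_eqI:
  assumes st: "s \<in> module_hom R M N" "t \<in> module_hom R M N"
    and eq: "\<And>B. subgraph B \<Longrightarrow> Cmp (LMod R) (P B) M N s (leg B) = Cmp (LMod R) (P B) M N t (leg B)"
  shows "s = t"
proof (rule module_hom_eqI[OF st])
  fix x m assume x: "x \<in> Obj R" and m: "m \<in> elts M x"
  note l = loop[OF x m]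
  show "s x m = t x m"
    using fun_cong[OF fun_cong[OF eq[OF l(1)]], of x "\<zeta> (loop (x, m)) (x, m)"] x \<zeta>_in[OF l] leg(2)[OF l] by simp
qed

end

section \<open>The directed colimit and the equivalence\<close>

text \<open>
  Otherwise functions from a copy of \<open>'u\<close> to \<open>'u\<close> would be as few as the elements of \<open>'u\<close>, against
  Cantor's theorem.
\<close>

lemma universe_bounds_cardinal:
  fixes \<kappa> :: "'l rel"
  assumes U: "universe \<kappa> (UNIV :: 'u set)" and \<kappa>: "Card_order \<kappa>"
  shows "|Field \<kappa>| \<le>o |UNIV :: 'u set|"
proof (rule ccontr)
  assume "\<not> ?thesis"
  then have "|UNIV :: 'u set| <o |Field \<kappa>|" by (simp add: not_ordLeq_iff_ordLess card_of_Well_order)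
  then obtain b :: "'u \<Rightarrow> 'l" where b: "inj b" and small: "|UNIV :: 'u set| <o \<kappa>"
    using card_of_ordLeq[of "UNIV :: 'u set" "Field \<kappa>"] ordLess_imp_ordLeq
      ordLess_ordIso_trans[OF _ card_of_Field_ordIso[OF \<kappa>]] by blast
  have inf: "infinite (UNIV :: 'u set)" using U by (simp add: universe_def)
  obtain u0 u1 :: 'u where "u0 \<noteq> u1" using inf by (metis finite.simps UNIV_I finite_subset singletonI subsetI)
  have "|range b| <o \<kappa>" using small card_of_image ordLeq_ordLess_trans by blast
  then have bound: "|range b \<rightarrow>\<^sub>E (UNIV :: 'u set)| \<le>o |UNIV :: 'u set|"
    using U by (simp add: universe_def)
  define \<chi> where "\<chi> X = (\<lambda>s\<in>range b. if s \<in> b ` X then u0 else u1)" for X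
  have "X \<subseteq> Y" if "\<chi> X = \<chi> Y" for X Y
  proof
    fix x assume "x \<in> X"
    then show "x \<in> Y"
      using fun_cong[OF that, of "b x"] \<open>u0 \<noteq> u1\<close> b by (auto simp: \<chi>_def inj_image_mem_iff split: if_splits)
  qed
  then have "inj \<chi>" by (metis injI subset_antisym)
  then have "|Pow (UNIV :: 'u set)| \<le>o |range b \<rightarrow>\<^sub>E (UNIV :: 'u set)|"
    using card_of_ordLeq[of "Pow (UNIV :: 'u set)" "range b \<rightarrow>\<^sub>E (UNIV :: 'u set)"]
    by (auto simp: \<chi>_def intro!: exI[of _ \<chi>])
  then have "|Pow (UNIV :: 'u set)| \<le>o |UNIV :: 'u set|" using bound ordLeq_transitive by blast
  then show False using card_of_Pow[of "UNIV :: 'u set"] not_ordLess_ordLeq by blast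
qed

text \<open>A set of size below \<open>\<kappa>\<close> is the image of an initial segment of \<open>\<kappa>\<close>.\<close>

lemma card_small_subsets:
  fixes \<kappa> :: "'l rel"
  assumes U: "universe \<kappa> (UNIV :: 'u set)" and \<kappa>: "Card_order \<kappa>" and A: "|A| \<le>o |UNIV :: 'u set|"
  shows "|{B. B \<subseteq> A \<and> |B| <o \<kappa>}| \<le>o |UNIV :: 'u set|"
proof -
  obtain e :: "_ \<Rightarrow> 'u" where e: "inj_on e A" using A card_of_ordLeq[of A "UNIV :: 'u set"] by blast
  let ?F = "SIGMA a:Field \<kappa>. underS \<kappa> a \<rightarrow>\<^sub>E (UNIV :: 'u set)"
  let ?\<Phi> = "\<lambda>(a, f). {z \<in> A. e z \<in> f ` underS \<kappa> a}"
  have "{B. B \<subseteq> A \<and> |B| <o \<kappa>} \<subseteq> ?\<Phi> ` ?F"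
  proof
    fix B assume "B \<in> {B. B \<subseteq> A \<and> |B| <o \<kappa>}"
    then have B: "B \<subseteq> A" "|B| <o \<kappa>" by auto
    obtain a where a: "a \<in> Field \<kappa>" "|B| =o Restr \<kappa> (underS \<kappa> a)"
      using B(2) ordLess_iff_ordIso_Restr[OF card_order_on_well_order_on[OF \<kappa>] card_of_Well_order, of B] by blast
    have wo: "Well_order \<kappa>" using \<kappa> by (rule card_order_on_well_order_on)
    then have "wo_rel.ofilter \<kappa> (underS \<kappa> a)" by (simp add: wo_rel_def wo_rel.underS_ofilter)
    then have "Field (Restr \<kappa> (underS \<kappa> a)) = underS \<kappa> a" using wo Field_Restr_ofilter by blast
    then have "|underS \<kappa> a| =o |B|" using card_of_cong[OF a(2)] by (simp add: Field_card_of ordIso_symmetric)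
    then obtain g where g: "bij_betw g (underS \<kappa> a) B" using card_of_ordIso by blast
    define f where "f = (\<lambda>s\<in>underS \<kappa> a. e (g s))"
    have "f ` underS \<kappa> a = e ` B" using g by (auto simp: f_def bij_betw_def image_iff)
    then have "B = ?\<Phi> (a, f)" using B(1) e by (auto dest: inj_onD)
    then show "B \<in> ?\<Phi> ` ?F" using a(1) by (intro image_eqI[of _ _ "(a, f)"]) (auto simp: f_def)
  qed
  then have "|{B. B \<subseteq> A \<and> |B| <o \<kappa>}| \<le>o |?F|"
    by (rule ordLeq_transitive[OF card_of_mono1 card_of_image])
  moreover have "|?F| \<le>o |UNIV :: 'u set|"
  proof (rule card_of_Sigma_ordLeq_infinite)
    show "infinite (UNIV :: 'u set)" using U by (simp add: universe_def)
    show "|Field \<kappa>| \<le>o |UNIV :: 'u set|" by (rule universe_bounds_cardinal[OF U \<kappa>])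
    show "\<forall>a\<in>Field \<kappa>. |underS \<kappa> a \<rightarrow>\<^sub>E (UNIV :: 'u set)| \<le>o |UNIV :: 'u set|"
      using U card_of_underS[OF \<kappa>] by (simp add: universe_def)
  qed
  ultimately show ?thesis by (rule ordLeq_transitive)
qed

context element_graphs
begin

lemma card_Elt:
  assumes "infinite (UNIV :: 'u set)"
  shows "|Elt| \<le>o |UNIV :: 'u set|"
proof -
  have "inj_on (\<lambda>(g, g', f). ((fst g, fst g', f), snd g)) Elt"
    by (auto simp: inj_on_def Elt_def)
  moreover have "(\<lambda>(g, g', f). ((fst g, fst g', f), snd g)) ` Elt \<subseteq> arrows R \<times> UNIV"
    by (auto simp: Elt_def arrows_def)
  ultimately have "|Elt| \<le>o |arrows R \<times> (UNIV :: 'u set)|" using card_of_ordLeq by blast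
  also have "|arrows R \<times> (UNIV :: 'u set)| \<le>o |UNIV :: 'u set|"
    using small_arrows assms by (intro card_of_Sigma_ordLeq_infinite) (auto intro: card_of_mono1)
  finally show ?thesis .
qed

lemma subgraph_Union:
  assumes reg: "regularCard \<kappa>" and S: "|S| <o \<kappa>" and F: "\<And>s. s \<in> S \<Longrightarrow> subgraph (F s)"
  shows "subgraph (\<Union>s\<in>S. F s)"
proof -
  have "stable \<kappa>" using regularCard_stable Card_order cinfinite reg by (auto simp: cinfinite_def)
  then have "|\<Union>s\<in>S. F s| <o \<kappa>" using stable_UNION S F by (auto simp: subgraph_def)
  then show ?thesis using F by (auto simp: subgraph_def)
qed

text \<open>
  The index set consists of the small graphs of elements of \<open>M\<close>, coded in \<open>'u\<close>; they are directed
  under inclusion as \<open>\<kappa>\<close> is regular.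
\<close>

lemma directed_colimit_of_subgraphs:
  assumes reg: "regularCard \<kappa>" and U: "universe \<kappa> (UNIV :: 'u set)"
  shows "directed_colimit_of_fp \<kappa> R M"
proof -
  have "infinite (UNIV :: 'u set)" using U by (simp add: universe_def)
  then have "|{B. subgraph B}| \<le>o |UNIV :: 'u set|"
    unfolding subgraph_def by (intro card_small_subsets[OF U Card_order] card_Elt)
  then obtain \<iota> :: "_ \<Rightarrow> 'u" where \<iota>: "inj_on \<iota> (Collect subgraph)"
    using card_of_ordLeq[of "Collect subgraph" "UNIV :: 'u set"] by blast
  define I where "I = \<iota> ` Collect subgraph"
  define G where "G = the_inv_into (Collect subgraph) \<iota>"
  define r where "r = {(i, j). i \<in> I \<and> j \<in> I \<and> G i \<subseteq> G j}"
  define D :: "('u, unit, ('o, 'h, 'u) module, 'o \<Rightarrow> 'u \<Rightarrow> 'u) ftor"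
    where "D = \<lparr>Ob = (\<lambda>i. P (G i)), Ar = (\<lambda>i j _. transition (G i) (G j))\<rparr>"
  have G: "subgraph (G i)" if "i \<in> I" for i
    using that \<iota> by (auto simp: I_def G_def the_inv_into_f_f)
  have G_\<iota>: "\<iota> B \<in> I" "G (\<iota> B) = B" if "subgraph B" for B
    using that \<iota> by (auto simp: I_def G_def the_inv_into_f_f)
  have \<iota>_G: "\<iota> (G i) = i" if "i \<in> I" for i
    using that \<iota> by (auto simp: I_def G_def the_inv_into_f_f)
  have poset: "directed_poset \<kappa> I r"
    unfolding directed_poset_def
  proof (intro conjI allI impI)
    have "i = j" if "i \<in> I" "j \<in> I" "G i = G j" for i j using that \<iota>_G by metis
    then show "partial_order_on I r"
      unfolding partial_order_on_def preorder_on_def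
      by (auto simp: r_def refl_on_def intro!: transI antisymI)
    fix S assume S: "S \<subseteq> I" "|S| <o \<kappa>"
    have B: "subgraph (\<Union>s\<in>S. G s)" using S G by (intro subgraph_Union[OF reg]) auto
    show "\<exists>u\<in>I. \<forall>s\<in>S. (s, u) \<in> r"
      using G_\<iota>[OF B] S(1) by (intro bexI[of _ "\<iota> (\<Union>s\<in>S. G s)"]) (auto simp: r_def)
  qed
  have D_simps: "Ob D i = P (G i)" "Ar D i j u = transition (G i) (G j)" for i j u
    by (simp_all add: D_def)
  have r: "i \<in> I" "j \<in> I" "G i \<subseteq> G j" if "(i, j) \<in> r" for i j using that by (simp_all add: r_def)
  have "is_functor (poset_cat I r) (LMod R) D"
    unfolding is_functor_def D_simps
  proof (intro conjI ballI; (unfold poset_cat_simps)?)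
    show "P (G i) \<in> Obj (LMod R)" if "i \<in> I" for i using P_module[OF G[OF that]] by simp
    show "transition (G i) (G j) \<in> Hom (LMod R) (P (G i)) (P (G j))" if "(i, j) \<in> r" for i j
      using transition(1)[OF G G] r[OF that] by simp
    show "transition (G i) (G i) = Id (LMod R) (P (G i))" if "i \<in> I" for i by (rule transition_refl[OF G[OF that]])
    show "transition (G i) (G k) = Cmp (LMod R) (P (G i)) (P (G j)) (P (G k)) (transition (G j) (G k)) (transition (G i) (G j))"
      if "(i, j) \<in> r" "(j, k) \<in> r" for i j k
      using that r G by (intro transition_transition) blast+
  qed
  moreover have "is_colimit (poset_cat I r) (LMod R) D M (\<lambda>i. leg (G i))"
    unfolding is_colimit_def
  proof (intro conjI allI impI)
    show "is_cocone (poset_cat I r) (LMod R) D M (\<lambda>i. leg (G i))"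
      unfolding is_cocone_def D_simps using M leg(1)[OF G] leg_transition[OF G G] r by simp
  next
    fix N d assume cocone: "is_cocone (poset_cat I r) (LMod R) D N d"
    then have N: "left_module R N" and d: "\<And>i. i \<in> I \<Longrightarrow> d i \<in> module_hom R (P (G i)) N"
      and d_trans: "\<And>i j. \<lbrakk>i \<in> I; j \<in> I; (i, j) \<in> r\<rbrakk> \<Longrightarrow> Cmp (LMod R) (P (G i)) (P (G j)) N (d j) (transition (G i) (G j)) = d i"
      by (auto simp: is_cocone_def D_simps)
    obtain h where h: "h \<in> module_hom R M N" "\<And>B. subgraph B \<Longrightarrow> Cmp (LMod R) (P B) M N h (leg B) = d (\<iota> B)"
    proof (rule exists_hom_from_legs[OF N, of "\<lambda>B. d (\<iota> B)"])
      show "d (\<iota> B) \<in> module_hom R (P B) N" if "subgraph B" for B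
        using d[OF G_\<iota>(1)[OF that]] G_\<iota>(2)[OF that] by simp
      show "Cmp (LMod R) (P B) (P B') N (d (\<iota> B')) (transition B B') = d (\<iota> B)"
        if "subgraph B" "subgraph B'" "B \<subseteq> B'" for B B'
        using d_trans[of "\<iota> B" "\<iota> B'"] G_\<iota>[OF that(1)] G_\<iota>[OF that(2)] that(3) by (simp add: r_def)
    qed (rule that)
    show "\<exists>!h. h \<in> Hom (LMod R) M N \<and> (\<forall>i\<in>Obj (poset_cat I r). Cmp (LMod R) (Ob D i) M N h (leg (G i)) = d i)"
    proof (rule ex1I[of _ h])
      show "h \<in> Hom (LMod R) M N \<and> (\<forall>i\<in>Obj (poset_cat I r). Cmp (LMod R) (Ob D i) M N h (leg (G i)) = d i)"
        using h(1) h(2)[OF G] \<iota>_G by (simp add: D_simps)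
      fix h' assume "h' \<in> Hom (LMod R) M N \<and> (\<forall>i\<in>Obj (poset_cat I r). Cmp (LMod R) (Ob D i) M N h' (leg (G i)) = d i)"
      then have h': "h' \<in> module_hom R M N" "\<And>i. i \<in> I \<Longrightarrow> Cmp (LMod R) (P (G i)) M N h' (leg (G i)) = d i"
        by (simp_all add: D_simps)
      show "h' = h"
      proof (rule hom_from_M_eqI[OF h'(1) h(1)])
        show "Cmp (LMod R) (P B) M N h' (leg B) = Cmp (LMod R) (P B) M N h (leg B)" if "subgraph B" for B
          using h'(2)[OF G_\<iota>(1)[OF that]] G_\<iota>(2)[OF that] h(2)[OF that] by simp
      qed
    qed
  qed
  moreover have "\<forall>i\<in>I. finitely_presented R (Ob D i)"
    using P_finitely_presented[OF G] by (simp add: D_simps)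
  ultimately show ?thesis
    unfolding directed_colimit_of_fp_def using poset by blast
qed

end

theorem corollary2p19:
  fixes \<kappa> :: "'l rel"
    and R :: "('o, 'h) acat"
    and M :: "('o, 'h, 'u) module"
  assumes "cinfinite \<kappa>" and "Card_order \<kappa>" and "regularCard \<kappa>"
    and "universe \<kappa> (UNIV :: 'u set)"
    and "small_category (UNIV :: 'u set) R"
    and "additive_category R"
    and "has_small_products \<kappa> R"
    and "left_module R M"
  shows "(preserves_small_products \<kappa> R Ab M \<longleftrightarrow>
          filtered_category \<kappa> (comma (LMod R) {P. finitely_presented R P} M)) \<and>
         (filtered_category \<kappa> (comma (LMod R) {P. finitely_presented R P} M) \<longleftrightarrow>
          directed_colimit_of_fp \<kappa> R M)"
proof -
  interpret small_product_cat R \<kappa>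
    using assms by unfold_locales (simp_all add: additive_category_def)
  have inf: "infinite (UNIV :: 'u set)" using assms(4) by (simp add: universe_def)
  have small: "|arrows R| \<le>o |UNIV :: 'u set|" using assms(5) by (simp add: small_category_def)
  have a: "preserves_small_products \<kappa> R Ab M \<longleftrightarrow> elt_preserving M"
    by (rule preserves_small_products_iff[OF inf assms(8)])
  have ab: "filtered_category \<kappa> (comma (LMod R) {P. finitely_presented R P} M)"
    and ac: "directed_colimit_of_fp \<kappa> R M" if "elt_preserving M"
  proof -
    interpret element_graphs R \<kappa> M
      using small assms(8) that by unfold_locales
    show "filtered_category \<kappa> (comma (LMod R) {P. finitely_presented R P} M)"
      by (rule filtered_category_comma)
    show "directed_colimit_of_fp \<kappa> R M"
      by (rule directed_colimit_of_subgraphs[OF assms(3,4)])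
  qed
  have ba: "elt_preserving M" if "filtered_category \<kappa> (comma (LMod R) {P. finitely_presented R P} M)"
    by (rule filtered_comma_elt_preserving[OF small assms(8) that])
  have ca: "elt_preserving M" if colim_fp: "directed_colimit_of_fp \<kappa> R M"
  proof -
    obtain I :: "'u set" and r D c where I: "directed_poset \<kappa> I r" "is_functor (poset_cat I r) (LMod R) D"
      and fp: "\<forall>i\<in>I. finitely_presented R (Ob D i)" and colim: "is_colimit (poset_cat I r) (LMod R) D M c"
      using colim_fp unfolding directed_colimit_of_fp_def by blast
    have "|I \<times> (UNIV :: 'u set)| \<le>o |UNIV :: 'u set|"
      using inf by (intro card_of_Sigma_ordLeq_infinite) (auto intro: card_of_mono1)
    then show ?thesis
      using fp finitely_presented_elt_preserving by (intro directed_colimit_elt_preserving[OF _ I _ colim]) auto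
  qed
  show ?thesis using a ab ac ba ca by blast
qed

end
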